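(* Let $N \in \mathbb{Z}_{\geq 1}$, let $t = 1/p$, and let $$X^{(N)}(\tau) := U_{P(\tau)}\,\mathrm{diag}(p,1,\ldots,1)\,V_{P(\tau)} \cdots U_1\,\mathrm{diag}(p,1,\ldots,1)\,V_1, \qquad \tau \in \mathbb{R}_{\geq 0},$$ where $P(\tau)$ is a rate $1$ Poisson process (started at $0$), $U_i, V_i$ ($i \geq 1$) are distributed by the Haar probability measure on $\mathrm{GL}_N(\mathbb{Z}_p)$, all of these are independent, and $\mathrm{diag}(p,1,\ldots,1)$ is $N\times N$. Then $$\mathrm{SN}\left(X^{(N)}(\tau)\right) = \mathcal{S}^{(N)}\left(\left(\frac{1}{t}\,\frac{1-t}{1-t^N}\right)\tau\right)$$ in multi-time distribution (i.e. the two $\mathrm{Sig}_N$-valued processes indexed by $\tau \geq 0$ have the same joint distributions at any finite collection of times), where $\mathcal{S}^{(N)}$ is the reflected Poisson walk with parameter $t=1/p$.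
   Context: Fix a prime $p$; $\mathbb{Q}_p$ and $\mathbb{Z}_p$ are the $p$-adic numbers and $p$-adic integers. $\mathrm{Sig}_N := \{(\lambda_1,\ldots,\lambda_N) \in \mathbb{Z}^N : \lambda_1 \geq \cdots \geq \lambda_N\}$. For $A \in \mathrm{GL}_N(\mathbb{Q}_p)$ there is a unique $\lambda \in \mathrm{Sig}_N$ such that $A = U\,\mathrm{diag}(p^{\lambda_1},\ldots,p^{\lambda_N})V$ for some $U,V \in \mathrm{GL}_N(\mathbb{Z}_p)$; write $\mathrm{SN}(A) := \lambda$. For a parameter $t \in (0,1)$, the reflected Poisson walk $\mathcal{S}^{(N)}(\tau) = (\mathcal{S}^{(N)}_1(\tau),\ldots,\mathcal{S}^{(N)}_N(\tau))$ is the continuous-time Markov process on $\mathrm{Sig}_N$ with initial condition $\mathcal{S}^{(N)}(0) = (0,\ldots,0)$ and the following dynamics: for each $1 \leq i \leq N$, $\mathcal{S}^{(N)}_i$ has an independent exponential clock of rate $t^i$; when the clock associated to $\mathcal{S}^{(N)}_i$ rings, $\mathcal{S}^{(N)}_i$ increases by $1$ if the resulting $N$-tuple is still weakly decreasing. If not, then $\mathcal{S}^{(N)}_{i-d}$ increases by $1$ instead and $\mathcal{S}^{(N)}_i$ remains the same, where $d \geq 0$ is the smallest nonnegative integer such that the resulting tuple is weakly decreasing. Equivalently, $\mathcal{S}^{(N)}$ is the Markov process started at $(0,\ldots,0)$ with generator $B(\kappa,\nu)$, $\kappa,\nu\in\mathrm{Sig}_N$, given by $B(\kappa,\kappa) =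 -t\frac{1-t^N}{1-t}$; $B(\kappa,\nu) = t^\ell\frac{1-t^{m}}{1-t}$ if $\nu = \kappa + \vec{e}_\ell$ for some $1\le \ell\le N$ (with $\vec e_\ell$ the $\ell$-th standard basis vector), where $m = \#\{j : \kappa_j = \kappa_\ell\}$; and $B(\kappa,\nu) = 0$ otherwise. In the product defining $X^{(N)}(\tau)$, the empty product (when $P(\tau)=0$) is the identity. *)

theory Defs
  imports
    "HOL-Probability.Probability"
    "HOL-Computational_Algebra.Polynomial_Factorial"
    "Berlekamp_Zassenhaus.Finite_Field"
    "Jordan_Normal_Form.Matrix"
begin

section \<open>The \<open>p\<close>-adic integers and numbers\<close>

text \<open>
  The prime \<open>p\<close> is the cardinality of the type parameter \<open>'p\<close>.  The \<open>p\<close>-adic integers are the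
  inverse limit of the rings of integers modulo \<open>p ^ n\<close>, each residue class being represented by
  its least nonnegative element.  The condition below also forces \<open>x n\<close> to lie in
  \<open>{0..<p ^ n}\<close>, because it is a remainder modulo \<open>p ^ n\<close>.
\<close>

typedef (overloaded) ('p::prime_card) padic_int =
  "{x :: nat \<Rightarrow> int. \<forall>n. x (Suc n) mod (int CARD('p) ^ n) = x n}"
  by (rule exI[of _ "\<lambda>_. 0"]) simp

setup_lifting type_definition_padic_int

lemma mod_tower_op:
  fixes p :: int
  shows "(a mod p ^ Suc n) mod p ^ n = a mod p ^ n"
  by (simp add: mod_mod_cancel)

instantiation padic_int :: (prime_card) comm_ring_1
begin

lift_definition zero_padic_int :: "'a padic_int" is "\<lambda>_. 0"
  by simp

lift_definition one_padic_int :: "'a padic_int" is "\<lambda>n. 1 mod int CARD('a) ^ n"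
  using mod_tower_op by blast

lift_definition plus_padic_int :: "'a padic_int \<Rightarrow> 'a padic_int \<Rightarrow> 'a padic_int"
  is "\<lambda>x y n. (x n + y n) mod int CARD('a) ^ n"
  by (metis mod_add_eq mod_tower_op)

lift_definition uminus_padic_int :: "'a padic_int \<Rightarrow> 'a padic_int"
  is "\<lambda>x n. (- x n) mod int CARD('a) ^ n"
  by (metis mod_minus_eq mod_tower_op)

lift_definition minus_padic_int :: "'a padic_int \<Rightarrow> 'a padic_int \<Rightarrow> 'a padic_int"
  is "\<lambda>x y n. (x n - y n) mod int CARD('a) ^ n"
  by (metis mod_diff_eq mod_tower_op)

lift_definition times_padic_int :: "'a padic_int \<Rightarrow> 'a padic_int \<Rightarrow> 'a padic_int"
  is "\<lambda>x y n. (x n * y n) mod int CARD('a) ^ n"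
  by (metis mod_mult_eq mod_tower_op)

instance
proof
  have m: "x n mod int CARD('a) ^ n = x n"
    if "\<forall>n. x (Suc n) mod int CARD('a) ^ n = x n" for x :: "nat \<Rightarrow> int" and n
    using that by (metis mod_mod_trivial)
  fix a b c :: "'a padic_int"
  show "a * b * c = a * (b * c)"
    by transfer (simp add: fun_eq_iff mod_simps mult.assoc)
  show "a * b = b * a"
    by transfer (simp add: mult.commute)
  show "1 * a = a"
    by transfer (simp add: fun_eq_iff mod_simps m)
  show "a + b + c = a + (b + c)"
    by transfer (simp add: fun_eq_iff mod_simps add.assoc)
  show "a + b = b + a"
    by transfer (simp add: add.commute)
  show "0 + a = a"
    by transfer (simp add: fun_eq_iff m)
  show "- a + a = 0"
    by transfer (simp add: fun_eq_iff mod_simps)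
  show "a - b = a + - b"
    by transfer (simp add: fun_eq_iff mod_simps)
  show "(a + b) * c = a * c + b * c"
    by transfer (simp add: fun_eq_iff mod_simps distrib_right)
  have "(1::int) mod int CARD('a) ^ 1 \<noteq> 0"
    using prime_gt_1_int[OF prime_card_int[where 'a = 'a]] by simp
  then show "(0::'a padic_int) \<noteq> 1"
    by transfer metis
qed

end

lemma padic_int_rep_mod:
  assumes "\<forall>n. x (Suc n) mod (p::int) ^ n = x n" and "n \<le> m"
  shows "x m mod p ^ n = x n"
  using assms(2)
proof (induction m rule: dec_induct)
  case base
  show ?case using assms(1) by (metis mod_mod_trivial)
next
  case (step m)
  have "x (Suc m) mod p ^ n = x (Suc m) mod p ^ m mod p ^ n"
    using step(1) by (simp add: le_imp_power_dvd mod_mod_cancel)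
  then show ?case using step assms(1) by simp
qed

instance padic_int :: (prime_card) idom
proof
  fix a b :: "'a padic_int"
  assume "a \<noteq> 0" "b \<noteq> 0"
  then show "a * b \<noteq> 0"
  proof transfer
    fix x y :: "nat \<Rightarrow> int"
    let ?p = "int CARD('a)"
    assume x: "\<forall>n. x (Suc n) mod ?p ^ n = x n" and y: "\<forall>n. y (Suc n) mod ?p ^ n = y n"
    assume "x \<noteq> (\<lambda>_. 0)" "y \<noteq> (\<lambda>_. 0)"
    then obtain n m where nm: "x n \<noteq> 0" "y m \<noteq> 0" by blast
    let ?k = "n + m"
    have p: "prime ?p" by (rule prime_card_int)
    have "\<not> ?p ^ n dvd x ?k"
      using padic_int_rep_mod[OF x, of n ?k] nm by (auto simp: dvd_eq_mod_eq_0)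
    moreover have "\<not> ?p ^ m dvd y ?k"
      using padic_int_rep_mod[OF y, of m ?k] nm by (auto simp: dvd_eq_mod_eq_0)
    ultimately have "x ?k \<noteq> 0" "y ?k \<noteq> 0"
      and "multiplicity ?p (x ?k) < n" "multiplicity ?p (y ?k) < m"
      by (auto intro: multiplicity_lessI simp: not_less dest: multiplicity_dvd')
    then have "\<not> ?p ^ ?k dvd x ?k * y ?k"
      using p by (subst power_dvd_iff_le_multiplicity)
        (auto simp: prime_elem_multiplicity_mult_distrib)
    then have "(x ?k * y ?k) mod ?p ^ ?k \<noteq> 0" by (simp add: dvd_eq_mod_eq_0)
    then show "(\<lambda>n. x n * y n mod ?p ^ n) \<noteq> (\<lambda>_. 0)" by metis
  qed
qed

type_synonym 'p padic = "'p padic_int fract"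


section \<open>Singular numbers\<close>

definition Sig :: "nat \<Rightarrow> int list set" where
  "Sig N = {\<kappa>. length \<kappa> = N \<and> sorted_wrt (\<ge>) \<kappa>}"

definition GL_Zp :: "nat \<Rightarrow> 'p::prime_card padic_int mat set" where
  "GL_Zp N = {A \<in> carrier_mat N N. invertible_mat A}"

definition to_Qp :: "'p::prime_card padic_int mat \<Rightarrow> 'p padic mat" where
  "to_Qp = map_mat to_fract"

text \<open>Only meaningful for \<open>A\<close> in the general linear group over the \<open>p\<close>-adic numbers.\<close>

definition SN :: "nat \<Rightarrow> 'p::prime_card padic mat \<Rightarrow> int list" where
  "SN N A = (THE \<kappa>. \<kappa> \<in> Sig N \<and>
     (\<exists>U \<in> GL_Zp N. \<exists>V \<in> GL_Zp N.
        A = to_Qp U * mat_diag N (\<lambda>i. of_nat CARD('p) powi (\<kappa> ! i)) * to_Qp V))"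


section \<open>Haar measure\<close>

text \<open>The topology induced by the \<open>p\<close>-adic absolute value on the entries: the matrices congruent
  to \<open>A\<close> modulo \<open>p ^ k\<close>, for varying \<open>k\<close>, form a basis of neighbourhoods of \<open>A\<close>.\<close>

definition GL_Zp_open :: "nat \<Rightarrow> 'p::prime_card padic_int mat set \<Rightarrow> bool" where
  "GL_Zp_open N S \<longleftrightarrow> S \<subseteq> GL_Zp N \<and>
     (\<forall>A\<in>S. \<exists>k. \<forall>B\<in>GL_Zp N.
        (\<forall>i<N. \<forall>j<N. of_nat CARD('p) ^ k dvd B $$ (i, j) - A $$ (i, j)) \<longrightarrow> B \<in> S)"

definition GL_Zp_borel :: "nat \<Rightarrow> 'p::prime_card padic_int mat measure" where
  "GL_Zp_borel N = sigma (GL_Zp N) {S. GL_Zp_open N S}"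

definition haar_prob_measure :: "nat \<Rightarrow> 'p::prime_card padic_int mat measure \<Rightarrow> bool" where
  "haar_prob_measure N \<mu> \<longleftrightarrow>
     prob_space \<mu> \<and> space \<mu> = GL_Zp N \<and> sets \<mu> = sets (GL_Zp_borel N) \<and>
     (\<forall>A\<in>GL_Zp N. distr \<mu> (GL_Zp_borel N) (\<lambda>B. A * B) = \<mu>)"


section \<open>Poisson processes and the two walks\<close>

definition poisson_process :: "'w measure \<Rightarrow> real \<Rightarrow> (real \<Rightarrow> 'w \<Rightarrow> nat) \<Rightarrow> bool" where
  "poisson_process M r P \<longleftrightarrow>
     prob_space M \<and>
     (\<forall>\<tau>\<ge>0. P \<tau> \<in> M \<rightarrow>\<^sub>M count_space UNIV) \<and>
     (AE \<omega> in M. P 0 \<omega> = 0 \<and> mono_on {0..} (\<lambda>\<tau>. P \<tau> \<omega>) \<and>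
        (\<forall>\<tau>\<ge>0. continuous (at_right \<tau>) (\<lambda>\<sigma>. P \<sigma> \<omega>))) \<and>
     (\<forall>\<sigma> \<tau>. 0 \<le> \<sigma> \<and> \<sigma> < \<tau> \<longrightarrow>
        distr M (count_space UNIV) (\<lambda>\<omega>. P \<tau> \<omega> - P \<sigma> \<omega>)
          = measure_pmf (poisson_pmf (r * (\<tau> - \<sigma>)))) \<and>
     (\<forall>n (s :: nat \<Rightarrow> real). 0 \<le> s 0 \<and> mono s \<longrightarrow>
        prob_space.indep_vars M (\<lambda>_. count_space UNIV)
          (\<lambda>k \<omega>. P (s (Suc k)) \<omega> - P (s k) \<omega>) {..<n})"

definition trajectory :: "(real \<Rightarrow> 'w \<Rightarrow> 'b) \<Rightarrow> 'w \<Rightarrow> real \<Rightarrow> 'b" where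
  "trajectory Y \<omega> = (\<lambda>\<tau>\<in>{0..}. Y \<tau> \<omega>)"

abbreviation path_space :: "(real \<Rightarrow> 'b) measure" where
  "path_space \<equiv> PiM {0..} (\<lambda>_. count_space UNIV)"

text \<open>Positions are counted from 0, here and for the clocks below.\<close>

definition bump :: "nat \<Rightarrow> int list \<Rightarrow> int list" where
  "bump j \<kappa> = \<kappa>[j := \<kappa> ! j + 1]"

definition ring_clock :: "nat \<Rightarrow> int list \<Rightarrow> int list" where
  "ring_clock i \<kappa> =
     bump (i - (LEAST d. d \<le> i \<and> bump (i - d) \<kappa> \<in> Sig (length \<kappa>))) \<kappa>"

text \<open>
  \<open>C i \<tau>\<close> is the number of rings of clock \<open>i\<close> up to and including time \<open>\<tau>\<close>; as positions are counted
  from 0, the clock \<open>i\<close> has rate \<open>t ^ (i + 1)\<close>.  The dynamics are stated on time intervals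
  \<open>(\<sigma>, \<tau>]\<close>: the state does not change if no clock rings, and is changed by \<open>ring_clock i\<close> if there
  is a single ring, of clock \<open>i\<close>.  Almost surely no two clocks ring at the same time, so every
  bounded interval splits into finitely many of these two kinds and the trajectory is determined
  by the rings.
\<close>

definition reflected_poisson_walk ::
    "nat \<Rightarrow> real \<Rightarrow> 'w measure \<Rightarrow> (real \<Rightarrow> 'w \<Rightarrow> int list) \<Rightarrow> bool" where
  "reflected_poisson_walk N t M S \<longleftrightarrow>
     prob_space M \<and>
     (\<forall>\<tau>\<ge>0. S \<tau> \<in> M \<rightarrow>\<^sub>M count_space UNIV) \<and>
     (\<exists>C :: nat \<Rightarrow> real \<Rightarrow> 'w \<Rightarrow> nat.
        (\<forall>i<N. poisson_process M (t ^ (i + 1)) (C i)) \<and>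
        prob_space.indep_vars M (\<lambda>_. path_space) (\<lambda>i. trajectory (C i)) {..<N} \<and>
        (AE \<omega> in M.
           S 0 \<omega> = replicate N 0 \<and>
           (\<forall>\<sigma> \<tau>. 0 \<le> \<sigma> \<and> \<sigma> \<le> \<tau> \<longrightarrow>
              ((\<forall>i<N. C i \<tau> \<omega> = C i \<sigma> \<omega>) \<longrightarrow> S \<tau> \<omega> = S \<sigma> \<omega>) \<and>
              (\<forall>i<N. C i \<tau> \<omega> = C i \<sigma> \<omega> + 1 \<and>
                 (\<forall>j<N. j \<noteq> i \<longrightarrow> C j \<tau> \<omega> = C j \<sigma> \<omega>) \<longrightarrow>
                 S \<tau> \<omega> = ring_clock i (S \<sigma> \<omega>)))))"

primrec matrix_product ::
    "nat \<Rightarrow> (nat \<Rightarrow> 'p::prime_card padic_int mat) \<Rightarrow> (nat \<Rightarrow> 'p padic_int mat) \<Rightarrow> nat \<Rightarrow> 'p padic mat"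
where
  "matrix_product N U V 0 = 1\<^sub>m N"
| "matrix_product N U V (Suc n) =
     to_Qp (U (Suc n)) * mat_diag N (\<lambda>i. if i = 0 then of_nat CARD('p) else 1) * to_Qp (V (Suc n))
       * matrix_product N U V n"

text \<open>The independent matrices \<open>U\<^sub>1, U\<^sub>2, \<dots>\<close> and \<open>V\<^sub>1, V\<^sub>2, \<dots>\<close> form one family, indexed by a disjoint
  union.\<close>

abbreviation matrix_index :: "(nat + nat) set" where
  "matrix_index \<equiv> {1..} <+> {1..}"

end

theory Submission
  imports Defs "Jordan_Normal_Form.Determinant"
begin

text \<open>
  The singular numbers of the matrix product and the reflected Poisson walk are both driven by a
  rule of the same kind: from time to time a clock \<open>i\<close> is selected, and \<open>ring_clock i\<close> is applied
  to the current signature. The theorem holds because the clocks are selected with the same law.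

  Multiplication by one factor. Let \<open>A = K * diag(p\<^sup>\<kappa>) * L\<close> with \<open>K\<close> and \<open>L\<close> invertible over the
  \<open>p\<close>-adic integers. The factor \<open>U * diag(p, 1, \<dots>, 1) * V\<close> acts on the singular numbers through one
  number only: let \<open>i\<close> be the position of the first nonzero entry modulo \<open>p\<close> of the column \<open>w\<close> with
  \<open>V * K * w = e\<^sub>0\<close>. Then the new singular numbers are \<open>ring_clock i \<kappa>\<close> (\<open>smith_step\<close>). That this
  describes \<open>SN\<close> uses the uniqueness of singular numbers (\<open>SN_eqI\<close>).

  The law of the mark. If \<open>V\<close> is Haar distributed and \<open>K\<close> is a constant, then \<open>w\<close> is uniformly
  distributed among the nonzero columns modulo \<open>p\<close>. So \<open>i\<close> has probability
  \<open>(p - 1) p\<^sup>N\<^sup>-\<^sup>1\<^sup>-\<^sup>i / (p\<^sup>N - 1)\<close> (\<open>haar_leads\<close>), and this is proportional to the rate \<open>t ^ (i + 1)\<close> of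
  clock \<open>i\<close> if \<open>t = 1 / p\<close>. In the product, \<open>K\<close> is random, but it can be chosen as a function of
  the previous product modulo a power of \<open>p\<close> (\<open>left_transform_cong\<close>), which takes finitely many
  values and is independent of the next \<open>V\<close>. Hence the marks of successive factors are
  independent with this law (\<open>marks_iid\<close>).

  Comparison in continuous time. The times of interest are put into a partition whose cells have
  lengths with a small sum of squares. Except on an event of small probability, each cell contains
  at most one jump of the Poisson process, respectively at most one ring of all clocks, and then
  the states at the given times are determined by the word that lists, cell by cell, the clock that
  rings. A word has the same probability for both walks once time is divided by the
  total rate \<open>t + t\<^sup>2 + \<dots> + t\<^sup>N = t (1 - t\<^sup>N) / (1 - t)\<close> of the clocks (\<open>product_walk_words\<close> and
  \<open>reflected_poisson_walk_words\<close>). So the two joint distributions differ by less than any positive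
  number (\<open>word_approximation\<close>).
\<close>

section \<open>The \<open>p\<close>-adic integers and their residue field\<close>

abbreviation uniformizer :: "'p::prime_card padic_int" where
  "uniformizer \<equiv> of_nat CARD('p)"

lemma padic_int_eqI: "(\<And>n. Rep_padic_int x n = Rep_padic_int y n) \<Longrightarrow> x = y"
  by (simp add: Rep_padic_int_inject[symmetric] fun_eq_iff)

lemma Rep_padic_int_mod:
  fixes x :: "'p::prime_card padic_int"
  assumes "n \<le> m"
  shows "Rep_padic_int x m mod int CARD('p) ^ n = Rep_padic_int x n"
proof (rule padic_int_rep_mod[OF _ assms])
  show "\<forall>n. Rep_padic_int x (Suc n) mod int CARD('p) ^ n = Rep_padic_int x n"
    using Rep_padic_int[of x] by simp
qed

lemma Rep_padic_int_range:
  fixes x :: "'p::prime_card padic_int"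
  shows "Rep_padic_int x n \<in> {0..<int CARD('p) ^ n}"
proof -
  have "0 < int CARD('p) ^ n" by simp
  then show ?thesis
    using Rep_padic_int_mod[OF order.refl, of x n]
    by (metis atLeastLessThan_iff pos_mod_bound pos_mod_sign)
qed

lemma Abs_padic_int_inverse':
  fixes x :: "nat \<Rightarrow> int"
  assumes "\<And>n. x (Suc n) mod (int CARD('p::prime_card) ^ n) = x n"
  shows "Rep_padic_int (Abs_padic_int x :: 'p padic_int) = x"
  using assms by (simp add: Abs_padic_int_inverse)

lemma Rep_padic_int_of_nat:
  "Rep_padic_int (of_nat m :: 'p::prime_card padic_int) n = int m mod int CARD('p) ^ n"
proof (induction m)
  case 0
  show ?case by (simp add: zero_padic_int.rep_eq)
next
  case (Suc m)
  then show ?case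
    by (simp add: plus_padic_int.rep_eq one_padic_int.rep_eq mod_simps)
qed

lemma Rep_padic_int_uniformizer_power:
  "Rep_padic_int (uniformizer ^ k :: 'p::prime_card padic_int) n
    = int CARD('p) ^ k mod int CARD('p) ^ n"
  using Rep_padic_int_of_nat[where 'p='p, of "CARD('p) ^ k" n] by simp

text \<open>
  If \<open>x\<close> vanishes modulo \<open>p ^ k\<close>, then its quotient by \<open>p ^ k\<close> is known modulo \<open>p ^ n\<close> as soon as
  \<open>x\<close> is known modulo \<open>p ^ (n + k)\<close>.
\<close>

lemma uniformizer_power_dvd_iff:
  fixes x :: "'p::prime_card padic_int"
  shows "uniformizer ^ k dvd x \<longleftrightarrow> Rep_padic_int x k = 0"
proof
  assume "uniformizer ^ k dvd x"
  then obtain y where "x = uniformizer ^ k * y" by (rule dvdE)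
  then show "Rep_padic_int x k = 0"
    by (simp add: times_padic_int.rep_eq Rep_padic_int_uniformizer_power)
next
  assume x: "Rep_padic_int x k = 0"
  let ?p = "int CARD('p)"
  define y :: "nat \<Rightarrow> int" where "y n = Rep_padic_int x (n + k) div ?p ^ k" for n
  have dvd: "?p ^ k dvd Rep_padic_int x (n + k)" for n
    using Rep_padic_int_mod[of k "n + k" x] x by (simp add: dvd_eq_mod_eq_0)
  have y: "?p ^ k * y n = Rep_padic_int x (n + k)" for n
    unfolding y_def using dvd by simp
  have "y (Suc n) mod ?p ^ n = y n" for n
  proof -
    have "?p ^ k * (y (Suc n) mod ?p ^ n) = (?p ^ k * y (Suc n)) mod ?p ^ (n + k)"
      by (simp only: power_add mult.commute[of "?p ^ n"] mult_mod_right)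
    also have "\<dots> = ?p ^ k * y n"
      unfolding y using Rep_padic_int_mod[of "n + k" "Suc n + k" x] by simp
    finally show ?thesis by simp
  qed
  then have Rep: "Rep_padic_int (Abs_padic_int y :: 'p padic_int) = y"
    by (rule Abs_padic_int_inverse')
  have "x = uniformizer ^ k * Abs_padic_int y"
  proof (rule padic_int_eqI)
    fix n
    have "Rep_padic_int (uniformizer ^ k * Abs_padic_int y :: 'p padic_int) n
        = (?p ^ k * y n) mod ?p ^ n"
      by (simp add: times_padic_int.rep_eq Rep_padic_int_uniformizer_power Rep mod_simps)
    then show "Rep_padic_int x n = Rep_padic_int (uniformizer ^ k * Abs_padic_int y :: 'p padic_int) n"
      unfolding y using Rep_padic_int_mod[of n "n + k" x] by simp
  qed
  then show "uniformizer ^ k dvd x" by simp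
qed

lemma uniformizer_power_dvd_diff_iff:
  fixes x y :: "'p::prime_card padic_int"
  shows "uniformizer ^ k dvd x - y \<longleftrightarrow> Rep_padic_int x k = Rep_padic_int y k"
proof -
  have "uniformizer ^ k dvd x - y
      \<longleftrightarrow> (Rep_padic_int x k - Rep_padic_int y k) mod int CARD('p) ^ k = 0"
    by (simp add: uniformizer_power_dvd_iff minus_padic_int.rep_eq)
  also have "\<dots> \<longleftrightarrow> Rep_padic_int x k mod int CARD('p) ^ k = Rep_padic_int y k mod int CARD('p) ^ k"
    by (simp add: mod_eq_dvd_iff dvd_eq_mod_eq_0)
  finally show ?thesis by (simp add: Rep_padic_int_mod)
qed

lemma uniformizer_neq_0: "(uniformizer :: 'p::prime_card padic_int) \<noteq> 0"
proof
  assume "(uniformizer :: 'p padic_int) = 0"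
  then have "Rep_padic_int (uniformizer :: 'p padic_int) 2 = 0"
    by (simp add: zero_padic_int.rep_eq)
  moreover have "1 < int CARD('p)" using prime_gt_1_int[OF prime_card_int[where 'a='p]] .
  then have "int CARD('p) < int CARD('p) ^ 2" by (simp add: power2_eq_square)
  ultimately show False by (simp add: Rep_padic_int_of_nat)
qed

definition residue :: "'p::prime_card padic_int \<Rightarrow> 'p mod_ring" where
  "residue x = of_int (Rep_padic_int x 1)"

lemma of_int_mod_card: "of_int (z mod int CARD('p)) = (of_int z :: 'p::prime_card mod_ring)"
  unfolding of_int_of_int_mod_ring by transfer simp

lemma of_int_mod_ring_eq_0_iff:
  "(of_int z :: 'p::prime_card mod_ring) = 0 \<longleftrightarrow> int CARD('p) dvd z"
  unfolding of_int_of_int_mod_ring dvd_eq_mod_eq_0 by transfer simp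

interpretation residue_hom: comm_ring_hom residue
  by unfold_locales
    (simp_all add: residue_def zero_padic_int.rep_eq one_padic_int.rep_eq plus_padic_int.rep_eq
      times_padic_int.rep_eq of_int_mod_card)

lemma residue_eq_0_iff: "residue x = 0 \<longleftrightarrow> uniformizer dvd (x :: 'p::prime_card padic_int)"
proof -
  have "residue x = 0 \<longleftrightarrow> Rep_padic_int x 1 mod int CARD('p) = 0"
    by (simp add: residue_def of_int_mod_ring_eq_0_iff dvd_eq_mod_eq_0)
  also have "\<dots> \<longleftrightarrow> Rep_padic_int x 1 = 0"
    using Rep_padic_int_mod[of 1 1 x] by simp
  finally show ?thesis
    using uniformizer_power_dvd_iff[of 1 x] by simp
qed

text \<open>
  Inverses exist modulo every \<open>p ^ n\<close>, and they are unique there. So they are compatible and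
  form a \<open>p\<close>-adic integer.
\<close>

lemma unit_if_residue_neq_0:
  fixes x :: "'p::prime_card padic_int"
  assumes "residue x \<noteq> 0"
  shows "x dvd 1"
proof -
  let ?p = "int CARD('p)"
  let ?inv = "\<lambda>n y. 0 \<le> y \<and> y < ?p ^ n \<and> Rep_padic_int x n * y mod ?p ^ n = 1 mod ?p ^ n"
  have p: "prime ?p" by (rule prime_card_int)
  have "Rep_padic_int x 1 \<noteq> 0"
    using assms uniformizer_power_dvd_iff[of 1 x] by (simp add: residue_eq_0_iff)
  have coprime: "coprime (Rep_padic_int x n) (?p ^ n)" for n
  proof (cases "n = 0")
    case False
    then have "Rep_padic_int x n mod ?p \<noteq> 0"
      using Rep_padic_int_mod[of 1 n x] \<open>Rep_padic_int x 1 \<noteq> 0\<close> by simp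
    then have "\<not> ?p dvd Rep_padic_int x n" by (simp add: dvd_eq_mod_eq_0)
    then have "coprime ?p (Rep_padic_int x n)" using p by (simp add: prime_imp_coprime)
    then show ?thesis by (simp add: coprime_commute)
  qed simp
  have ex: "\<exists>y. ?inv n y" for n
  proof -
    obtain y where "[Rep_padic_int x n * y = 1] (mod ?p ^ n)"
      using cong_solve_coprime_int[OF coprime] by blast
    then have "?inv n (y mod ?p ^ n)" by (simp add: cong_def mod_simps)
    then show ?thesis by blast
  qed
  have unique: "y = z" if "?inv n y" "?inv n z" for n y z
  proof -
    have "[Rep_padic_int x n * y = Rep_padic_int x n * z] (mod ?p ^ n)"
      using that by (simp add: cong_def)
    then have "[y = z] (mod ?p ^ n)"
      using coprime by (simp add: cong_mult_lcancel)
    then show ?thesis using that by (simp add: cong_def)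
  qed
  define y where "y n = (SOME y. ?inv n y)" for n
  have y: "?inv n (y n)" for n
    unfolding y_def by (rule someI_ex[OF ex])
  have "y (Suc n) mod ?p ^ n = y n" for n
  proof (rule unique[OF _ y])
    have "Rep_padic_int x n * (y (Suc n) mod ?p ^ n) mod ?p ^ n
        = (Rep_padic_int x (Suc n) mod ?p ^ n) * y (Suc n) mod ?p ^ n"
      by (simp only: mod_mult_right_eq Rep_padic_int_mod[OF le_SucI[OF order.refl]])
    also have "\<dots> = (Rep_padic_int x (Suc n) * y (Suc n) mod ?p ^ Suc n) mod ?p ^ n"
      by (simp only: mod_mult_left_eq mod_tower_op)
    also have "\<dots> = 1 mod ?p ^ n"
      using y[of "Suc n"] by (simp only: mod_tower_op)
    finally show "?inv n (y (Suc n) mod ?p ^ n)" by simp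
  qed
  then have Rep: "Rep_padic_int (Abs_padic_int y :: 'p padic_int) = y"
    by (rule Abs_padic_int_inverse')
  have "x * Abs_padic_int y = 1"
    by (rule padic_int_eqI) (simp add: times_padic_int.rep_eq one_padic_int.rep_eq Rep y)
  then show ?thesis by (metis dvd_triv_left)
qed

lemma unit_iff_residue: "x dvd 1 \<longleftrightarrow> residue x \<noteq> 0"
proof
  assume "x dvd 1"
  then obtain y where "1 = x * y" by (rule dvdE)
  then show "residue x \<noteq> 0"
    by (metis residue_hom.hom_mult residue_hom.hom_one mult_zero_left zero_neq_one)
qed (rule unit_if_residue_neq_0)

definition lift_residue :: "'p::prime_card mod_ring \<Rightarrow> 'p padic_int" where
  "lift_residue a = of_int (to_int_mod_ring a)"

lemma residue_lift_residue [simp]: "residue (lift_residue a) = a"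
proof -
  have "residue (of_int z) = (of_int z :: 'a mod_ring)" for z
    by (rule residue_hom.hom_of_int)
  then show ?thesis by (simp add: lift_residue_def of_int_of_int_mod_ring)
qed

lemma lift_residue_0 [simp]: "lift_residue 0 = 0"
  by (simp add: lift_residue_def)

section \<open>The general linear group over the \<open>p\<close>-adic integers\<close>

abbreviation det where "det \<equiv> Determinant.det"

lemma GL_ZpI:
  assumes "A \<in> carrier_mat N N" "B \<in> carrier_mat N N" "A * B = 1\<^sub>m N" "B * A = 1\<^sub>m N"
  shows "A \<in> GL_Zp N"
proof -
  have "inverts_mat A B" "inverts_mat B A" "square_mat A"
    using assms by (auto simp: inverts_mat_def)
  then show ?thesis
    using assms(1) unfolding GL_Zp_def invertible_mat_def by blast
qed

lemma GL_Zp_carrier: "A \<in> GL_Zp N \<Longrightarrow> A \<in> carrier_mat N N"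
  by (simp add: GL_Zp_def)

lemma GL_Zp_dim [simp]: "A \<in> GL_Zp N \<Longrightarrow> dim_row A = N" "A \<in> GL_Zp N \<Longrightarrow> dim_col A = N"
  by (auto simp: GL_Zp_def)

lemma GL_Zp_inverse:
  fixes A :: "'p::prime_card padic_int mat"
  assumes "A \<in> GL_Zp N"
  obtains B where "B \<in> GL_Zp N" "A * B = 1\<^sub>m N" "B * A = 1\<^sub>m N"
proof -
  have A: "A \<in> carrier_mat N N" using assms by (rule GL_Zp_carrier)
  from assms obtain B where "inverts_mat A B" "inverts_mat B A"
    unfolding GL_Zp_def invertible_mat_def by blast
  then have AB: "A * B = 1\<^sub>m N" and BA: "B * A = 1\<^sub>m (dim_row B)"
    using assms by (simp_all add: inverts_mat_def)
  have "dim_col B = N" using arg_cong[OF AB, of dim_col] by simp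
  moreover have "dim_row B = N" using arg_cong[OF BA, of dim_col] assms by simp
  ultimately have B: "B \<in> carrier_mat N N" by (intro carrier_matI)
  moreover have "B * A = 1\<^sub>m N" using BA \<open>dim_row B = N\<close> by simp
  ultimately show ?thesis using that GL_ZpI[OF B A] AB by blast
qed

text \<open>
  If \<open>d * det A = 1\<close>, then \<open>d\<close> times the adjugate of \<open>A\<close> is the inverse.
\<close>

lemma GL_Zp_iff_det_unit:
  fixes A :: "'p::prime_card padic_int mat"
  shows "A \<in> GL_Zp N \<longleftrightarrow> A \<in> carrier_mat N N \<and> det A dvd 1"
proof (intro iffI conjI; (elim conjE)?)
  assume "A \<in> GL_Zp N"
  then show A: "A \<in> carrier_mat N N" by (rule GL_Zp_carrier)
  obtain B where B: "B \<in> GL_Zp N" "A * B = 1\<^sub>m N"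
    using \<open>A \<in> GL_Zp N\<close> by (rule GL_Zp_inverse)
  have "det A * det B = 1" using det_mult[OF A, of B] B by (simp add: GL_Zp_carrier)
  then show "det A dvd 1" by (rule dvdI[OF sym])
next
  assume A: "A \<in> carrier_mat N N" and "det A dvd 1"
  then obtain d where d: "1 = det A * d" by (auto elim: dvdE)
  let ?B = "d \<cdot>\<^sub>m adj_mat A"
  have "A * ?B = d \<cdot>\<^sub>m (det A \<cdot>\<^sub>m 1\<^sub>m N)"
    using mult_smult_distrib[OF A adj_mat(1)[OF A], of d] by (simp add: adj_mat(2)[OF A])
  moreover have "?B * A = d \<cdot>\<^sub>m (det A \<cdot>\<^sub>m 1\<^sub>m N)"
    using mult_smult_assoc_mat[OF adj_mat(1)[OF A] A, of d] by (simp add: adj_mat(3)[OF A])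
  moreover have "d \<cdot>\<^sub>m (det A \<cdot>\<^sub>m 1\<^sub>m N) = 1\<^sub>m N"
    using d by (intro eq_matI) (auto simp: mult.commute)
  ultimately show "A \<in> GL_Zp N"
    using A adj_mat(1)[OF A] by (intro GL_ZpI[of A N ?B]) simp_all
qed

lemma one_GL_Zp: "1\<^sub>m N \<in> GL_Zp N"
  by (simp add: GL_Zp_iff_det_unit)

lemma mult_GL_Zp: "A \<in> GL_Zp N \<Longrightarrow> B \<in> GL_Zp N \<Longrightarrow> A * B \<in> GL_Zp N"
  using det_mult[of A N B] by (auto simp: GL_Zp_iff_det_unit)

lemma swaprows_mat_GL_Zp:
  assumes "k < N" "l < N"
  shows "swaprows_mat N k l \<in> GL_Zp N"
  by (rule GL_ZpI[of _ _ "swaprows_mat N k l"]) (simp_all add: swaprows_mat_inv[OF assms])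

abbreviation residue_mat :: "'p::prime_card padic_int mat \<Rightarrow> 'p mod_ring mat" where
  "residue_mat \<equiv> map_mat residue"

text \<open>
  The \<open>p\<close>-adic integers are a local ring with residue field \<open>'p mod_ring\<close>, so invertibility
  can be tested modulo \<open>p\<close>.
\<close>

lemma GL_Zp_iff_residue:
  "A \<in> GL_Zp N \<longleftrightarrow> A \<in> carrier_mat N N \<and> det (residue_mat A) \<noteq> 0"
  by (simp only: GL_Zp_iff_det_unit unit_iff_residue residue_hom.hom_det)

text \<open>
  This matrix sends the \<open>i\<close>-th basis vector to the column \<open>c\<close> and fixes the other ones. It serves
  to move basis vectors to prescribed columns.
\<close>

definition column_mat :: "nat \<Rightarrow> nat \<Rightarrow> (nat \<Rightarrow> 'a::zero_neq_one) \<Rightarrow> 'a mat" where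
  "column_mat N i c = mat N N (\<lambda>(r, s). if s = i then c r else if r = s then 1 else 0)"

lemma column_mat_carrier [simp]: "column_mat N i c \<in> carrier_mat N N"
  by (simp add: column_mat_def)

text \<open>
  Expand along row \<open>i\<close>, whose only nonzero entry is \<open>c i\<close>.
\<close>

lemma det_column_mat:
  fixes c :: "nat \<Rightarrow> 'a::comm_ring_1"
  assumes "i < N"
  shows "det (column_mat N i c) = c i"
proof -
  let ?C = "column_mat N i c"
  have delete: "mat_delete ?C i i = 1\<^sub>m (N - 1)"
    by (rule eq_matI) (auto simp: mat_delete_def column_mat_def)
  have "det ?C = (\<Sum>j<N. ?C $$ (i, j) * cofactor ?C i j)"
    using assms by (intro laplace_expansion_row) simp_all
  also have "\<dots> = (\<Sum>j\<in>{i}. ?C $$ (i, j) * cofactor ?C i j)"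
    using assms by (intro sum.mono_neutral_right) (auto simp: column_mat_def)
  also have "\<dots> = c i"
    using assms by (simp add: cofactor_def delete) (simp add: column_mat_def flip: mult_2)
  finally show ?thesis .
qed

section \<open>Uniqueness of singular numbers\<close>

text \<open>
  No permutation maps the \<open>k + 1\<close> indices up to \<open>k\<close> into the \<open>k\<close> indices below \<open>k\<close>. So every
  term of the Leibniz formula contains an entry of the block of zeros.
\<close>

lemma det_zero_block:
  fixes A :: "'a::comm_ring_1 mat"
  assumes A: "A \<in> carrier_mat N N" and "k < N"
    and zero: "\<And>i j. i \<le> k \<Longrightarrow> k \<le> j \<Longrightarrow> j < N \<Longrightarrow> A $$ (i, j) = 0"
  shows "det A = 0"
proof -
  have "(\<Prod>i = 0..<N. A $$ (i, \<pi> i)) = 0" if \<pi>: "\<pi> permutes {0..<N}" for \<pi>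
  proof -
    have "\<exists>i\<le>k. k \<le> \<pi> i"
    proof (rule ccontr)
      assume "\<not> (\<exists>i\<le>k. k \<le> \<pi> i)"
      then have "\<pi> i < k" if "i \<le> k" for i using that not_le by blast
      then have "\<pi> ` {..k} \<subseteq> {..<k}" by auto
      then have "card (\<pi> ` {..k}) \<le> card {..<k}" by (intro card_mono) auto
      moreover have "card (\<pi> ` {..k}) = card {..k}"
        by (rule card_image[OF permutes_inj_on[OF \<pi>]])
      ultimately show False by simp
    qed
    then obtain i where i: "i \<le> k" "k \<le> \<pi> i" by blast
    moreover have "\<pi> i < N" using permutes_in_image[OF \<pi>, of i] i \<open>k < N\<close> by simp
    ultimately have "A $$ (i, \<pi> i) = 0" by (intro zero)
    then show ?thesis using i \<open>k < N\<close> by (intro prod_zero) auto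
  qed
  then show ?thesis by (simp add: det_def'[OF A])
qed

interpretation to_fract_hom: comm_ring_hom to_fract
  by unfold_locales auto

lemma to_Qp_mult:
  "A \<in> carrier_mat N N \<Longrightarrow> B \<in> carrier_mat N N \<Longrightarrow> to_Qp (A * B) = to_Qp A * to_Qp B"
  unfolding to_Qp_def by (rule to_fract_hom.mat_hom_mult)

lemma to_Qp_one: "to_Qp (1\<^sub>m N) = 1\<^sub>m N"
  unfolding to_Qp_def by (rule to_fract_hom.mat_hom_one)

lemma to_Qp_carrier [simp]: "to_Qp A \<in> carrier_mat n m \<longleftrightarrow> A \<in> carrier_mat n m"
  by (simp add: to_Qp_def)

lemma of_nat_card_padic: "(of_nat CARD('p) :: 'p::prime_card padic) = to_fract uniformizer"
  by (simp add: to_fract_hom.hom_of_nat)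

lemma Sig_nth_mono: "\<kappa> \<in> Sig N \<Longrightarrow> i \<le> j \<Longrightarrow> j < N \<Longrightarrow> \<kappa> ! j \<le> \<kappa> ! i"
  using sorted_wrt_nth_less[of "(\<ge>)" \<kappa> i j] by (cases "i = j") (auto simp: Sig_def)

abbreviation padic_diag :: "nat \<Rightarrow> int list \<Rightarrow> 'p::prime_card padic mat" where
  "padic_diag N \<kappa> \<equiv> mat_diag N (\<lambda>i. of_nat CARD('p) powi (\<kappa> ! i))"

text \<open>
  If \<open>\<nu> ! k > \<kappa> ! k\<close>, then \<open>\<nu> ! i > \<kappa> ! j\<close> whenever \<open>i \<le> k \<le> j\<close>, and comparing the entries
  at \<open>(i, j)\<close> shows that \<open>p\<close> divides \<open>U $$ (i, j)\<close>. Such a block of zeros modulo \<open>p\<close> is too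
  large for an invertible matrix.
\<close>

lemma singular_numbers_le:
  fixes U V :: "'p::prime_card padic_int mat"
  assumes U: "U \<in> GL_Zp N" and V: "V \<in> carrier_mat N N"
    and \<kappa>: "\<kappa> \<in> Sig N" and \<nu>: "\<nu> \<in> Sig N"
    and eq: "to_Qp U * padic_diag N \<kappa> = padic_diag N \<nu> * to_Qp V"
    and "k < N"
  shows "\<nu> ! k \<le> \<kappa> ! k"
proof (rule ccontr)
  let ?q = "of_nat CARD('p) :: 'p padic"
  assume less: "\<not> \<nu> ! k \<le> \<kappa> ! k"
  have q: "?q \<noteq> 0"
    using uniformizer_neq_0[where 'p='p] by (simp add: of_nat_card_padic)
  have Uc: "U \<in> carrier_mat N N" using U by (rule GL_Zp_carrier)
  have "residue_mat U $$ (i, j) = 0" if ij: "i \<le> k" "k \<le> j" "j < N" for i j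
  proof -
    have "\<nu> ! k \<le> \<nu> ! i" "\<kappa> ! j \<le> \<kappa> ! k"
      using Sig_nth_mono[OF \<nu>, of i k] Sig_nth_mono[OF \<kappa>, of k j] ij \<open>k < N\<close> by auto
    then have "\<kappa> ! j < \<nu> ! i" using less by linarith
    then obtain n where n: "\<nu> ! i = \<kappa> ! j + int (Suc n)"
      by (auto simp: zless_iff_Suc_zadd)
    have "(to_Qp U * padic_diag N \<kappa>) $$ (i, j) = (padic_diag N \<nu> * to_Qp V) $$ (i, j)"
      using eq by simp
    then have "to_fract (U $$ (i, j)) * ?q powi (\<kappa> ! j) = ?q powi (\<nu> ! i) * to_fract (V $$ (i, j))"
      using ij \<open>k < N\<close> Uc V
      by (simp add: mat_diag_mult_left[of _ N N] mat_diag_mult_right[of _ N N] to_Qp_def)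
    also have "?q powi (\<nu> ! i) = ?q powi (\<kappa> ! j) * ?q ^ Suc n"
      unfolding n using q by (subst power_int_add) (simp_all only: power_int_of_nat simp_thms)
    finally have "to_fract (U $$ (i, j)) * ?q powi (\<kappa> ! j)
        = (?q ^ Suc n * to_fract (V $$ (i, j))) * ?q powi (\<kappa> ! j)" by (simp only: mult_ac)
    then have "to_fract (U $$ (i, j)) = ?q ^ Suc n * to_fract (V $$ (i, j))"
      using q by (simp only: mult_right_cancel power_int_eq_0_iff simp_thms)
    also have "\<dots> = to_fract (uniformizer ^ Suc n * V $$ (i, j))"
      unfolding of_nat_card_padic by (simp only: to_fract_hom.hom_power to_fract_hom.hom_mult)
    finally have "U $$ (i, j) = uniformizer ^ Suc n * V $$ (i, j)" by (simp only: to_fract_eq_iff)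
    then have "uniformizer dvd U $$ (i, j)" by simp
    then show ?thesis using ij \<open>k < N\<close> Uc by (simp add: residue_eq_0_iff)
  qed
  then have "det (residue_mat U) = 0"
    using Uc by (intro det_zero_block[OF _ \<open>k < N\<close>]) auto
  with U show False unfolding GL_Zp_iff_residue by blast
qed

text \<open>
  The inequality of \<open>singular_numbers_le\<close>, applied to two decompositions in both orders, shows that
  their exponents agree.
\<close>

lemma SN_eqI:
  fixes U V :: "'p::prime_card padic_int mat"
  assumes \<kappa>: "\<kappa> \<in> Sig N" and U: "U \<in> GL_Zp N" and V: "V \<in> GL_Zp N"
    and A: "A = to_Qp U * padic_diag N \<kappa> * to_Qp V"
  shows "SN N A = \<kappa>"
proof -
  have le: "\<nu> ! k \<le> \<kappa> ! k"
    if "\<kappa> \<in> Sig N" "\<nu> \<in> Sig N" and U: "U \<in> GL_Zp N" and V: "V \<in> GL_Zp N"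
      and U': "U' \<in> GL_Zp N" and V': "V' \<in> GL_Zp N"
      and eq: "to_Qp U * padic_diag N \<kappa> * to_Qp V = to_Qp U' * padic_diag N \<nu> * to_Qp V'"
      and "k < N"
    for \<kappa> \<nu> k and U V U' V' :: "'p padic_int mat"
  proof -
    obtain U2 where U2: "U2 \<in> GL_Zp N" "U2 * U' = 1\<^sub>m N" using GL_Zp_inverse[OF U'] by metis
    obtain V2 where V2: "V2 \<in> GL_Zp N" "V * V2 = 1\<^sub>m N" using GL_Zp_inverse[OF V] by metis
    note [simp] = U V U' V' U2 V2 GL_Zp_carrier
    note assoc = assoc_mult_mat[of _ N N _ N _ N]
    have [simp]: "to_Qp V * to_Qp V2 = 1\<^sub>m N"
      using to_Qp_mult[of V N V2] by (simp add: to_Qp_one)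
    have "to_Qp (U2 * U) * padic_diag N \<kappa>
        = to_Qp U2 * (to_Qp U * (padic_diag N \<kappa> * (to_Qp V * to_Qp V2)))"
      by (simp add: to_Qp_mult[of _ N] assoc right_mult_one_mat[of _ N N])
    also have "\<dots> = to_Qp U2 * (to_Qp U * padic_diag N \<kappa> * to_Qp V) * to_Qp V2"
      by (simp only: assoc U2 V2 U V GL_Zp_carrier to_Qp_carrier mat_diag_dim mult_carrier_mat[of _ N N _ N])
    also have "\<dots> = to_Qp U2 * (to_Qp U' * padic_diag N \<nu> * to_Qp V') * to_Qp V2"
      by (simp add: eq)
    also have "\<dots> = (to_Qp U2 * to_Qp U') * (padic_diag N \<nu> * (to_Qp V' * to_Qp V2))"
      by (simp only: assoc U2 V2 U' V' GL_Zp_carrier to_Qp_carrier mat_diag_dim mult_carrier_mat[of _ N N _ N])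
    also have "to_Qp U2 * to_Qp U' = 1\<^sub>m N"
      using to_Qp_mult[of U2 N U'] by (simp add: to_Qp_one)
    also have "1\<^sub>m N * (padic_diag N \<nu> * (to_Qp V' * to_Qp V2)) = padic_diag N \<nu> * to_Qp (V' * V2)"
      by (simp add: to_Qp_mult[of _ N] left_mult_one_mat[of _ N N] mult_carrier_mat[of _ N N _ N])
    finally show ?thesis
      using that by (intro singular_numbers_le[of "U2 * U" N "V' * V2"]) (simp_all add: mult_GL_Zp)
  qed
  show ?thesis
    unfolding SN_def
  proof (rule the_equality)
    show "\<kappa> \<in> Sig N \<and> (\<exists>U \<in> GL_Zp N. \<exists>V \<in> GL_Zp N. A = to_Qp U * padic_diag N \<kappa> * to_Qp V)"
      using assms by blast
  next
    fix \<nu>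
    assume "\<nu> \<in> Sig N \<and> (\<exists>U \<in> GL_Zp N. \<exists>V \<in> GL_Zp N. A = to_Qp U * padic_diag N \<nu> * to_Qp V)"
    then obtain U' V' where \<nu>: "\<nu> \<in> Sig N" and U': "U' \<in> GL_Zp N" and V': "V' \<in> GL_Zp N"
      and A': "A = to_Qp U' * padic_diag N \<nu> * to_Qp V'" by blast
    show "\<nu> = \<kappa>"
    proof (rule nth_equalityI)
      show "length \<nu> = length \<kappa>" using \<kappa> \<nu> by (simp add: Sig_def)
      fix k assume "k < length \<nu>"
      then have "k < N" using \<nu> by (simp add: Sig_def)
      then show "\<nu> ! k = \<kappa> ! k"
        using le[OF \<kappa> \<nu> U V U' V'] le[OF \<nu> \<kappa> U' V' U V] A A' by (metis order.antisym)
    qed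
  qed
qed

section \<open>Multiplication by one factor\<close>

text \<open>
  The ring of clock \<open>i\<close> is passed on to the first position \<open>j\<close> of the block of entries equal to
  \<open>\<kappa> ! i\<close>: adding \<open>1\<close> at a position destroys the order exactly if the entry before it is equal.
\<close>

lemma ring_clock_cases:
  assumes \<kappa>: "\<kappa> \<in> Sig N" and "i < N"
  obtains j where "j \<le> i" "ring_clock i \<kappa> = bump j \<kappa>" "\<kappa> ! j = \<kappa> ! i" "bump j \<kappa> \<in> Sig N"
proof -
  have len: "length \<kappa> = N" using \<kappa> by (simp add: Sig_def)
  have bump: "bump j \<kappa> \<in> Sig N" if "j < N" "j = 0 \<or> \<kappa> ! j < \<kappa> ! (j - 1)" for j
  proof -
    have "bump j \<kappa> ! b \<le> bump j \<kappa> ! a" if ab: "a < b" "b < N" for a b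
    proof (cases "b = j")
      case True
      then have "\<kappa> ! (j - 1) \<le> \<kappa> ! a" using ab \<open>j < N\<close> by (intro Sig_nth_mono[OF \<kappa>]) auto
      then show ?thesis using True ab that(2) len \<open>j = 0 \<or> _\<close> \<open>j < N\<close> by (auto simp: bump_def)
    next
      case False
      then show ?thesis
        using ab Sig_nth_mono[OF \<kappa>, of a b] len by (cases "a = j") (auto simp: bump_def)
    qed
    then show ?thesis using len by (auto simp: Sig_def sorted_wrt_iff_nth_less bump_def)
  qed
  let ?P = "\<lambda>d. d \<le> i \<and> bump (i - d) \<kappa> \<in> Sig N"
  define d where "d = (LEAST d. ?P d)"
  have "?P i" using bump[of 0] \<open>i < N\<close> by simp
  then have d: "?P d" unfolding d_def by (rule LeastI)
  have least: "\<not> ?P e" if "e < d" for e using that unfolding d_def by (rule not_less_Least)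
  have "e \<le> d \<Longrightarrow> \<kappa> ! (i - e) = \<kappa> ! i" for e
  proof (induction e)
    case (Suc e)
    then have "\<not> ?P e" by (intro least) simp
    then have "\<not> (i - e = 0 \<or> \<kappa> ! (i - e) < \<kappa> ! (i - e - 1))"
      using bump[of "i - e"] d Suc.prems le_less_trans[OF diff_le_self \<open>i < N\<close>] by auto
    moreover have "\<kappa> ! (i - e) \<le> \<kappa> ! (i - e - 1)"
      using \<open>i < N\<close> by (intro Sig_nth_mono[OF \<kappa>]) auto
    ultimately show ?case using Suc by simp
  qed simp
  then have "\<kappa> ! (i - d) = \<kappa> ! i" by simp
  moreover have "ring_clock i \<kappa> = bump (i - d) \<kappa>" by (simp add: ring_clock_def d_def len)
  ultimately show ?thesis using that[of "i - d"] d by simp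
qed

text \<open>
  The integral form of \<open>padic_diag\<close>, faithful if the entries of \<open>\<kappa>\<close> are nonnegative. All products
  of the walk have \<open>p\<close>-adic integer entries, so the decompositions can be computed without fractions.
\<close>

definition power_diag :: "nat \<Rightarrow> int list \<Rightarrow> 'p::prime_card padic_int mat" where
  "power_diag N \<kappa> = mat_diag N (\<lambda>r. uniformizer ^ nat (\<kappa> ! r))"

lemma power_diag_carrier [simp]: "power_diag N \<kappa> \<in> carrier_mat N N"
  by (simp add: power_diag_def)

definition unit_column :: "nat \<Rightarrow> 'a::zero_neq_one mat" where
  "unit_column N = mat N 1 (\<lambda>(r, s). if r = 0 then 1 else 0)"

lemma mat_diag_cong: "(\<And>r. r < N \<Longrightarrow> f r = g r) \<Longrightarrow> mat_diag N f = mat_diag N g"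
  by (intro eq_matI) (auto simp: mat_diag_def)

lemma swaprows_mat_diag:
  assumes "k < N" "l < N"
  shows "swaprows_mat N k l * mat_diag N f
    = mat_diag N (\<lambda>r. if r = k then f l else if r = l then f k else f r) * swaprows_mat N k l"
  using assms
  by (intro eq_matI)
    (auto simp: mat_diag_mult_left[of _ N N] mat_diag_mult_right[of _ N N] swaprows_mat_def)

abbreviation step_diag :: "nat \<Rightarrow> nat \<Rightarrow> 'p::prime_card padic_int mat" where
  "step_diag N j \<equiv> mat_diag N (\<lambda>r. if r = j then uniformizer else 1)"

text \<open>
  Conjugation by \<open>diag(p, 1, \<dots>, 1)\<close> multiplies row \<open>0\<close> by \<open>p\<close> and divides column \<open>0\<close> by \<open>p\<close>,
  except for the entry in the corner. The result is integral because of the assumption on column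
  \<open>0\<close>, and invertible because the determinant is the same.
\<close>

lemma conjugate_step_diag:
  fixes Q :: "'p::prime_card padic_int mat"
  assumes Q: "Q \<in> GL_Zp N" and "0 < N"
    and col: "\<And>r. 0 < r \<Longrightarrow> r < N \<Longrightarrow> uniformizer dvd Q $$ (r, 0)"
  obtains Q' where "Q' \<in> GL_Zp N" "step_diag N 0 * Q = Q' * step_diag N 0"
proof -
  let ?p = "uniformizer :: 'p padic_int"
  have Qc: "Q \<in> carrier_mat N N" using Q by (rule GL_Zp_carrier)
  define q where "q r = (SOME y. Q $$ (r, 0) = ?p * y)" for r
  have q: "Q $$ (r, 0) = ?p * q r" if "0 < r" "r < N" for r
    using col[OF that] unfolding q_def dvd_def by (rule someI_ex)
  define Q' where "Q' = mat N N (\<lambda>(r, s). if r = 0 \<and> s = 0 then Q $$ (0, 0)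
    else if r = 0 then ?p * Q $$ (r, s) else if s = 0 then q r else Q $$ (r, s))"
  have Q'c: "Q' \<in> carrier_mat N N" by (simp add: Q'_def)
  have eq: "step_diag N 0 * Q = Q' * step_diag N 0"
    by (rule eq_matI)
      (use Qc q in \<open>auto simp: mat_diag_mult_left[of _ N N] mat_diag_mult_right[of _ N N] Q'_def\<close>)
  have "step_diag N 0 = column_mat N 0 (\<lambda>r. if r = 0 then ?p else 0)"
    by (rule eq_matI) (auto simp: mat_diag_def column_mat_def)
  then have "det (step_diag N 0) = ?p" by (simp only: det_column_mat[OF \<open>0 < N\<close>] simp_thms if_True)
  moreover have "det (step_diag N 0) * det Q = det Q' * det (step_diag N 0)"
    unfolding det_mult[OF mat_diag_dim Qc, symmetric] det_mult[OF Q'c mat_diag_dim, symmetric] eq ..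
  ultimately have "det Q' = det Q" using uniformizer_neq_0[where 'p='p] by simp
  then have "Q' \<in> GL_Zp N" using Q Q'c by (simp add: GL_Zp_iff_det_unit)
  then show ?thesis using that eq by blast
qed

text \<open>
  Adding \<open>1\<close> to \<open>\<kappa> ! i\<close> may destroy the order. Conjugation by the swap of \<open>i\<close> with the first
  position \<open>j\<close> of its block moves the increased entry to \<open>j\<close>, and this is what \<open>ring_clock\<close> does.
\<close>

lemma step_diag_mult_power_diag:
  fixes \<kappa> :: "int list"
  assumes \<kappa>: "\<kappa> \<in> Sig N" and pos: "\<And>r. r < N \<Longrightarrow> 0 \<le> \<kappa> ! r" and "i < N"
  obtains S where "S \<in> GL_Zp N"
    "step_diag N i * power_diag N \<kappa> = S * power_diag N (ring_clock i \<kappa>) * (S :: 'p::prime_card padic_int mat)"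
proof -
  obtain j where j: "j \<le> i" "ring_clock i \<kappa> = bump j \<kappa>" "\<kappa> ! j = \<kappa> ! i"
    using ring_clock_cases[OF \<kappa> \<open>i < N\<close>] by metis
  have "length \<kappa> = N" using \<kappa> by (simp add: Sig_def)
  let ?S = "swaprows_mat N i j :: 'p padic_int mat"
  have "j < N" using j \<open>i < N\<close> by simp
  have "?S * power_diag N (ring_clock i \<kappa>) = step_diag N i * power_diag N \<kappa> * ?S"
  proof -
    have "?S * power_diag N (ring_clock i \<kappa>)
      = mat_diag N (\<lambda>r. if r = i then uniformizer ^ nat (bump j \<kappa> ! j)
          else if r = j then uniformizer ^ nat (bump j \<kappa> ! i) else uniformizer ^ nat (bump j \<kappa> ! r)) * ?S"
      unfolding power_diag_def j(2) by (rule swaprows_mat_diag[OF \<open>i < N\<close> \<open>j < N\<close>])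
    also have "mat_diag N (\<lambda>r. if r = i then uniformizer ^ nat (bump j \<kappa> ! j)
          else if r = j then uniformizer ^ nat (bump j \<kappa> ! i) else uniformizer ^ nat (bump j \<kappa> ! r))
        = step_diag N i * power_diag N \<kappa>"
      unfolding power_diag_def mat_diag_diag
      by (rule mat_diag_cong) (use \<open>length \<kappa> = N\<close> \<open>j < N\<close> j(3) pos in
        \<open>auto simp: bump_def nat_add_distrib\<close>)
    finally show ?thesis .
  qed
  then have "?S * power_diag N (ring_clock i \<kappa>) * ?S = step_diag N i * power_diag N \<kappa> * (?S * ?S)"
    by (simp only: assoc_mult_mat[of _ N N _ N _ N] mult_carrier_mat[of _ N N _ N]
        swaprows_mat_carrier power_diag_carrier mat_diag_dim)
  also have "?S * ?S = 1\<^sub>m N" by (rule swaprows_mat_inv[OF \<open>i < N\<close> \<open>j < N\<close>])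
  finally show ?thesis
    using that[OF swaprows_mat_GL_Zp[OF \<open>i < N\<close> \<open>j < N\<close>]]
    by (simp add: right_mult_one_mat[of _ N N] mult_carrier_mat[of _ N N _ N])
qed

text \<open>
  This is the algebraic heart of the proof: the position \<open>i\<close> of the leading entry modulo \<open>p\<close> of
  the solution \<open>w\<close> of \<open>V * K * w = e\<^sub>0\<close> decides which clock rings.

  Let \<open>B\<close> be the identity matrix with column \<open>i\<close> replaced by a lift of \<open>w\<close>, and let \<open>P\<close> swap the
  indices \<open>0\<close> and \<open>i\<close>. Then \<open>V * K * B * P\<close> fixes \<open>e\<^sub>0\<close> modulo \<open>p\<close>, so \<open>diag(p, 1, \<dots>, 1)\<close> can be
  moved to its right. On the other side, \<open>B * power_diag N \<kappa> = power_diag N \<kappa> * C\<close> with an integral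
  matrix \<open>C\<close>: column \<open>i\<close> of \<open>B\<close> vanishes above row \<open>i\<close>, and \<open>\<kappa> ! r \<le> \<kappa> ! i\<close> for the rows \<open>r\<close> below.
  Up to invertible factors this leaves \<open>power_diag N \<kappa>\<close> with an additional factor \<open>p\<close> at
  position \<open>i\<close>.
\<close>

lemma smith_step:
  fixes U V K L :: "'p::prime_card padic_int mat"
  assumes U: "U \<in> GL_Zp N" and V: "V \<in> GL_Zp N" and K: "K \<in> GL_Zp N" and L: "L \<in> GL_Zp N"
    and \<kappa>: "\<kappa> \<in> Sig N" and pos: "\<And>r. r < N \<Longrightarrow> 0 \<le> \<kappa> ! r" and "i < N"
    and w: "w \<in> carrier_mat N 1" "residue_mat (V * K) * w = unit_column N"
    and lead: "\<And>r. r < i \<Longrightarrow> w $$ (r, 0) = 0" "w $$ (i, 0) \<noteq> 0"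
  shows "\<exists>K'\<in>GL_Zp N. \<exists>L'\<in>GL_Zp N. U * step_diag N 0 * V * (K * power_diag N \<kappa> * L)
    = K' * power_diag N (ring_clock i \<kappa>) * L'"
proof -
  have "0 < N" using \<open>i < N\<close> by simp
  let ?p = "uniformizer :: 'p padic_int"
  \<comment> \<open>The entries of \<open>c\<close> above row \<open>i\<close> are zero, not only divisible by \<open>p\<close>.\<close>
  define c where "c r = lift_residue (w $$ (r, 0))" for r
  define B where "B = column_mat N i c"
  define C where "C = column_mat N i (\<lambda>r. ?p ^ (nat (\<kappa> ! i) - nat (\<kappa> ! r)) * c r)"
  have "c i dvd 1" using lead(2) by (simp add: unit_iff_residue c_def)
  then have B: "B \<in> GL_Zp N" and C: "C \<in> GL_Zp N"
    using \<open>i < N\<close> by (simp_all add: GL_Zp_iff_det_unit B_def C_def det_column_mat)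
  have DC: "power_diag N \<kappa> * C = B * power_diag N \<kappa>"
  proof (rule eq_matI)
    fix r s assume "r < dim_row (B * power_diag N \<kappa>)" "s < dim_col (B * power_diag N \<kappa>)"
    then have rs: "r < N" "s < N" by (simp_all add: B_def power_diag_def mat_diag_def column_mat_def)
    have "?p ^ nat (\<kappa> ! r) * (?p ^ (nat (\<kappa> ! i) - nat (\<kappa> ! r)) * c r) = c r * ?p ^ nat (\<kappa> ! i)"
    proof (cases "r < i")
      case True
      then show ?thesis by (simp add: c_def lead)
    next
      case False
      then have "nat (\<kappa> ! r) \<le> nat (\<kappa> ! i)" using Sig_nth_mono[OF \<kappa>, of i r] rs by auto
      then show ?thesis by (simp add: mult.commute flip: mult.assoc power_add)
    qed
    then show "(power_diag N \<kappa> * C) $$ (r, s) = (B * power_diag N \<kappa>) $$ (r, s)"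
      using rs by (auto simp: power_diag_def mat_diag_mult_left[of _ N N] mat_diag_mult_right[of _ N N]
          B_def C_def column_mat_def)
  qed (simp_all add: B_def C_def power_diag_def mat_diag_def column_mat_def)
  obtain C' where C': "C' \<in> GL_Zp N" "C * C' = 1\<^sub>m N" using GL_Zp_inverse[OF C] by metis
  define P where "P = (swaprows_mat N 0 i :: 'p padic_int mat)"
  have P: "P \<in> GL_Zp N" "P * P = 1\<^sub>m N"
    unfolding P_def using swaprows_mat_GL_Zp[OF \<open>0 < N\<close> \<open>i < N\<close>] swaprows_mat_inv[OF \<open>0 < N\<close> \<open>i < N\<close>] .
  note GL = U V K L B C C'(1) P(1)
  note carriers = GL[THEN GL_Zp_carrier]
  note assoc = assoc_mult_mat[of _ N N _ N _ N]
  define Q where "Q = V * K * (B * P)"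
  have Q: "Q \<in> GL_Zp N" by (simp add: Q_def mult_GL_Zp GL)
  have "?p dvd Q $$ (r, 0)" if r: "0 < r" "r < N" for r
  proof -
    have BP: "B * P = swapcols 0 i B"
      unfolding P_def by (rule swapcols_mat[symmetric, OF carriers(5) \<open>0 < N\<close> \<open>i < N\<close>])
    have "residue (Q $$ (r, 0)) = residue (\<Sum>s<N. (V * K) $$ (r, s) * c s)"
      unfolding Q_def BP
      using r \<open>i < N\<close> carriers
      by (simp add: scalar_prod_def B_def column_mat_def lessThan_atLeast0)
    also have "\<dots> = (\<Sum>s<N. residue ((V * K) $$ (r, s)) * w $$ (s, 0))"
      by (simp add: residue_hom.hom_sum residue_hom.hom_mult c_def)
    also have "\<dots> = (residue_mat (V * K) * w) $$ (r, 0)"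
      using r w(1) carriers by (simp add: scalar_prod_def lessThan_atLeast0)
    also have "\<dots> = 0" using r by (simp add: w(2) unit_column_def)
    finally show ?thesis by (simp add: residue_eq_0_iff)
  qed
  then obtain Q' where Q': "Q' \<in> GL_Zp N" "step_diag N 0 * Q = Q' * step_diag N 0"
    using conjugate_step_diag[OF Q \<open>0 < N\<close>] by metis
  have EP: "step_diag N 0 * P = P * step_diag N i"
  proof -
    have "P * step_diag N i = mat_diag N (\<lambda>r. if r = 0 then (if i = i then ?p else 1)
        else if r = i then (if 0 = i then ?p else 1) else if r = i then ?p else 1) * P"
      unfolding P_def by (rule swaprows_mat_diag[OF \<open>0 < N\<close> \<open>i < N\<close>])
    also have "mat_diag N (\<lambda>r. if r = 0 then (if i = i then ?p else 1)
        else if r = i then (if 0 = i then ?p else 1) else if r = i then ?p else 1) = step_diag N 0"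
      by (rule mat_diag_cong) auto
    finally show ?thesis by (rule sym)
  qed
  obtain S where S: "S \<in> GL_Zp N"
    "step_diag N i * power_diag N \<kappa> = S * power_diag N (ring_clock i \<kappa>) * (S :: 'p padic_int mat)"
    by (rule step_diag_mult_power_diag[OF \<kappa> pos \<open>i < N\<close>])
  note car = carriers Q'(1)[THEN GL_Zp_carrier] S(1)[THEN GL_Zp_carrier]
    power_diag_carrier mat_diag_dim mult_carrier_mat[of _ N N _ N]
  have "power_diag N \<kappa> * L = power_diag N \<kappa> * ((C * C') * L)"
    using carriers by (simp add: C')
  also have "\<dots> = (power_diag N \<kappa> * C) * (C' * L)" by (simp add: assoc car)
  also have "\<dots> = B * (1\<^sub>m N * power_diag N \<kappa>) * (C' * L)"
    by (simp only: DC left_mult_one_mat[OF power_diag_carrier])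
  also have "\<dots> = B * P * (P * power_diag N \<kappa> * (C' * L))"
    unfolding P(2)[symmetric] by (simp only: assoc car)
  finally have DL: "power_diag N \<kappa> * L = B * P * (P * power_diag N \<kappa> * (C' * L))" .
  have "U * step_diag N 0 * V * (K * power_diag N \<kappa> * L)
      = U * step_diag N 0 * V * (K * (power_diag N \<kappa> * L))"
    by (simp only: assoc car)
  also have "\<dots> = U * (step_diag N 0 * Q) * (P * power_diag N \<kappa> * (C' * L))"
    unfolding DL Q_def by (simp only: assoc car)
  also have "\<dots> = U * Q' * (step_diag N 0 * P) * (power_diag N \<kappa> * (C' * L))"
    unfolding Q' by (simp only: assoc car)
  also have "\<dots> = U * Q' * P * (step_diag N i * power_diag N \<kappa>) * (C' * L)"
    unfolding EP by (simp only: assoc car)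
  also have "\<dots> = U * Q' * P * S * power_diag N (ring_clock i \<kappa>) * (S * (C' * L))"
    unfolding S by (simp only: assoc car)
  finally show ?thesis
    by (intro bexI[of _ "U * Q' * P * S"] bexI[of _ "S * (C' * L)"] mult_GL_Zp GL Q'(1) S(1))
qed

section \<open>Stability under small perturbations\<close>

text \<open>
  The left factors of the decompositions of \<open>A\<close>. The bound on the exponents makes this property
  of \<open>K\<close> depend on \<open>A\<close> only modulo \<open>p ^ (n + 1)\<close>.
\<close>

definition left_transform :: "nat \<Rightarrow> nat \<Rightarrow> 'p::prime_card padic_int mat \<Rightarrow> 'p padic_int mat \<Rightarrow> bool" where
  "left_transform N n A K \<longleftrightarrow> K \<in> GL_Zp N \<and>
     (\<exists>\<kappa>\<in>Sig N. (\<forall>r<N. 0 \<le> \<kappa> ! r \<and> \<kappa> ! r \<le> int n) \<and>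
        (\<exists>L\<in>GL_Zp N. A = K * power_diag N \<kappa> * L))"

lemma one_plus_uniformizer_GL_Zp:
  assumes "F \<in> carrier_mat N N"
  shows "1\<^sub>m N + (uniformizer :: 'p::prime_card padic_int) \<cdot>\<^sub>m F \<in> GL_Zp N"
proof -
  have "residue_mat (1\<^sub>m N + uniformizer \<cdot>\<^sub>m F) = 1\<^sub>m N"
    using assms
    by (intro eq_matI) (auto simp: residue_hom.hom_add residue_eq_0_iff)
  then show ?thesis using assms by (simp add: GL_Zp_iff_residue)
qed

text \<open>
  Write \<open>A = K * D * L\<close> with \<open>D = power_diag N \<kappa>\<close>. As the exponents are at most \<open>n\<close>, an error
  divisible by \<open>p ^ (n + 1)\<close> has the form \<open>K * D * (p F) * L\<close>, hence
  \<open>A' = K * D * ((1 + p F) * L)\<close> with the same \<open>K\<close>.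
\<close>

lemma left_transform_cong:
  fixes A A' :: "'p::prime_card padic_int mat"
  assumes A: "left_transform N n A K" and A': "A' \<in> carrier_mat N N"
    and close: "\<And>i j. i < N \<Longrightarrow> j < N \<Longrightarrow> uniformizer ^ Suc n dvd A' $$ (i, j) - A $$ (i, j)"
  shows "left_transform N n A' K"
proof -
  let ?p = "uniformizer :: 'p padic_int"
  from A obtain \<kappa> L where K: "K \<in> GL_Zp N" and \<kappa>: "\<kappa> \<in> Sig N"
    and bounds: "\<And>r. r < N \<Longrightarrow> 0 \<le> \<kappa> ! r \<and> \<kappa> ! r \<le> int n"
    and L: "L \<in> GL_Zp N" and A_eq: "A = K * power_diag N \<kappa> * L"
    unfolding left_transform_def by blast
  \<comment> \<open>\<open>E\<close> is the error divided by \<open>p ^ (n + 1)\<close>, \<open>G\<close> is \<open>E\<close> in the coordinates given by \<open>K\<close> and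
    \<open>L\<close>, and \<open>F\<close> is \<open>p ^ n\<close> times \<open>G\<close> with \<open>power_diag N \<kappa>\<close> divided out.\<close>
  define E where "E = mat N N (\<lambda>(i, j). SOME y. A' $$ (i, j) - A $$ (i, j) = ?p ^ Suc n * y)"
  have E: "A' $$ (i, j) - A $$ (i, j) = ?p ^ Suc n * E $$ (i, j)" if "i < N" "j < N" for i j
  proof -
    have "A' $$ (i, j) - A $$ (i, j)
        = ?p ^ Suc n * (SOME y. A' $$ (i, j) - A $$ (i, j) = ?p ^ Suc n * y)"
      using close[OF that] unfolding dvd_def by (rule someI_ex)
    then show ?thesis using that by (simp add: E_def)
  qed
  obtain K' where K': "K' \<in> GL_Zp N" "K * K' = 1\<^sub>m N" using GL_Zp_inverse[OF K] by metis
  obtain L' where L': "L' \<in> GL_Zp N" "L' * L = 1\<^sub>m N" using GL_Zp_inverse[OF L] by metis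
  have Ec: "E \<in> carrier_mat N N" by (simp add: E_def)
  note car = Ec K[THEN GL_Zp_carrier] L[THEN GL_Zp_carrier] K'(1)[THEN GL_Zp_carrier]
    L'(1)[THEN GL_Zp_carrier] power_diag_carrier mult_carrier_mat[of _ N N _ N]
  note assoc = assoc_mult_mat[of _ N N _ N _ N]
  define G where "G = K' * E * L'"
  have Gc: "G \<in> carrier_mat N N" by (simp add: G_def car)
  define F where "F = mat N N (\<lambda>(i, j). ?p ^ (n - nat (\<kappa> ! i)) * G $$ (i, j))"
  have Fc: "F \<in> carrier_mat N N" by (simp add: F_def)
  have "K * (?p ^ Suc n \<cdot>\<^sub>m G) * L = ?p ^ Suc n \<cdot>\<^sub>m (K * G * L)"
    using mult_smult_distrib[OF car(2) Gc] mult_smult_assoc_mat[of "K * G" N N L N]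
    by (simp add: car Gc)
  also have "K * G * L = (K * K') * E * (L' * L)" unfolding G_def by (simp only: assoc car)
  also have "\<dots> = E" by (simp only: K' L' left_mult_one_mat[OF Ec] right_mult_one_mat[OF Ec])
  finally have KGL: "K * (?p ^ Suc n \<cdot>\<^sub>m G) * L = ?p ^ Suc n \<cdot>\<^sub>m E" .
  have DF: "power_diag N \<kappa> * (?p \<cdot>\<^sub>m F) = ?p ^ Suc n \<cdot>\<^sub>m G"
  proof (rule eq_matI)
    fix r s assume "r < dim_row (?p ^ Suc n \<cdot>\<^sub>m G)" "s < dim_col (?p ^ Suc n \<cdot>\<^sub>m G)"
    then have rs: "r < N" "s < N" using Gc by auto
    have "nat (\<kappa> ! r) \<le> n" using bounds[OF rs(1)] by auto
    then have "?p ^ nat (\<kappa> ! r) * (?p * (?p ^ (n - nat (\<kappa> ! r)))) = ?p ^ Suc n"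
      by (simp flip: power_add power_Suc)
    then have "?p ^ nat (\<kappa> ! r) * (?p * (?p ^ (n - nat (\<kappa> ! r)) * G $$ (r, s))) = ?p ^ Suc n * G $$ (r, s)"
      by (simp only: mult.assoc[symmetric])
    then show "(power_diag N \<kappa> * (?p \<cdot>\<^sub>m F)) $$ (r, s) = (?p ^ Suc n \<cdot>\<^sub>m G) $$ (r, s)"
      using rs Gc Fc by (simp add: power_diag_def mat_diag_mult_left[of _ N N] F_def)
  qed (use Gc Fc in \<open>simp_all add: power_diag_def mat_diag_def\<close>)
  have "A' = A + ?p ^ Suc n \<cdot>\<^sub>m E"
  proof (rule eq_matI)
    fix i j assume "i < dim_row (A + ?p ^ Suc n \<cdot>\<^sub>m E)" "j < dim_col (A + ?p ^ Suc n \<cdot>\<^sub>m E)"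
    then have "i < N" "j < N" using Ec by auto
    then show "A' $$ (i, j) = (A + ?p ^ Suc n \<cdot>\<^sub>m E) $$ (i, j)"
      using E[of i j] Ec by (simp add: algebra_simps)
  qed (use A' Ec in auto)
  also have "\<dots> = K * power_diag N \<kappa> * L + K * (?p ^ Suc n \<cdot>\<^sub>m G) * L" by (simp only: A_eq KGL)
  also have "\<dots> = (K * power_diag N \<kappa> + K * (power_diag N \<kappa> * (?p \<cdot>\<^sub>m F))) * L"
    unfolding DF by (rule add_mult_distrib_mat[where nr = N and n = N and nc = N, symmetric])
      (simp_all add: car Gc)
  also have "K * power_diag N \<kappa> + K * (power_diag N \<kappa> * (?p \<cdot>\<^sub>m F))
      = K * power_diag N \<kappa> * (1\<^sub>m N + ?p \<cdot>\<^sub>m F)"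
  proof -
    have KD: "K * power_diag N \<kappa> \<in> carrier_mat N N" and pF: "?p \<cdot>\<^sub>m F \<in> carrier_mat N N"
      using car Fc by simp_all
    show ?thesis
      by (simp only: mult_add_distrib_mat[OF KD one_carrier_mat pF] right_mult_one_mat[OF KD]
          assoc_mult_mat[OF car(2) power_diag_carrier pF])
  qed
  also have "K * power_diag N \<kappa> * (1\<^sub>m N + ?p \<cdot>\<^sub>m F) * L = K * power_diag N \<kappa> * ((1\<^sub>m N + ?p \<cdot>\<^sub>m F) * L)"
    by (rule assoc) (simp_all add: car Fc)
  finally have "A' = K * power_diag N \<kappa> * ((1\<^sub>m N + ?p \<cdot>\<^sub>m F) * L)" .
  moreover have "(1\<^sub>m N + ?p \<cdot>\<^sub>m F) * L \<in> GL_Zp N"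
    by (intro mult_GL_Zp one_plus_uniformizer_GL_Zp Fc L)
  ultimately show ?thesis
    unfolding left_transform_def using K \<kappa> bounds by blast
qed

section \<open>Haar measure modulo powers of the prime\<close>

text \<open>
  Matrices modulo \<open>p ^ k\<close>, with each residue class represented by its least nonnegative element.
  In each size there are finitely many, so random matrices become discrete random variables.
\<close>

definition reduce :: "nat \<Rightarrow> 'p::prime_card padic_int mat \<Rightarrow> int mat" where
  "reduce k = map_mat (\<lambda>x. Rep_padic_int x k)"

lemma reduce_eq_iff:
  fixes A B :: "'p::prime_card padic_int mat"
  assumes "A \<in> carrier_mat N M" "B \<in> carrier_mat N M"
  shows "reduce k A = reduce k B
    \<longleftrightarrow> (\<forall>i<N. \<forall>j<M. uniformizer ^ k dvd B $$ (i, j) - A $$ (i, j))"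
proof -
  have "reduce k A = reduce k B
      \<longleftrightarrow> (\<forall>i<N. \<forall>j<M. Rep_padic_int (B $$ (i, j)) k = Rep_padic_int (A $$ (i, j)) k)"
    using assms by (fastforce simp: reduce_def mat_eq_iff)
  then show ?thesis by (simp only: uniformizer_power_dvd_diff_iff)
qed

lemma residue_mat_reduce: "residue_mat A = map_mat of_int (reduce 1 A)"
  by (rule eq_matI) (simp_all add: reduce_def residue_def)

lemma space_GL_Zp_borel [simp]: "space (GL_Zp_borel N) = GL_Zp N"
  by (auto simp: GL_Zp_borel_def space_measure_of_conv)

lemma GL_Zp_open_sets: "GL_Zp_open N S \<Longrightarrow> S \<in> sets (GL_Zp_borel N)"
  unfolding GL_Zp_borel_def
  by (subst sets_measure_of) (auto simp: GL_Zp_open_def)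

text \<open>
  A union of congruence classes modulo \<open>p ^ k\<close> is open.
\<close>

lemma reduce_measurable:
  "reduce k \<in> (GL_Zp_borel N :: 'p::prime_card padic_int mat measure) \<rightarrow>\<^sub>M count_space UNIV"
proof (rule measurableI)
  fix S :: "int mat set"
  have "GL_Zp_open N (reduce k -` S \<inter> (GL_Zp N :: 'p padic_int mat set))"
    unfolding GL_Zp_open_def
  proof (intro conjI ballI exI[of _ k] impI)
    fix A B :: "'p padic_int mat"
    assume A: "A \<in> reduce k -` S \<inter> GL_Zp N" and B: "B \<in> GL_Zp N"
      and close: "\<forall>i<N. \<forall>j<N. of_nat CARD('p) ^ k dvd B $$ (i, j) - A $$ (i, j)"
    then have "reduce k A = reduce k B"
      by (simp add: reduce_eq_iff[of _ N N] GL_Zp_carrier)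
    then show "B \<in> reduce k -` S \<inter> GL_Zp N" using A B by simp
  qed simp
  then show "reduce k -` S \<inter> space (GL_Zp_borel N :: 'p padic_int mat measure) \<in> sets (GL_Zp_borel N)"
    by (simp add: GL_Zp_open_sets)
qed simp

lemma mult_left_measurable:
  fixes A :: "'p::prime_card padic_int mat"
  assumes A: "A \<in> GL_Zp N"
  shows "(\<lambda>B. A * B) \<in> GL_Zp_borel N \<rightarrow>\<^sub>M GL_Zp_borel N"
  unfolding GL_Zp_borel_def[of N]
proof (rule measurable_measure_of)
  show "{S. GL_Zp_open N S} \<subseteq> Pow (GL_Zp N :: 'p padic_int mat set)" by (auto simp: GL_Zp_open_def)
  show "(*) A \<in> space (sigma (GL_Zp N) {S. GL_Zp_open N S}) \<rightarrow> GL_Zp N"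
    using mult_GL_Zp[OF A] by (auto simp: space_measure_of_conv)
  fix S :: "'p padic_int mat set" assume "S \<in> {S. GL_Zp_open N S}"
  then have S: "S \<subseteq> GL_Zp N" "\<And>C. C \<in> S \<Longrightarrow> \<exists>k. \<forall>B\<in>GL_Zp N.
        (\<forall>i<N. \<forall>j<N. of_nat CARD('p) ^ k dvd B $$ (i, j) - C $$ (i, j)) \<longrightarrow> B \<in> S"
    by (simp_all add: GL_Zp_open_def)
  have "GL_Zp_open N ((*) A -` S \<inter> GL_Zp N)"
    unfolding GL_Zp_open_def
  proof (intro conjI ballI)
    fix C assume C: "C \<in> (*) A -` S \<inter> GL_Zp N"
    then have "C \<in> GL_Zp N" by simp
    from C obtain k where k: "\<And>B. B \<in> GL_Zp N \<Longrightarrow>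
        (\<forall>i<N. \<forall>j<N. uniformizer ^ k dvd B $$ (i, j) - (A * C) $$ (i, j)) \<Longrightarrow> B \<in> S"
      using S(2)[of "A * C"] by auto
    have "B \<in> (*) A -` S \<inter> GL_Zp N"
      if B: "B \<in> GL_Zp N" and close: "\<forall>i<N. \<forall>j<N. uniformizer ^ k dvd B $$ (i, j) - C $$ (i, j)" for B
    proof -
      have "uniformizer ^ k dvd (A * B) $$ (i, j) - (A * C) $$ (i, j)" if "i < N" "j < N" for i j
      proof -
        have "(A * B) $$ (i, j) - (A * C) $$ (i, j)
            = (\<Sum>l<N. A $$ (i, l) * (B $$ (l, j) - C $$ (l, j)))"
          using that A B \<open>C \<in> GL_Zp N\<close>
          by (simp add: scalar_prod_def lessThan_atLeast0 right_diff_distrib sum_subtractf)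
        then show ?thesis using close that by (auto intro!: dvd_sum dvd_mult)
      qed
      then have "A * B \<in> S" using mult_GL_Zp[OF A B] by (intro k) auto
      then show ?thesis using B by simp
    qed
    then show "\<exists>k. \<forall>B\<in>GL_Zp N. (\<forall>i<N. \<forall>j<N. of_nat CARD('p) ^ k dvd B $$ (i, j) - C $$ (i, j))
        \<longrightarrow> B \<in> (*) A -` S \<inter> GL_Zp N" by blast
  qed simp
  then have "(*) A -` S \<inter> GL_Zp N \<in> sets (GL_Zp_borel N)" by (rule GL_Zp_open_sets)
  then show "(*) A -` S \<inter> space (sigma (GL_Zp N) {S. GL_Zp_open N S}) \<in> sets (sigma (GL_Zp N) {S. GL_Zp_open N S})"
    by (simp add: GL_Zp_borel_def space_measure_of_conv)
qed

section \<open>The position of the leading entry\<close>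

text \<open>
  The solution of \<open>b * w = x\<close> has its first nonzero entry in row \<open>i\<close>. Columns are matrices with
  a single column.
\<close>

definition leads :: "nat \<Rightarrow> 'a::field mat \<Rightarrow> 'a mat \<Rightarrow> nat \<Rightarrow> bool" where
  "leads N b x i \<longleftrightarrow> (\<exists>w\<in>carrier_mat N 1. b * w = x \<and> (\<forall>r<i. w $$ (r, 0) = 0) \<and> w $$ (i, 0) \<noteq> 0)"

lemma GL_Zp_residue_inverse:
  assumes "A \<in> GL_Zp N"
  obtains b where "b \<in> carrier_mat N N" "residue_mat A * b = 1\<^sub>m N" "b * residue_mat A = 1\<^sub>m N"
proof -
  obtain B where B: "B \<in> GL_Zp N" "A * B = 1\<^sub>m N" "B * A = 1\<^sub>m N"
    using GL_Zp_inverse[OF assms] by metis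
  note carrier = GL_Zp_carrier[OF assms] GL_Zp_carrier[OF B(1)]
  show ?thesis
  proof (rule that[of "residue_mat B"])
    show "residue_mat A * residue_mat B = 1\<^sub>m N"
      using residue_hom.mat_hom_mult[OF carrier] by (simp only: B residue_hom.mat_hom_one)
    show "residue_mat B * residue_mat A = 1\<^sub>m N"
      using residue_hom.mat_hom_mult[OF carrier(2,1)] by (simp only: B residue_hom.mat_hom_one)
  qed (simp add: carrier)
qed

lemma leads_unique:
  assumes A: "A \<in> GL_Zp N" and x: "x \<in> carrier_mat N 1" "x \<noteq> 0\<^sub>m N 1"
  shows "\<exists>!i. i < N \<and> leads N (residue_mat A) x i"
proof -
  obtain b where b: "b \<in> carrier_mat N N" "residue_mat A * b = 1\<^sub>m N" "b * residue_mat A = 1\<^sub>m N"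
    by (rule GL_Zp_residue_inverse[OF A])
  have Ac: "residue_mat A \<in> carrier_mat N N" using GL_Zp_carrier[OF A] by simp
  define w where "w = b * x"
  have w: "w \<in> carrier_mat N 1" using b x by (simp add: w_def)
  have Aw: "residue_mat A * w = x"
    using assoc_mult_mat[OF Ac b(1) x(1)] b x by (simp add: w_def)
  have w_unique: "v = w" if "v \<in> carrier_mat N 1" "residue_mat A * v = x" for v
    using assoc_mult_mat[OF b(1) Ac that(1)] b that by (simp add: w_def)
  have "\<exists>i<N. w $$ (i, 0) \<noteq> 0"
  proof (rule ccontr)
    assume "\<not> ?thesis"
    then have "w = 0\<^sub>m N 1" using w by (intro eq_matI) auto
    then show False using x Aw right_mult_zero_mat[OF Ac, of 1] by simp
  qed
  then obtain i where i: "i < N" "w $$ (i, 0) \<noteq> 0" "\<And>r. r < i \<Longrightarrow> w $$ (r, 0) = 0"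
    using exists_least_iff[of "\<lambda>i. i < N \<and> w $$ (i, 0) \<noteq> 0"] by (metis less_trans)
  show ?thesis
  proof (rule ex1I[of _ i])
    show "i < N \<and> leads N (residue_mat A) x i"
      using i w Aw unfolding leads_def by blast
  next
    fix j assume "j < N \<and> leads N (residue_mat A) x j"
    then have "(\<forall>r<j. w $$ (r, 0) = 0) \<and> w $$ (j, 0) \<noteq> 0"
      unfolding leads_def using w_unique by blast
    then show "j = i" using i by (metis linorder_neqE_nat)
  qed
qed

lemma card_columns:
  fixes B :: "nat \<Rightarrow> 'a::finite set"
  shows "card {w \<in> carrier_mat N 1. \<forall>r<N. w $$ (r, 0) \<in> B r} = (\<Prod>r<N. card (B r))"
proof -
  have "bij_betw (\<lambda>f. mat N 1 (\<lambda>(r, s). f r)) (PiE {..<N} B)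
      {w \<in> carrier_mat N 1. \<forall>r<N. w $$ (r, 0) \<in> B r}"
  proof (rule bij_betwI[where g = "\<lambda>w. \<lambda>r\<in>{..<N}. w $$ (r, 0)"])
    show "(\<lambda>r\<in>{..<N}. mat N 1 (\<lambda>(r, s). f r) $$ (r, 0)) = f" if "f \<in> PiE {..<N} B" for f
      using that by (auto simp: fun_eq_iff PiE_def extensional_def)
    show "mat N 1 (\<lambda>(r, s). (\<lambda>r\<in>{..<N}. w $$ (r, 0)) r) = w"
      if "w \<in> {w \<in> carrier_mat N 1. \<forall>r<N. w $$ (r, 0) \<in> B r}" for w
      using that by (intro eq_matI) auto
    show "(\<lambda>f. mat N 1 (\<lambda>(r, s). f r)) \<in> PiE {..<N} B \<rightarrow> {w \<in> carrier_mat N 1. \<forall>r<N. w $$ (r, 0) \<in> B r}"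
      by (rule Pi_I) (simp add: PiE_mem)
    show "(\<lambda>w. \<lambda>r\<in>{..<N}. w $$ (r, 0)) \<in> {w \<in> carrier_mat N 1. \<forall>r<N. w $$ (r, 0) \<in> B r} \<rightarrow> PiE {..<N} B"
      by (rule Pi_I) simp
  qed
  then have "card (PiE {..<N} B) = card {w \<in> carrier_mat N 1. \<forall>r<N. w $$ (r, 0) \<in> B r}"
    by (rule bij_betw_same_card)
  then show ?thesis by (simp add: card_PiE)
qed

lemma card_mod_ring: "CARD('p::prime_card mod_ring) = CARD('p)"
proof -
  have "CARD('p mod_ring) = card (range (to_int_mod_ring :: 'p mod_ring \<Rightarrow> int))"
    by (rule card_image[symmetric]) (metis injI of_int_mod_ring_to_int_mod_ring)
  then show ?thesis by (simp add: range_to_int_mod_ring)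
qed

lemma card_columns_leading:
  assumes "i < N"
  shows "card {w \<in> carrier_mat N 1 :: 'p::prime_card mod_ring mat set.
      (\<forall>r<i. w $$ (r, 0) = 0) \<and> w $$ (i, 0) \<noteq> 0} = (CARD('p) - 1) * CARD('p) ^ (N - 1 - i)"
proof -
  let ?B = "\<lambda>r. if r < i then {0} else if r = i then UNIV - {0} else UNIV :: 'p mod_ring set"
  have "{w \<in> carrier_mat N 1 :: 'p mod_ring mat set. (\<forall>r<i. w $$ (r, 0) = 0) \<and> w $$ (i, 0) \<noteq> 0}
      = {w \<in> carrier_mat N 1. \<forall>r<N. w $$ (r, 0) \<in> ?B r}"
    using assms by (auto split: if_splits)
  also have "card \<dots> = (\<Prod>r<N. card (?B r))" by (rule card_columns)
  also have "{..<N} = {..<i} \<union> {i} \<union> {i<..<N}" using assms by auto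
  also have "(\<Prod>r\<in>{..<i} \<union> {i} \<union> {i<..<N}. card (?B r))
      = (\<Prod>r\<in>{..<i}. card (?B r)) * (\<Prod>r\<in>{i}. card (?B r)) * (\<Prod>r\<in>{i<..<N}. card (?B r))"
    by (subst prod.union_disjoint; auto)+
  also have "(\<Prod>r\<in>{i<..<N}. card (?B r)) = (\<Prod>r\<in>{i<..<N}. CARD('p))"
    by (rule prod.cong) (auto simp: card_mod_ring)
  also have "(\<Prod>r\<in>{..<i}. card (?B r)) = 1" by (rule prod.neutral) auto
  also have "(\<Prod>r\<in>{i}. card (?B r)) = CARD('p) - 1"
    by (simp add: card_Diff_subset card_mod_ring)
  finally show ?thesis by simp
qed

lemma finite_columns: "finite (carrier_mat N 1 :: 'a::finite mat set)"
proof -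
  have "carrier_mat N 1 \<subseteq> (\<lambda>f. mat N 1 (\<lambda>(r, s). f r)) ` (PiE {..<N} (\<lambda>_. UNIV :: 'a set))"
  proof
    fix w :: "'a mat" assume "w \<in> carrier_mat N 1"
    then have "w = mat N 1 (\<lambda>(r, s). (\<lambda>r\<in>{..<N}. w $$ (r, 0)) r)" by (intro eq_matI) auto
    then show "w \<in> (\<lambda>f. mat N 1 (\<lambda>(r, s). f r)) ` (PiE {..<N} (\<lambda>_. UNIV))"
      by (rule image_eqI[where x = "\<lambda>r\<in>{..<N}. w $$ (r, 0)"]) simp
  qed
  then show ?thesis by (rule finite_subset) (intro finite_imageI finite_PiE; simp)
qed

lemma card_nonzero_columns:
  "card (carrier_mat N 1 - {0\<^sub>m N 1} :: 'p::prime_card mod_ring mat set) = CARD('p) ^ N - 1"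
  using card_columns[of N "\<lambda>_. UNIV :: 'p mod_ring set"]
  by (simp add: card_Diff_subset card_mod_ring)

text \<open>
  Multiplication by an invertible matrix is a bijection from the columns \<open>w\<close> with leading entry
  in row \<open>i\<close> to the targets \<open>x\<close> in question.
\<close>

lemma card_leads:
  fixes A :: "'p::prime_card padic_int mat"
  assumes A: "A \<in> GL_Zp N" and "i < N"
  shows "card {x \<in> carrier_mat N 1 - {0\<^sub>m N 1}. leads N (residue_mat A) x i}
    = (CARD('p) - 1) * CARD('p) ^ (N - 1 - i)"
proof -
  let ?W = "{w \<in> carrier_mat N 1 :: 'p mod_ring mat set. (\<forall>r<i. w $$ (r, 0) = 0) \<and> w $$ (i, 0) \<noteq> 0}"
  obtain b where b: "b \<in> carrier_mat N N" "residue_mat A * b = 1\<^sub>m N" "b * residue_mat A = 1\<^sub>m N"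
    by (rule GL_Zp_residue_inverse[OF A])
  have Ac: "residue_mat A \<in> carrier_mat N N" using GL_Zp_carrier[OF A] by simp
  have cancel: "b * (residue_mat A * w) = w" if "w \<in> carrier_mat N 1" for w
    using assoc_mult_mat[OF b(1) Ac that] b that by simp
  have inj: "inj_on ((*) (residue_mat A)) ?W"
    by (rule inj_on_inverseI[where g = "(*) b"]) (simp add: cancel)
  have image: "(*) (residue_mat A) ` ?W = {x \<in> carrier_mat N 1 - {0\<^sub>m N 1}. leads N (residue_mat A) x i}"
  proof (intro equalityI subsetI)
    fix x assume "x \<in> (*) (residue_mat A) ` ?W"
    then obtain w where w: "w \<in> ?W" "x = residue_mat A * w" by blast
    have "x \<noteq> 0\<^sub>m N 1"
    proof
      assume "x = 0\<^sub>m N 1"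
      then have "w = 0\<^sub>m N 1" using cancel[of w] w right_mult_zero_mat[OF b(1), of 1] by simp
      then show False using w \<open>i < N\<close> by simp
    qed
    then show "x \<in> {x \<in> carrier_mat N 1 - {0\<^sub>m N 1}. leads N (residue_mat A) x i}"
      using w Ac unfolding leads_def by auto
  qed (auto simp: leads_def)
  show ?thesis
    unfolding image[symmetric] card_image[OF inj] by (rule card_columns_leading[OF \<open>i < N\<close>])
qed

text \<open>
  A nonzero column is the first column of an invertible matrix; take the inverse of that matrix.
\<close>

lemma GL_Zp_transitive:
  fixes x :: "'p::prime_card mod_ring mat"
  assumes x: "x \<in> carrier_mat N 1" "x \<noteq> 0\<^sub>m N 1"
  obtains A where "A \<in> GL_Zp N" "residue_mat A * x = unit_column N"
proof -
  have "\<exists>i<N. x $$ (i, 0) \<noteq> 0"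
  proof (rule ccontr)
    assume "\<not> ?thesis"
    then have "x = 0\<^sub>m N 1" using x by (intro eq_matI) auto
    then show False using x by simp
  qed
  then obtain i where i: "i < N" "x $$ (i, 0) \<noteq> 0" by blast
  then have "0 < N" by simp
  define B where "B = column_mat N i (\<lambda>r. lift_residue (x $$ (r, 0)))"
  have B: "B \<in> GL_Zp N" "B \<in> carrier_mat N N"
    using i by (simp_all add: GL_Zp_iff_det_unit B_def det_column_mat unit_iff_residue)
  define C where "C = swapcols 0 i B"
  have "C = B * swaprows_mat N 0 i"
    unfolding C_def by (rule swapcols_mat[OF B(2) \<open>0 < N\<close> i(1)])
  then have C: "C \<in> GL_Zp N"
    using mult_GL_Zp[OF B(1) swaprows_mat_GL_Zp[OF \<open>0 < N\<close> i(1)]] by simp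
  obtain A where A: "A \<in> GL_Zp N" "A * C = 1\<^sub>m N" using GL_Zp_inverse[OF C] by metis
  have Cc: "C \<in> carrier_mat N N" and Ac: "A \<in> carrier_mat N N"
    using A C by (simp_all add: GL_Zp_carrier)
  have Cx: "residue_mat C * unit_column N = x"
  proof (rule eq_matI)
    fix r s assume "r < dim_row x" "s < dim_col x"
    then have rs: "r < N" "s = 0" using x by auto
    have "(residue_mat C * unit_column N) $$ (r, s) = (\<Sum>l<N. residue (C $$ (r, l)) * (if l = 0 then 1 else 0))"
      using rs Cc by (simp add: scalar_prod_def unit_column_def lessThan_atLeast0)
    also have "\<dots> = (\<Sum>l\<in>{0}. residue (C $$ (r, l)) * (if l = 0 then 1 else 0))"
      using \<open>0 < N\<close> by (intro sum.mono_neutral_right) auto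
    also have "\<dots> = residue (C $$ (r, 0))" by simp
    also have "\<dots> = x $$ (r, s)"
      using rs i \<open>0 < N\<close> by (simp add: C_def B_def column_mat_def)
    finally show "(residue_mat C * unit_column N) $$ (r, s) = x $$ (r, s)" .
  qed (use x Cc in \<open>auto simp: unit_column_def\<close>)
  have "residue_mat A * x = residue_mat A * residue_mat C * unit_column N"
    unfolding Cx[symmetric]
    by (rule assoc_mult_mat[symmetric, of _ N N _ N _ 1]) (use Ac Cc in \<open>simp_all add: unit_column_def\<close>)
  also have "residue_mat A * residue_mat C = 1\<^sub>m N"
    using residue_hom.mat_hom_mult[OF Ac Cc] by (simp only: A residue_hom.mat_hom_one)
  also have "1\<^sub>m N * unit_column N = (unit_column N :: 'p mod_ring mat)"
    by (rule left_mult_one_mat[of _ _ 1]) (simp add: unit_column_def)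
  finally show ?thesis using that A by blast
qed

lemma leads_measurable:
  fixes K :: "'p::prime_card padic_int mat"
  assumes K: "K \<in> GL_Zp N"
  shows "{V \<in> GL_Zp N. leads N (residue_mat (V * K)) x i} \<in> sets (GL_Zp_borel N)"
proof -
  let ?S = "{B. leads N (map_mat of_int B * residue_mat K) x i}"
  have "{V \<in> GL_Zp N. leads N (residue_mat (V * K)) x i} = reduce 1 -` ?S \<inter> GL_Zp N"
  proof (rule Set.set_eqI)
    fix V
    show "V \<in> {V \<in> GL_Zp N. leads N (residue_mat (V * K)) x i} \<longleftrightarrow> V \<in> reduce 1 -` ?S \<inter> GL_Zp N"
    proof (cases "V \<in> GL_Zp N")
      case True
      have "residue_mat (V * K) = map_mat of_int (reduce 1 V) * residue_mat K"
        unfolding residue_mat_reduce[of V, symmetric]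
        by (rule residue_hom.mat_hom_mult[OF GL_Zp_carrier[OF True] GL_Zp_carrier[OF K]])
      then show ?thesis using True by simp
    qed simp
  qed
  also have "\<dots> \<in> sets (GL_Zp_borel N)"
    using measurable_sets[OF reduce_measurable, of ?S 1 N] by simp
  finally show ?thesis .
qed

text \<open>
  Replacing \<open>V\<close> by \<open>A * V\<close> replaces the target \<open>x\<close> by \<open>A * x\<close>. So by left invariance and
  transitivity the probability does not depend on the nonzero target. Among the
  \<open>p ^ N - 1\<close> targets, the number of successes is the constant of \<open>card_leads\<close>, for every \<open>V\<close> and
  \<open>K\<close>; divide it by the number of targets.
\<close>

lemma haar_leads:
  fixes \<mu> :: "'p::prime_card padic_int mat measure"
  assumes \<mu>: "haar_prob_measure N \<mu>" and K: "K \<in> GL_Zp N" and "i < N"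
  shows "measure \<mu> {V \<in> GL_Zp N. leads N (residue_mat (V * K)) (unit_column N) i}
    = (real CARD('p) - 1) * real CARD('p) ^ (N - 1 - i) / (real CARD('p) ^ N - 1)"
proof -
  let ?E = "\<lambda>x. {V \<in> GL_Zp N. leads N (residue_mat (V * K)) x i}"
  let ?X = "carrier_mat N 1 - {0\<^sub>m N 1} :: 'p mod_ring mat set"
  let ?u = "unit_column N :: 'p mod_ring mat"
  interpret prob_space \<mu> using \<mu> by (simp add: haar_prob_measure_def)
  have space: "space \<mu> = GL_Zp N" and sets: "sets \<mu> = sets (GL_Zp_borel N)"
    and invariant: "\<And>A. A \<in> GL_Zp N \<Longrightarrow> distr \<mu> (GL_Zp_borel N) (\<lambda>B. A * B) = \<mu>"
    using \<mu> by (auto simp: haar_prob_measure_def)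
  have E: "?E x \<in> sets \<mu>" for x
    unfolding sets by (rule leads_measurable[OF K])
  have same: "prob (?E x) = prob (?E ?u)" if x: "x \<in> ?X" for x
  proof -
    have xc: "x \<in> carrier_mat N 1" and x0: "x \<noteq> 0\<^sub>m N 1" using x by simp_all
    obtain A where A: "A \<in> GL_Zp N" "residue_mat A * x = ?u"
      by (rule GL_Zp_transitive[OF xc x0])
    obtain b where b: "b \<in> carrier_mat N N" "residue_mat A * b = 1\<^sub>m N" "b * residue_mat A = 1\<^sub>m N"
      by (rule GL_Zp_residue_inverse[OF A(1)])
    have Ac: "residue_mat A \<in> carrier_mat N N" using GL_Zp_carrier[OF A(1)] by simp
    have cancel: "residue_mat A * y = ?u \<longleftrightarrow> y = x" if y: "y \<in> carrier_mat N 1" for y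
    proof
      assume "residue_mat A * y = ?u"
      then have "b * (residue_mat A * y) = b * (residue_mat A * x)" using A by simp
      then show "y = x"
        using assoc_mult_mat[OF b(1) Ac y] assoc_mult_mat[OF b(1) Ac xc] b y xc by simp
    qed (use A in simp)
    have "(\<lambda>B. A * B) -` ?E ?u \<inter> space \<mu> = ?E x"
    proof (rule Set.set_eqI)
      fix V
      show "V \<in> (\<lambda>B. A * B) -` ?E ?u \<inter> space \<mu> \<longleftrightarrow> V \<in> ?E x"
      proof (cases "V \<in> GL_Zp N")
        case True
        have c: "V \<in> carrier_mat N N" "K \<in> carrier_mat N N" "A \<in> carrier_mat N N"
          using True K A by (simp_all add: GL_Zp_carrier)
        have "A * V * K = A * (V * K)" by (rule assoc_mult_mat[OF c(3,1,2)])
        then have mult: "residue_mat (A * V * K) = residue_mat A * residue_mat (V * K)"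
          using residue_hom.mat_hom_mult[of A N N "V * K" N] c by simp
        have VKc: "residue_mat (V * K) \<in> carrier_mat N N" using c by simp
        have "leads N (residue_mat (A * V * K)) ?u i \<longleftrightarrow> leads N (residue_mat (V * K)) x i"
          unfolding leads_def mult
          by (intro bex_cong refl conj_cong)
            (simp add: assoc_mult_mat[OF Ac VKc] cancel mult_carrier_mat[OF VKc])
        then show ?thesis using True A space mult_GL_Zp by auto
      qed (auto simp: space)
    qed
    moreover have "prob (?E ?u) = measure (distr \<mu> (GL_Zp_borel N) (\<lambda>B. A * B)) (?E ?u)"
      by (simp only: invariant[OF A(1)])
    moreover have "\<dots> = prob ((\<lambda>B. A * B) -` ?E ?u \<inter> space \<mu>)"
      using mult_left_measurable[OF A(1)] E[of ?u]
      by (intro measure_distr) (simp_all add: sets cong: measurable_cong_sets)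
    ultimately show ?thesis by simp
  qed
  have finite: "finite ?X" using finite_columns by (rule finite_Diff)
  have "(\<Sum>x\<in>?X. prob (?E x)) = (\<integral>V. (\<Sum>x\<in>?X. indicator (?E x) V) \<partial>\<mu>)"
    using E by (subst Bochner_Integration.integral_sum) (auto simp: emeasure_eq_measure)
  also have "\<dots> = (\<integral>V. real ((CARD('p) - 1) * CARD('p) ^ (N - 1 - i)) \<partial>\<mu>)"
  proof (rule Bochner_Integration.integral_cong[OF refl])
    fix V assume "V \<in> space \<mu>"
    then have V: "V \<in> GL_Zp N" by (simp add: space)
    have "(\<Sum>x\<in>?X. indicator (?E x) V) = (\<Sum>x\<in>?X. if leads N (residue_mat (V * K)) x i then 1 else 0 :: real)"
      using V by (intro sum.cong) auto
    also have "\<dots> = real (card {x \<in> ?X. leads N (residue_mat (V * K)) x i})"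
      using finite by (simp add: sum.If_cases Int_def)
    finally show "(\<Sum>x\<in>?X. indicator (?E x) V) = real ((CARD('p) - 1) * CARD('p) ^ (N - 1 - i))"
      using card_leads[OF mult_GL_Zp[OF V K] \<open>i < N\<close>] by simp
  qed
  also have "\<dots> = real ((CARD('p) - 1) * CARD('p) ^ (N - 1 - i))" by (simp add: prob_space)
  finally have "real (card ?X) * prob (?E ?u) = real ((CARD('p) - 1) * CARD('p) ^ (N - 1 - i))"
    using same by simp
  moreover have "1 < CARD('p)" by (rule nontriv)
  moreover have "1 < real CARD('p) ^ N" using \<open>1 < CARD('p)\<close> \<open>i < N\<close> by (intro one_less_power) auto
  moreover have "real (CARD('p) ^ N - 1) = real CARD('p) ^ N - 1" using \<open>1 < CARD('p)\<close> by simp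
  ultimately show ?thesis
    unfolding card_nonzero_columns by (simp add: of_nat_diff nonzero_eq_divide_eq mult.commute)
qed

section \<open>The chain of singular numbers\<close>

primrec integral_product :: "nat \<Rightarrow> (nat + nat \<Rightarrow> 'p::prime_card padic_int mat) \<Rightarrow> nat \<Rightarrow> 'p padic_int mat"
where
  "integral_product N x 0 = 1\<^sub>m N"
| "integral_product N x (Suc n) =
     x (Inl (Suc n)) * step_diag N 0 * x (Inr (Suc n)) * integral_product N x n"

definition index_upto :: "nat \<Rightarrow> (nat + nat) set" where
  "index_upto n = {1..n} <+> {1..n}"

lemma index_upto_0 [simp]: "index_upto 0 = {}"
  by (simp add: index_upto_def)

lemma index_upto_Suc [simp]: "Inl (Suc n) \<in> index_upto (Suc n)" "Inr (Suc n) \<in> index_upto (Suc n)"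
  by (auto simp: index_upto_def)

lemma index_upto_mono: "m \<le> n \<Longrightarrow> k \<in> index_upto m \<Longrightarrow> k \<in> index_upto n"
  by (auto simp: index_upto_def)

lemma index_upto_SucI: "k \<in> index_upto n \<Longrightarrow> k \<in> index_upto (Suc n)"
  by (rule index_upto_mono) simp_all

lemma Pi_index_upto_SucD: "x \<in> index_upto (Suc n) \<rightarrow> G \<Longrightarrow> x \<in> index_upto n \<rightarrow> G"
  by (auto intro: index_upto_SucI)

lemma index_upto_subset: "index_upto n \<subseteq> matrix_index"
  by (auto simp: index_upto_def)

lemma integral_product_carrier:
  assumes "x \<in> index_upto n \<rightarrow> GL_Zp N"
  shows "integral_product N x n \<in> carrier_mat N N"
  using assms
proof (induction n)
  case (Suc n)
  have "x (Inl (Suc n)) \<in> carrier_mat N N" "x (Inr (Suc n)) \<in> carrier_mat N N"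
    using Pi_mem[OF Suc.prems] by (simp_all add: GL_Zp_carrier)
  moreover have "integral_product N x n \<in> carrier_mat N N"
    by (rule Suc.IH) (rule Pi_index_upto_SucD[OF Suc.prems])
  ultimately show ?case
    by (simp add: mult_carrier_mat[of _ N N _ N])
qed simp

lemma to_Qp_integral_product:
  fixes x :: "nat + nat \<Rightarrow> 'p::prime_card padic_int mat"
  assumes "x \<in> index_upto n \<rightarrow> GL_Zp N"
  shows "to_Qp (integral_product N x n) = matrix_product N (\<lambda>i. x (Inl i)) (\<lambda>i. x (Inr i)) n"
  using assms
proof (induction n)
  case 0
  show ?case by (simp add: to_Qp_one)
next
  case (Suc n)
  have c: "x (Inl (Suc n)) \<in> carrier_mat N N" "x (Inr (Suc n)) \<in> carrier_mat N N"
    using Pi_mem[OF Suc.prems] by (simp_all add: GL_Zp_carrier)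
  have i: "integral_product N x n \<in> carrier_mat N N"
    by (rule integral_product_carrier) (rule Pi_index_upto_SucD[OF Suc.prems])
  have IH: "to_Qp (integral_product N x n) = matrix_product N (\<lambda>i. x (Inl i)) (\<lambda>i. x (Inr i)) n"
    by (rule Suc.IH) (rule Pi_index_upto_SucD[OF Suc.prems])
  have "to_Qp (step_diag N 0 :: 'p padic_int mat) = mat_diag N (\<lambda>i. if i = 0 then of_nat CARD('p) else 1)"
    by (rule eq_matI) (simp_all add: to_Qp_def mat_diag_def of_nat_card_padic)
  then show ?case
    by (simp add: to_Qp_mult[of _ N] c i mult_carrier_mat[of _ N N _ N] IH)
qed

lemma integral_product_cong:
  "(\<And>k. k \<in> index_upto n \<Longrightarrow> x k = y k) \<Longrightarrow> integral_product N x n = integral_product N y n"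
proof (induction n)
  case (Suc n)
  have "integral_product N x n = integral_product N y n"
    by (rule Suc.IH) (simp add: Suc.prems index_upto_SucI)
  moreover have "x (Inl (Suc n)) = y (Inl (Suc n))" "x (Inr (Suc n)) = y (Inr (Suc n))"
    using Suc.prems by auto
  ultimately show ?case by simp
qed simp

text \<open>
  An arbitrary choice, but one that depends on \<open>A\<close> only modulo \<open>p ^ (n + 1)\<close>: the left factor of a
  random product is therefore a discrete random variable.
\<close>

definition left_factor :: "nat \<Rightarrow> nat \<Rightarrow> 'p::prime_card padic_int mat \<Rightarrow> 'p padic_int mat" where
  "left_factor N n A = (SOME K. left_transform N n A K)"

text \<open>
  The clock that rings when the product of \<open>n\<close> factors is multiplied by the factor \<open>n + 1\<close>.
\<close>

definition mark :: "nat \<Rightarrow> (nat + nat \<Rightarrow> 'p::prime_card padic_int mat) \<Rightarrow> nat \<Rightarrow> nat" where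
  "mark N x n = (THE i. i < N \<and>
     leads N (residue_mat (x (Inr (Suc n)) * left_factor N n (integral_product N x n))) (unit_column N) i)"

primrec chain :: "nat \<Rightarrow> (nat \<Rightarrow> nat) \<Rightarrow> nat \<Rightarrow> int list" where
  "chain N m 0 = replicate N 0"
| "chain N m (Suc n) = ring_clock (m n) (chain N m n)"

lemma mark_cong:
  assumes "\<And>k. k \<in> index_upto (Suc n) \<Longrightarrow> x k = y k"
  shows "mark N x n = mark N y n"
proof -
  have "integral_product N x n = integral_product N y n"
    by (rule integral_product_cong) (simp add: assms index_upto_SucI)
  moreover have "x (Inr (Suc n)) = y (Inr (Suc n))" using assms by auto
  ultimately show ?thesis by (simp add: mark_def)
qed

lemma power_diag_to_Qp:
  assumes "\<And>r. r < N \<Longrightarrow> 0 \<le> \<kappa> ! r"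
  shows "to_Qp (power_diag N \<kappa> :: 'p::prime_card padic_int mat) = padic_diag N \<kappa>"
proof (rule eq_matI)
  fix r s assume "r < dim_row (padic_diag N \<kappa> :: 'p padic mat)" "s < dim_col (padic_diag N \<kappa> :: 'p padic mat)"
  then have "r < N" "s < N" by (simp_all add: mat_diag_def)
  then show "to_Qp (power_diag N \<kappa> :: 'p padic_int mat) $$ (r, s) = padic_diag N \<kappa> $$ (r, s)"
    using assms[of s]
    by (simp add: to_Qp_def power_diag_def mat_diag_def power_int_def of_nat_card_padic to_fract_hom.hom_power)
qed (simp_all add: to_Qp_def power_diag_def mat_diag_def)

lemma SN_power_diag:
  fixes K L :: "'p::prime_card padic_int mat"
  assumes "\<kappa> \<in> Sig N" "\<And>r. r < N \<Longrightarrow> 0 \<le> \<kappa> ! r" "K \<in> GL_Zp N" "L \<in> GL_Zp N"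
  shows "SN N (to_Qp (K * power_diag N \<kappa> * L)) = \<kappa>"
  using assms
  by (intro SN_eqI[of _ _ K L])
    (simp_all add: to_Qp_mult[of _ N] GL_Zp_carrier mult_carrier_mat[of _ N N _ N] power_diag_to_Qp)

lemma unit_column_neq_0: "0 < N \<Longrightarrow> (unit_column N :: 'a::zero_neq_one mat) \<noteq> 0\<^sub>m N 1"
  by (auto simp: unit_column_def mat_eq_iff)

lemma mark_leads:
  fixes x :: "nat + nat \<Rightarrow> 'p::prime_card padic_int mat"
  assumes "0 < N" "x (Inr (Suc n)) \<in> GL_Zp N" "left_factor N n (integral_product N x n) \<in> GL_Zp N"
  shows "mark N x n < N" "leads N
    (residue_mat (x (Inr (Suc n)) * left_factor N n (integral_product N x n))) (unit_column N) i
      \<and> i < N \<longleftrightarrow> mark N x n = i"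
proof -
  let ?B = "residue_mat (x (Inr (Suc n)) * left_factor N n (integral_product N x n))"
  have unique: "\<exists>!i. i < N \<and> leads N ?B (unit_column N) i"
    by (rule leads_unique[OF mult_GL_Zp[OF assms(2,3)] _ unit_column_neq_0[OF assms(1)]])
      (simp add: unit_column_def)
  then have "mark N x n < N \<and> leads N ?B (unit_column N) (mark N x n)"
    unfolding mark_def by (rule theI')
  then show "mark N x n < N" "leads N ?B (unit_column N) i \<and> i < N \<longleftrightarrow> mark N x n = i"
    using unique by blast+
qed

text \<open>
  By induction on \<open>n\<close>, using \<open>smith_step\<close>. The chosen left factor need not be the one provided by
  the induction hypothesis, but it comes with the same exponents, since singular numbers are unique.
  The exponents are at most \<open>n\<close> because each step increases a single one by \<open>1\<close>.
\<close>

lemma integral_product_decomposition: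
  fixes x :: "nat + nat \<Rightarrow> 'p::prime_card padic_int mat"
  assumes "0 < N" and "x \<in> index_upto n \<rightarrow> GL_Zp N"
  shows "chain N (mark N x) n \<in> Sig N \<and>
    (\<forall>r<N. 0 \<le> chain N (mark N x) n ! r \<and> chain N (mark N x) n ! r \<le> int n) \<and>
    (\<exists>K\<in>GL_Zp N. \<exists>L\<in>GL_Zp N. integral_product N x n = K * power_diag N (chain N (mark N x) n) * L)"
  using assms(2)
proof (induction n)
  case 0
  have "power_diag N (replicate N 0) = (1\<^sub>m N :: 'p padic_int mat)"
    by (rule eq_matI) (simp_all add: power_diag_def mat_diag_def)
  then have "integral_product N x 0 = 1\<^sub>m N * power_diag N (chain N (mark N x) 0) * 1\<^sub>m N"
    by simp
  moreover have "replicate N 0 \<in> Sig N" by (simp add: Sig_def sorted_wrt_iff_nth_less)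
  ultimately show ?case using one_GL_Zp by fastforce
next
  case (Suc n)
  let ?A = "integral_product N x n" and ?\<kappa> = "chain N (mark N x) n"
  have U: "x (Inl (Suc n)) \<in> GL_Zp N" and V: "x (Inr (Suc n)) \<in> GL_Zp N"
    using Pi_mem[OF Suc.prems] by simp_all
  have IH: "?\<kappa> \<in> Sig N" "\<And>r. r < N \<Longrightarrow> 0 \<le> ?\<kappa> ! r \<and> ?\<kappa> ! r \<le> int n"
    "\<exists>K\<in>GL_Zp N. \<exists>L\<in>GL_Zp N. ?A = K * power_diag N ?\<kappa> * L"
    using Suc.IH[OF Pi_index_upto_SucD[OF Suc.prems]] by auto
  then have "\<exists>K. left_transform N n ?A K" unfolding left_transform_def by blast
  then have "left_transform N n ?A (left_factor N n ?A)"
    unfolding left_factor_def by (rule someI_ex)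
  then obtain \<kappa> L where K: "left_factor N n ?A \<in> GL_Zp N" and L: "L \<in> GL_Zp N"
    and \<kappa>: "\<kappa> \<in> Sig N" "\<And>r. r < N \<Longrightarrow> 0 \<le> \<kappa> ! r"
    and A: "?A = left_factor N n ?A * power_diag N \<kappa> * L"
    unfolding left_transform_def by blast
  have "SN N (to_Qp ?A) = \<kappa>"
    by (subst A) (rule SN_power_diag[OF \<kappa> K L])
  moreover have "SN N (to_Qp ?A) = ?\<kappa>"
    using IH SN_power_diag[of ?\<kappa> N] by auto
  ultimately have \<kappa>_eq: "\<kappa> = ?\<kappa>" by simp
  let ?i = "mark N x n"
  have i: "?i < N" by (rule mark_leads(1)[OF \<open>0 < N\<close> V K])
  have "leads N (residue_mat (x (Inr (Suc n)) * left_factor N n ?A)) (unit_column N) ?i"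
    using mark_leads(2)[OF \<open>0 < N\<close> V K, of ?i] by simp
  then obtain w where w: "w \<in> carrier_mat N 1"
    "residue_mat (x (Inr (Suc n)) * left_factor N n ?A) * w = unit_column N"
    "\<And>r. r < ?i \<Longrightarrow> w $$ (r, 0) = 0" "w $$ (?i, 0) \<noteq> 0"
    unfolding leads_def by blast
  have "\<exists>K'\<in>GL_Zp N. \<exists>L'\<in>GL_Zp N.
      x (Inl (Suc n)) * step_diag N 0 * x (Inr (Suc n)) * (left_factor N n ?A * power_diag N \<kappa> * L)
        = K' * power_diag N (ring_clock ?i \<kappa>) * L'"
    by (rule smith_step[OF U V K L \<kappa> i w])
  then have "\<exists>K'\<in>GL_Zp N. \<exists>L'\<in>GL_Zp N.
      integral_product N x (Suc n) = K' * power_diag N (chain N (mark N x) (Suc n)) * L'"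
    by (simp add: A[unfolded \<kappa>_eq, symmetric] \<kappa>_eq)
  moreover obtain j where j: "ring_clock ?i ?\<kappa> = bump j ?\<kappa>" "bump j ?\<kappa> \<in> Sig N"
    using ring_clock_cases[OF IH(1) i] by blast
  moreover have "0 \<le> bump j ?\<kappa> ! r \<and> bump j ?\<kappa> ! r \<le> int (Suc n)" if "r < N" for r
    using IH(2)[OF that] IH(1) that by (cases "r = j") (auto simp: bump_def Sig_def)
  ultimately show ?case by simp
qed

lemma SN_matrix_product:
  fixes x :: "nat + nat \<Rightarrow> 'p::prime_card padic_int mat"
  assumes "0 < N" and x: "x \<in> index_upto n \<rightarrow> GL_Zp N"
  shows "SN N (matrix_product N (\<lambda>i. x (Inl i)) (\<lambda>i. x (Inr i)) n) = chain N (mark N x) n"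
proof -
  obtain K L where "K \<in> GL_Zp N" "L \<in> GL_Zp N"
    "integral_product N x n = K * power_diag N (chain N (mark N x) n) * L"
    using integral_product_decomposition[OF assms] by blast
  then have "SN N (to_Qp (integral_product N x n)) = chain N (mark N x) n"
    using integral_product_decomposition[OF assms] SN_power_diag[of "chain N (mark N x) n" N K L] by auto
  then show ?thesis by (simp add: to_Qp_integral_product[OF x])
qed

lemma left_factor_GL_Zp:
  fixes x :: "nat + nat \<Rightarrow> 'p::prime_card padic_int mat"
  assumes "0 < N" and x: "x \<in> index_upto n \<rightarrow> GL_Zp N"
  shows "left_factor N n (integral_product N x n) \<in> GL_Zp N"
proof -
  have "\<exists>K. left_transform N n (integral_product N x n) K"
    using integral_product_decomposition[OF assms] unfolding left_transform_def by blast
  then have "left_transform N n (integral_product N x n) (left_factor N n (integral_product N x n))"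
    unfolding left_factor_def by (rule someI_ex)
  then show ?thesis by (simp add: left_transform_def)
qed

section \<open>The marks as random variables\<close>

lemma joint_event_sets:
  assumes "finite T" and F: "\<And>\<tau>. \<tau> \<in> T \<Longrightarrow> (\<lambda>\<omega>. F \<tau> \<omega>) \<in> M \<rightarrow>\<^sub>M count_space UNIV"
  shows "{\<omega> \<in> space M. \<forall>\<tau>\<in>T. F \<tau> \<omega> = \<kappa> \<tau>} \<in> sets M"
proof (rule sets.sets_Collect_finite_All[OF _ \<open>finite T\<close>])
  show "{\<omega> \<in> space M. F \<tau> \<omega> = \<kappa> \<tau>} \<in> sets M" if "\<tau> \<in> T" for \<tau>
    using measurable_sets[OF F[OF that], of "{\<kappa> \<tau>}"] by (simp add: vimage_def Int_def conj_commute)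
qed

lemma left_factor_cong:
  fixes A B :: "'p::prime_card padic_int mat"
  assumes A: "A \<in> carrier_mat N N" and B: "B \<in> carrier_mat N N"
    and eq: "reduce (Suc n) A = reduce (Suc n) B"
  shows "left_factor N n A = left_factor N n B"
proof -
  have "left_transform N n A K \<longleftrightarrow> left_transform N n B K" for K
    using left_transform_cong[of N n A K B] left_transform_cong[of N n B K A] A B eq eq[symmetric]
    unfolding reduce_eq_iff[OF A B] reduce_eq_iff[OF B A] by blast
  then show ?thesis by (simp add: left_factor_def)
qed

lemma Rep_padic_int_sum:
  fixes f :: "'a \<Rightarrow> 'p::prime_card padic_int"
  assumes "finite I"
  shows "Rep_padic_int (\<Sum>i\<in>I. f i) k = (\<Sum>i\<in>I. Rep_padic_int (f i) k) mod int CARD('p) ^ k"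
  using assms
  by (induction I rule: finite_induct)
    (simp_all add: zero_padic_int.rep_eq plus_padic_int.rep_eq mod_simps)

lemma reduce_mult:
  fixes A B :: "'p::prime_card padic_int mat"
  assumes "A \<in> carrier_mat N N" "B \<in> carrier_mat N N"
  shows "reduce k (A * B) = map_mat (\<lambda>z. z mod int CARD('p) ^ k) (reduce k A * reduce k B)"
proof (rule eq_matI)
  fix i j assume "i < dim_row (map_mat (\<lambda>z. z mod int CARD('p) ^ k) (reduce k A * reduce k B))"
    "j < dim_col (map_mat (\<lambda>z. z mod int CARD('p) ^ k) (reduce k A * reduce k B))"
  then have ij: "i < N" "j < N" using assms by (simp_all add: reduce_def)
  have "reduce k (A * B) $$ (i, j) = Rep_padic_int (\<Sum>l<N. A $$ (i, l) * B $$ (l, j)) k"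
    using assms ij by (simp add: reduce_def scalar_prod_def lessThan_atLeast0)
  also have "\<dots> = (\<Sum>l<N. Rep_padic_int (A $$ (i, l)) k * Rep_padic_int (B $$ (l, j)) k) mod int CARD('p) ^ k"
    by (simp add: Rep_padic_int_sum times_padic_int.rep_eq mod_sum_eq)
  also have "\<dots> = map_mat (\<lambda>z. z mod int CARD('p) ^ k) (reduce k A * reduce k B) $$ (i, j)"
    using assms ij by (simp add: reduce_def scalar_prod_def lessThan_atLeast0)
  finally show "reduce k (A * B) $$ (i, j)
    = map_mat (\<lambda>z. z mod int CARD('p) ^ k) (reduce k A * reduce k B) $$ (i, j)" .
qed (use assms in \<open>simp_all add: reduce_def\<close>)

text \<open>
  As only finitely many residue classes occur, functions of several residue classes are measurable.
\<close>

lemma finite_reduce: "finite (reduce k ` (carrier_mat N N :: 'p::prime_card padic_int mat set))"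
proof -
  let ?F = "PiE ({..<N} \<times> {..<N}) (\<lambda>_. {0..<int CARD('p) ^ k})"
  have "reduce k ` (carrier_mat N N :: 'p padic_int mat set) \<subseteq> (\<lambda>f. mat N N f) ` ?F"
  proof
    fix a assume "a \<in> reduce k ` (carrier_mat N N :: 'p padic_int mat set)"
    then obtain A :: "'p padic_int mat" where A: "A \<in> carrier_mat N N" "a = reduce k A" by blast
    show "a \<in> (\<lambda>f. mat N N f) ` ?F"
    proof (rule image_eqI)
      show "a = mat N N (\<lambda>ij\<in>{..<N} \<times> {..<N}. Rep_padic_int (A $$ ij) k)"
        using A by (intro eq_matI) (auto simp: reduce_def)
      show "(\<lambda>ij\<in>{..<N} \<times> {..<N}. Rep_padic_int (A $$ ij) k) \<in> ?F"
        using Rep_padic_int_range by (intro restrict_PiE_iff[THEN iffD2] ballI)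
    qed
  qed
  then show ?thesis by (rule finite_subset) (intro finite_imageI finite_PiE; simp)
qed

lemma reduce_mult_measurable:
  fixes f g :: "'a \<Rightarrow> 'p::prime_card padic_int mat"
  assumes f: "(\<lambda>x. reduce k (f x)) \<in> M \<rightarrow>\<^sub>M count_space UNIV"
    and g: "(\<lambda>x. reduce k (g x)) \<in> M \<rightarrow>\<^sub>M count_space UNIV"
    and carrier: "\<And>x. x \<in> space M \<Longrightarrow> f x \<in> carrier_mat N N" "\<And>x. x \<in> space M \<Longrightarrow> g x \<in> carrier_mat N N"
  shows "(\<lambda>x. reduce k (f x * g x)) \<in> M \<rightarrow>\<^sub>M count_space UNIV"
proof -
  let ?h = "\<lambda>a b. map_mat (\<lambda>z. z mod int CARD('p) ^ k) (a * b)"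
  let ?R = "reduce k ` (carrier_mat N N :: 'p padic_int mat set)"
  have f': "(\<lambda>x. reduce k (f x)) \<in> M \<rightarrow>\<^sub>M count_space ?R"
    by (rule measurable_count_space_extend[OF subset_UNIV _ f]) (intro Pi_I imageI carrier(1))
  have "(\<lambda>x. ?h (reduce k (f x)) (reduce k (g x))) \<in> M \<rightarrow>\<^sub>M count_space UNIV"
  proof (rule measurable_compose_countable'[OF _ f' countable_finite[OF finite_reduce]])
    show "(\<lambda>x. ?h a (reduce k (g x))) \<in> M \<rightarrow>\<^sub>M count_space UNIV" for a
      by (rule measurable_compose[OF g]) simp
  qed
  then show ?thesis
    by (rule measurable_cong[THEN iffD1, rotated]) (simp add: reduce_mult[OF carrier])
qed

abbreviation matrix_space :: "nat \<Rightarrow> (nat + nat) set \<Rightarrow> (nat + nat \<Rightarrow> 'p::prime_card padic_int mat) measure"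
  where "matrix_space N I \<equiv> PiM I (\<lambda>_. GL_Zp_borel N)"

lemma matrix_space_GL_Zp: "x \<in> space (matrix_space N I) \<Longrightarrow> k \<in> I \<Longrightarrow> x k \<in> GL_Zp N"
  by (auto simp: space_PiM)

lemma reduce_component_measurable:
  assumes "k \<in> I"
  shows "(\<lambda>x. reduce m (x k)) \<in> matrix_space N I \<rightarrow>\<^sub>M count_space UNIV"
proof -
  have "(\<lambda>x. x k) \<in> matrix_space N I \<rightarrow>\<^sub>M GL_Zp_borel N"
    by (rule measurable_component_singleton[OF assms])
  then show ?thesis by (rule measurable_compose[OF _ reduce_measurable])
qed

lemma reduce_integral_product_measurable:
  assumes "index_upto n \<subseteq> I"
  shows "(\<lambda>x :: _ \<Rightarrow> 'p::prime_card padic_int mat. reduce k (integral_product N x n))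
    \<in> matrix_space N I \<rightarrow>\<^sub>M count_space UNIV"
  using assms
proof (induction n)
  case (Suc n)
  have I: "Inl (Suc n) \<in> I" "Inr (Suc n) \<in> I" "index_upto n \<subseteq> I"
    using Suc.prems index_upto_Suc[of n] index_upto_SucI[of _ n] by blast+
  have c: "x (Inl (Suc n)) \<in> carrier_mat N N" "x (Inr (Suc n)) \<in> carrier_mat N N"
      "integral_product N x n \<in> carrier_mat N N"
    if "x \<in> space (matrix_space N I)" for x :: "_ \<Rightarrow> 'p padic_int mat"
    using I that by (auto intro!: GL_Zp_carrier integral_product_carrier intro: matrix_space_GL_Zp)
  show ?case
    unfolding integral_product.simps
    by (intro reduce_mult_measurable[where N = N] reduce_component_measurable Suc.IH I)
      (simp_all add: c mult_carrier_mat[of _ N N _ N])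
qed simp

text \<open>
  \<open>left_factor\<close> as a function of the residue class of its argument.
\<close>

definition class_factor :: "nat \<Rightarrow> nat \<Rightarrow> int mat \<Rightarrow> 'p::prime_card padic_int mat" where
  "class_factor N n a = left_factor N n (SOME A. A \<in> carrier_mat N N \<and> reduce (Suc n) A = a)"

lemma class_factor_reduce:
  fixes A :: "'p::prime_card padic_int mat"
  assumes "A \<in> carrier_mat N N"
  shows "class_factor N n (reduce (Suc n) A) = left_factor N n A"
proof -
  let ?B = "SOME B :: 'p padic_int mat. B \<in> carrier_mat N N \<and> reduce (Suc n) B = reduce (Suc n) A"
  have "\<exists>B :: 'p padic_int mat. B \<in> carrier_mat N N \<and> reduce (Suc n) B = reduce (Suc n) A"
    by (intro exI[of _ A] conjI assms refl)
  then have B: "?B \<in> carrier_mat N N \<and> reduce (Suc n) ?B = reduce (Suc n) A"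
    by (rule someI_ex)
  show ?thesis
    unfolding class_factor_def by (rule left_factor_cong[OF conjunct1[OF B] assms conjunct2[OF B]])
qed

text \<open>
  The mark is a function of the new matrix modulo \<open>p\<close> and the previous product modulo
  \<open>p ^ (n + 1)\<close>.
\<close>

lemma mark_measurable:
  assumes "0 < N" and I: "index_upto (Suc n) \<subseteq> I"
  shows "(\<lambda>x :: _ \<Rightarrow> 'p::prime_card padic_int mat. mark N x n) \<in> matrix_space N I \<rightarrow>\<^sub>M count_space UNIV"
proof -
  let ?R = "reduce (Suc n) ` (carrier_mat N N :: 'p padic_int mat set)"
  let ?h = "\<lambda>a v. THE i. i < N \<and>
    leads N (map_mat of_int v * residue_mat (class_factor N n a :: 'p padic_int mat)) (unit_column N) i"
  let ?X = "\<lambda>x :: _ \<Rightarrow> 'p padic_int mat. reduce (Suc n) (integral_product N x n)"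
  have I': "index_upto n \<subseteq> I" "Inr (Suc n) \<in> I"
    using I index_upto_Suc[of n] index_upto_SucI[of _ n] by blast+
  have GL: "x \<in> index_upto n \<rightarrow> GL_Zp N" if "x \<in> space (matrix_space N I)"
    for x :: "_ \<Rightarrow> 'p padic_int mat"
    using that I' by (auto intro: matrix_space_GL_Zp)
  have X: "?X \<in> matrix_space N I \<rightarrow>\<^sub>M count_space ?R"
    by (rule measurable_count_space_extend[OF subset_UNIV _ reduce_integral_product_measurable[OF I'(1)]])
      (intro Pi_I imageI integral_product_carrier GL)
  have "(\<lambda>x. ?h (?X x) (reduce 1 (x (Inr (Suc n))))) \<in> matrix_space N I \<rightarrow>\<^sub>M count_space UNIV"
  proof (rule measurable_compose_countable'[OF _ X countable_finite[OF finite_reduce]])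
    show "(\<lambda>x. ?h a (reduce 1 (x (Inr (Suc n)))))
        \<in> (matrix_space N I :: (_ \<Rightarrow> 'p padic_int mat) measure) \<rightarrow>\<^sub>M count_space UNIV" for a
      by (rule measurable_compose[OF reduce_component_measurable[OF I'(2)]]) simp
  qed
  moreover have "?h (?X x) (reduce 1 (x (Inr (Suc n)))) = mark N x n"
    if x: "x \<in> space (matrix_space N I)" for x :: "_ \<Rightarrow> 'p padic_int mat"
  proof -
    let ?K = "left_factor N n (integral_product N x n)"
    have V: "x (Inr (Suc n)) \<in> carrier_mat N N"
      using matrix_space_GL_Zp[OF x I'(2)] by (rule GL_Zp_carrier)
    have K: "?K \<in> carrier_mat N N"
      using left_factor_GL_Zp[OF \<open>0 < N\<close> GL[OF x]] by (rule GL_Zp_carrier)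
    have "residue_mat (x (Inr (Suc n)) * ?K)
        = map_mat of_int (reduce 1 (x (Inr (Suc n)))) * residue_mat (class_factor N n (?X x) :: 'p padic_int mat)"
      unfolding class_factor_reduce[OF integral_product_carrier[OF GL[OF x]]]
        residue_mat_reduce[of "x (Inr (Suc n))", symmetric]
      by (rule residue_hom.mat_hom_mult[OF V K])
    then show ?thesis unfolding mark_def by (simp only:)
  qed
  ultimately show ?thesis
    by (rule measurable_cong[THEN iffD1, rotated])
qed

section \<open>The marks are independent and identically distributed\<close>

text \<open>
  The probability in \<open>haar_leads\<close>. By \<open>lead_weight_eq\<close> below, it is proportional to \<open>t ^ (i + 1)\<close>,
  the rate of clock \<open>i\<close>.
\<close>

definition lead_weight :: "nat \<Rightarrow> nat \<Rightarrow> nat \<Rightarrow> real" where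
  "lead_weight p N i = (real p - 1) * real p ^ (N - 1 - i) / (real p ^ N - 1)"

text \<open>
  Condition on the residue class \<open>a\<close> of the product of the first \<open>n\<close> factors modulo \<open>p ^ (n + 1)\<close>.
  Then the left factor is a constant matrix, and the next \<open>V\<close> is independent of the past, so by
  \<open>haar_leads\<close> the next mark has the same law for every \<open>a\<close>.
\<close>

lemma (in prob_space) marks_iid:
  fixes x :: "nat + nat \<Rightarrow> 'a \<Rightarrow> 'p::prime_card padic_int mat"
  assumes "0 < N"
    and indep: "indep_vars (\<lambda>_. GL_Zp_borel N) x matrix_index"
    and haar: "\<And>i. i \<ge> 1 \<Longrightarrow> haar_prob_measure N (distr M (GL_Zp_borel N) (x (Inr i)))"
    and f: "\<And>j. j < n \<Longrightarrow> f j < N"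
  shows "prob {\<omega> \<in> space M. \<forall>j<n. mark N (\<lambda>k. x k \<omega>) j = f j} = (\<Prod>j<n. lead_weight CARD('p) N (f j))"
  using f
proof (induction n)
  case 0
  then show ?case by (simp add: prob_space)
next
  case (Suc n)
  let ?A = "index_upto n" and ?B = "{Inr (Suc n)} :: (nat + nat) set"
  let ?R = "reduce (Suc n) ` (carrier_mat N N :: 'p padic_int mat set)"
  let ?X = "\<lambda>x :: _ \<Rightarrow> 'p padic_int mat. reduce (Suc n) (integral_product N x n)"
  let ?x = "\<lambda>\<omega> k. x k \<omega>"
  \<comment> \<open>\<open>E a\<close> belongs to the past, and \<open>E' a\<close> is the same event on the space of the past matrices.
    On \<open>E a\<close>, the event \<open>D\<close> says that the new matrix lies in \<open>S a\<close>.\<close>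
  define E where "E a = {\<omega> \<in> space M. (\<forall>j<n. mark N (?x \<omega>) j = f j) \<and> ?X (?x \<omega>) = a}" for a
  define E' where "E' a = {y \<in> space (matrix_space N ?A). (\<forall>j<n. mark N y j = f j) \<and> ?X y = a}" for a
  define S where "S a = {V \<in> GL_Zp N.
    leads N (residue_mat (V * (class_factor N n a :: 'p padic_int mat))) (unit_column N) (f n)}" for a
  define D where "D = {\<omega> \<in> space M. mark N (?x \<omega>) n = f n}"
  have rv: "x k \<in> M \<rightarrow>\<^sub>M GL_Zp_borel N" if "k \<in> matrix_index" for k
    using indep that by (auto simp: indep_vars_def2)
  have GL: "x k \<omega> \<in> GL_Zp N" if "\<omega> \<in> space M" "k \<in> matrix_index" for k \<omega>
    using measurable_space[OF rv[OF that(2)] that(1)] by simp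
  have restrict: "(\<lambda>\<omega>. \<lambda>k\<in>J. x k \<omega>) \<in> M \<rightarrow>\<^sub>M matrix_space N J" if "J \<subseteq> matrix_index" for J
    using rv that by (intro measurable_restrict) auto
  have A: "?A \<subseteq> matrix_index" and B: "?B \<subseteq> matrix_index" using index_upto_subset by auto
  have E'_sets: "E' a \<in> sets (matrix_space N ?A)" for a
  proof -
    have "{y \<in> space (matrix_space N ?A). \<forall>j\<in>{..<n}. mark N y j = f j}
        \<in> sets (matrix_space N ?A :: (_ \<Rightarrow> 'p padic_int mat) measure)"
    proof (rule joint_event_sets)
      fix j assume "j \<in> {..<n}"
      then have "index_upto (Suc j) \<subseteq> ?A" using index_upto_mono[of "Suc j" n] by auto
      then show "(\<lambda>y :: _ \<Rightarrow> 'p padic_int mat. mark N y j) \<in> matrix_space N ?A \<rightarrow>\<^sub>M count_space UNIV"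
        by (rule mark_measurable[OF \<open>0 < N\<close>])
    qed simp
    moreover have "{y \<in> space (matrix_space N ?A). ?X y = a} \<in> sets (matrix_space N ?A)"
      using measurable_sets[OF reduce_integral_product_measurable[OF order.refl, of "Suc n" N], of "{a}"]
      by (simp add: vimage_def Int_def conj_commute)
    moreover have "E' a = {y \<in> space (matrix_space N ?A). \<forall>j\<in>{..<n}. mark N y j = f j}
        \<inter> {y \<in> space (matrix_space N ?A). ?X y = a}"
      unfolding E'_def by auto
    ultimately show ?thesis by (simp only: sets.Int)
  qed
  have restrict_eq: "mark N (\<lambda>k\<in>?A. x k \<omega>) j = mark N (?x \<omega>) j" if "j < n" for j \<omega>
    using index_upto_mono[of "Suc j" n] that by (intro mark_cong) simp
  have restrict_X: "?X (\<lambda>k\<in>?A. x k \<omega>) = ?X (?x \<omega>)" for \<omega>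
    by (intro arg_cong[of _ _ "reduce (Suc n)"] integral_product_cong) simp
  have E_eq: "E a = (\<lambda>\<omega>. \<lambda>k\<in>?A. x k \<omega>) -` E' a \<inter> space M" for a
    using measurable_space[OF restrict[OF A]] restrict_eq restrict_X unfolding E_def E'_def by auto
  then have E_sets: "E a \<in> events" for a
    using measurable_sets[OF restrict[OF A] E'_sets] by simp
  have D_sets: "D \<in> events"
  proof -
    have C: "index_upto (Suc n) \<subseteq> matrix_index" by (rule index_upto_subset)
    have "(\<lambda>\<omega>. mark N (\<lambda>k\<in>index_upto (Suc n). x k \<omega>) n) \<in> M \<rightarrow>\<^sub>M count_space UNIV"
      by (rule measurable_compose[OF restrict[OF C] mark_measurable[OF \<open>0 < N\<close> order.refl]])
    moreover have "mark N (\<lambda>k\<in>index_upto (Suc n). x k \<omega>) n = mark N (?x \<omega>) n" for \<omega>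
      by (rule mark_cong) simp
    ultimately have "(\<lambda>\<omega>. mark N (?x \<omega>) n) \<in> M \<rightarrow>\<^sub>M count_space UNIV" by simp
    from measurable_sets[OF this, of "{f n}"] show ?thesis
      by (simp add: D_def vimage_def Int_def conj_commute)
  qed
  have X_R: "?X (?x \<omega>) \<in> ?R" if "\<omega> \<in> space M" for \<omega>
    using GL[OF that] A by (intro imageI integral_product_carrier) auto
  have step: "prob (E a \<inter> D) = prob (E a) * lead_weight CARD('p) N (f n)" for a
  proof (cases "E a = {}")
    case False
    then obtain \<omega>\<^sub>0 where \<omega>0: "\<omega>\<^sub>0 \<in> space M" "?X (?x \<omega>\<^sub>0) = a" unfolding E_def by blast
    have factor: "class_factor N n a = left_factor N n (integral_product N (?x \<omega>) n)"
      "left_factor N n (integral_product N (?x \<omega>) n) \<in> GL_Zp N"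
      if "\<omega> \<in> space M" "?X (?x \<omega>) = a" for \<omega>
    proof -
      have "?x \<omega> \<in> ?A \<rightarrow> GL_Zp N" using GL[OF \<open>\<omega> \<in> space M\<close>] A by blast
      then show "class_factor N n a = left_factor N n (integral_product N (?x \<omega>) n)"
        "left_factor N n (integral_product N (?x \<omega>) n) \<in> GL_Zp N"
        using class_factor_reduce[OF integral_product_carrier, of "?x \<omega>" n N n]
          left_factor_GL_Zp[OF \<open>0 < N\<close>, of "?x \<omega>" n] that(2) by simp_all
    qed
    have K: "class_factor N n a \<in> (GL_Zp N :: 'p padic_int mat set)"
      using factor[OF \<omega>0] by simp
    have S_sets: "S a \<in> sets (GL_Zp_borel N)"
      unfolding S_def by (rule leads_measurable[OF K])
    have "f n < N" using Suc.prems by simp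
    have "prob (x (Inr (Suc n)) -` S a \<inter> space M)
        = measure (distr M (GL_Zp_borel N) (x (Inr (Suc n)))) (S a)"
      using rv[of "Inr (Suc n)"] S_sets by (subst measure_distr) auto
    also have "\<dots> = lead_weight CARD('p) N (f n)"
      unfolding S_def lead_weight_def by (rule haar_leads[OF haar K \<open>f n < N\<close>]) simp
    finally have S_prob: "prob (x (Inr (Suc n)) -` S a \<inter> space M) = lead_weight CARD('p) N (f n)" .
    have indep_AB: "indep_var (matrix_space N ?A) (\<lambda>\<omega>. \<lambda>k\<in>?A. x k \<omega>) (matrix_space N ?B) (\<lambda>\<omega>. \<lambda>k\<in>?B. x k \<omega>)"
      by (rule indep_var_restrict[OF indep _ A B]) (auto simp: index_upto_def)
    let ?S' = "{y \<in> space (matrix_space N ?B). y (Inr (Suc n)) \<in> S a}"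
    have S'_sets: "?S' \<in> sets (matrix_space N ?B)"
      using measurable_sets[OF measurable_component_singleton[of "Inr (Suc n)" ?B] S_sets]
      by (simp add: vimage_def Int_def conj_commute)
    have S'_eq: "(\<lambda>\<omega>. \<lambda>k\<in>?B. x k \<omega>) -` ?S' \<inter> space M = x (Inr (Suc n)) -` S a \<inter> space M"
      using measurable_space[OF restrict[OF B]] by auto
    have "E a \<inter> D = E a \<inter> (x (Inr (Suc n)) -` S a \<inter> space M)"
    proof -
      have "mark N (?x \<omega>) n = f n \<longleftrightarrow> x (Inr (Suc n)) \<omega> \<in> S a"
        if \<omega>: "\<omega> \<in> space M" "?X (?x \<omega>) = a" for \<omega>
      proof -
        have V: "x (Inr (Suc n)) \<omega> \<in> GL_Zp N" using GL[OF \<omega>(1)] by auto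
        show ?thesis
          using mark_leads(2)[of N "?x \<omega>" n "f n"] V factor[OF \<omega>] \<open>0 < N\<close> \<open>f n < N\<close>
          by (auto simp: S_def)
      qed
      then show ?thesis unfolding E_def D_def by auto
    qed
    also have "\<dots> = (\<lambda>\<omega>. (\<lambda>k\<in>?A. x k \<omega>, \<lambda>k\<in>?B. x k \<omega>)) -` (E' a \<times> ?S') \<inter> space M"
      unfolding S'_eq[symmetric] E_eq by auto
    also have "prob \<dots> = prob ((\<lambda>\<omega>. \<lambda>k\<in>?A. x k \<omega>) -` E' a \<inter> space M)
        * prob ((\<lambda>\<omega>. \<lambda>k\<in>?B. x k \<omega>) -` ?S' \<inter> space M)"
      by (rule indep_varD[OF indep_AB E'_sets S'_sets])
    also have "\<dots> = prob (E a) * lead_weight CARD('p) N (f n)"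
      by (simp only: E_eq[symmetric] S'_eq S_prob)
    finally show ?thesis .
  qed simp
  define R where "R = ?R"
  have fin: "finite R" unfolding R_def by (rule finite_reduce)
  have X_R': "?X (?x \<omega>) \<in> R" if "\<omega> \<in> space M" for \<omega>
    unfolding R_def by (rule X_R[OF that])
  have disj: "disjoint_family_on E R" by (auto simp: disjoint_family_on_def E_def)
  have "{\<omega> \<in> space M. \<forall>j<Suc n. mark N (?x \<omega>) j = f j} = (\<Union>a\<in>R. E a \<inter> D)"
    using X_R' by (auto simp: E_def D_def less_Suc_eq)
  also have "prob \<dots> = (\<Sum>a\<in>R. prob (E a \<inter> D))"
  proof (rule finite_measure_finite_Union[OF fin])
    show "(\<lambda>a. E a \<inter> D) ` R \<subseteq> events" using E_sets D_sets by blast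
    show "disjoint_family_on (\<lambda>a. E a \<inter> D) R" using disj unfolding disjoint_family_on_def by blast
  qed
  also have "\<dots> = (\<Sum>a\<in>R. prob (E a)) * lead_weight CARD('p) N (f n)"
    by (simp add: step sum_distrib_right)
  also have "(\<Sum>a\<in>R. prob (E a)) = prob (\<Union>a\<in>R. E a)"
    using E_sets by (intro finite_measure_finite_Union[symmetric] fin disj) blast
  also have "(\<Union>a\<in>R. E a) = {\<omega> \<in> space M. \<forall>j<n. mark N (?x \<omega>) j = f j}"
    using X_R' by (auto simp: E_def)
  also have "prob \<dots> = (\<Prod>j<n. lead_weight CARD('p) N (f j))"
    using Suc by simp
  finally show ?case by simp
qed

section \<open>Counting rings in the cells of a partition\<close>

lemma poisson_cells:
  assumes P: "poisson_process M r P" and "0 < r" and s: "strict_mono s" "0 \<le> s 0"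
  shows "measure M {\<omega> \<in> space M. \<forall>c<n. P (s (Suc c)) \<omega> - P (s c) \<omega> = x c}
    = (\<Prod>c<n. pmf (poisson_pmf (r * (s (Suc c) - s c))) (x c))"
proof (cases "n = 0")
  case True
  interpret prob_space M using P by (simp add: poisson_process_def)
  show ?thesis using True by (simp add: prob_space)
next
  case False
  interpret prob_space M using P by (simp add: poisson_process_def)
  let ?D = "\<lambda>c \<omega>. P (s (Suc c)) \<omega> - P (s c) \<omega>"
  have law: "distr M (count_space UNIV) (\<lambda>\<omega>. P \<tau> \<omega> - P \<sigma> \<omega>) = measure_pmf (poisson_pmf (r * (\<tau> - \<sigma>)))"
    if "0 \<le> \<sigma>" "\<sigma> < \<tau>" for \<sigma> \<tau>
    using P that by (simp add: poisson_process_def)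
  have "0 \<le> s 0 \<and> mono s" using s by (simp add: strict_mono_mono)
  then have indep: "indep_vars (\<lambda>_. count_space UNIV) ?D {..<n}"
    using P unfolding poisson_process_def by blast
  have s_cell: "0 \<le> s c" "s c < s (Suc c)" for c
    using s strict_mono_less_eq[OF s(1), of 0 c] strict_mono_less[OF s(1), of c "Suc c"] by auto
  have "{\<omega> \<in> space M. \<forall>c<n. ?D c \<omega> = x c} = (\<Inter>c\<in>{..<n}. ?D c -` {x c} \<inter> space M)"
    using False by auto
  also have "prob \<dots> = (\<Prod>c<n. prob (?D c -` {x c} \<inter> space M))"
    by (rule indep_varsD[OF indep]) (use False in auto)
  also have "\<dots> = (\<Prod>c<n. pmf (poisson_pmf (r * (s (Suc c) - s c))) (x c))"
  proof (rule prod.cong[OF refl])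
    fix c assume "c \<in> {..<n}"
    then have "?D c \<in> M \<rightarrow>\<^sub>M count_space UNIV" using indep by (simp add: indep_vars_def2)
    then have "prob (?D c -` {x c} \<inter> space M) = measure (distr M (count_space UNIV) (?D c)) {x c}"
      by (simp add: measure_distr)
    then show "prob (?D c -` {x c} \<inter> space M) = pmf (poisson_pmf (r * (s (Suc c) - s c))) (x c)"
      unfolding law[OF s_cell] by (simp add: measure_pmf_single)
  qed
  finally show ?thesis .
qed

lemma nat_diff_measurable:
  fixes f g :: "'a \<Rightarrow> nat"
  assumes f: "f \<in> M \<rightarrow>\<^sub>M count_space UNIV" and g: "g \<in> M \<rightarrow>\<^sub>M count_space UNIV"
  shows "(\<lambda>\<omega>. f \<omega> - g \<omega>) \<in> M \<rightarrow>\<^sub>M count_space UNIV"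
proof (rule measurable_compose_countable[where f = "\<lambda>a \<omega>. a - g \<omega>", OF _ f])
  show "(\<lambda>\<omega>. a - g \<omega>) \<in> M \<rightarrow>\<^sub>M count_space UNIV" for a
    by (rule measurable_compose[OF g]) simp
qed

lemma path_increment_sets:
  assumes "\<And>c. 0 \<le> s c"
  shows "{g \<in> space path_space. \<forall>c<n. g (s (Suc c)) - g (s c) = (x c :: nat)} \<in> sets path_space"
proof -
  have comp: "(\<lambda>g :: real \<Rightarrow> nat. g (s c)) \<in> path_space \<rightarrow>\<^sub>M count_space UNIV" for c
    using measurable_component_singleton[of "s c" "{0..}" "\<lambda>_. count_space UNIV"] assms[of c] by simp
  have diff: "(\<lambda>g :: real \<Rightarrow> nat. g (s (Suc c)) - g (s c)) \<in> path_space \<rightarrow>\<^sub>M count_space UNIV" for c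
    by (rule nat_diff_measurable[OF comp[of "Suc c"] comp[of c]])
  have "{g \<in> space path_space. \<forall>c\<in>{..<n}. g (s (Suc c)) - g (s c) = x c} \<in> sets path_space"
    by (rule joint_event_sets[OF finite_lessThan diff])
  then show ?thesis unfolding Ball_def lessThan_iff .
qed

lemma trajectory_increments:
  assumes "\<And>c. 0 \<le> s c"
  shows "trajectory P -` {g \<in> space path_space. \<forall>c<n. g (s (Suc c)) - g (s c) = x c} \<inter> space M
    = {\<omega> \<in> space M. \<forall>c<n. P (s (Suc c)) \<omega> - P (s c) \<omega> = (x c :: nat)}"
  using assms by (auto simp: trajectory_def space_PiM)

lemma independent_poisson_cells:
  fixes n :: nat and x :: "nat \<Rightarrow> nat \<Rightarrow> nat"
  assumes "prob_space M" and "0 < N"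
    and C: "\<And>i. i < N \<Longrightarrow> poisson_process M (r i) (C i)" and r: "\<And>i. i < N \<Longrightarrow> 0 < r i"
    and indep: "prob_space.indep_vars M (\<lambda>_. path_space) (\<lambda>i. trajectory (C i)) {..<N}"
    and s: "strict_mono s" "0 \<le> s 0"
  defines "E \<equiv> {\<omega> \<in> space M. \<forall>i<N. \<forall>c<n. C i (s (Suc c)) \<omega> - C i (s c) \<omega> = (x i c :: nat)}"
  shows "E \<in> sets M"
    and "measure M E = (\<Prod>i<N. \<Prod>c<n. pmf (poisson_pmf (r i * (s (Suc c) - s c))) (x i c))"
proof -
  interpret prob_space M by fact
  have s_pos: "0 \<le> s c" for c using s strict_mono_less_eq[OF s(1), of 0 c] by auto
  let ?A = "\<lambda>i. {g \<in> space path_space. \<forall>c<n. g (s (Suc c)) - g (s c) = x i c}"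
  have A: "?A i \<in> sets path_space" for i by (rule path_increment_sets[where s = s, OF s_pos])
  have E: "E = (\<Inter>i\<in>{..<N}. trajectory (C i) -` ?A i \<inter> space M)"
    using \<open>0 < N\<close> unfolding trajectory_increments[where s = s, OF s_pos] E_def by auto
  have rv: "trajectory (C i) \<in> M \<rightarrow>\<^sub>M path_space" if "i < N" for i
    using indep that by (simp add: indep_vars_def2)
  show "E \<in> sets M"
    unfolding E using \<open>0 < N\<close> measurable_sets[OF rv A] by (intro sets.finite_INT) auto
  have "prob E = (\<Prod>i<N. prob (trajectory (C i) -` ?A i \<inter> space M))"
    unfolding E by (rule indep_varsD[OF indep _ _ order.refl A]) (use \<open>0 < N\<close> in auto)
  also have "\<dots> = (\<Prod>i<N. \<Prod>c<n. pmf (poisson_pmf (r i * (s (Suc c) - s c))) (x i c))"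
    unfolding trajectory_increments[where s = s, OF s_pos]
    by (intro prod.cong refl poisson_cells C r s) simp_all
  finally show "prob E = (\<Prod>i<N. \<Prod>c<n. pmf (poisson_pmf (r i * (s (Suc c) - s c))) (x i c))" .
qed

section \<open>Words of rings\<close>

text \<open>
  The time axis is cut into \<open>n\<close> cells. A word records the rings in each cell: none, or a single ring
  of clock \<open>i\<close>. Two or more rings in a cell have no letter; they become negligible for fine
  partitions.
\<close>

abbreviation words :: "nat \<Rightarrow> nat \<Rightarrow> (nat \<Rightarrow> nat option) set" where
  "words N n \<equiv> PiE {..<n} (\<lambda>_. insert None (Some ` {..<N}))"

primrec word_state :: "nat \<Rightarrow> (nat \<Rightarrow> nat option) \<Rightarrow> nat \<Rightarrow> int list" where
  "word_state N w 0 = replicate N 0"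
| "word_state N w (Suc c) =
     (case w c of None \<Rightarrow> word_state N w c | Some i \<Rightarrow> ring_clock i (word_state N w c))"

text \<open>
  The probability of the letter \<open>l\<close> in a cell of length \<open>d\<close>, if rings come at total rate \<open>1\<close> and
  belong to clock \<open>i\<close> with probability \<open>\<rho> i\<close>.
\<close>

definition cell_weight :: "(nat \<Rightarrow> real) \<Rightarrow> real \<Rightarrow> nat option \<Rightarrow> real" where
  "cell_weight \<rho> d l = exp (- d) * (case l of None \<Rightarrow> 1 | Some i \<Rightarrow> d * \<rho> i)"

lemma finite_words: "finite (words N n)"
  by (intro finite_PiE) auto

lemma sum_word_weights:
  assumes "(\<Sum>i<N. \<rho> i) = 1"
  shows "(\<Sum>w\<in>words N n. \<Prod>c<n. cell_weight \<rho> (d c) (w c)) = (\<Prod>c<n. exp (- d c) * (1 + d c))"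
proof -
  have "(\<Sum>l\<in>insert None (Some ` {..<N}). cell_weight \<rho> d l) = exp (- d) * (1 + d)" for d
  proof -
    have "(\<Sum>l\<in>insert None (Some ` {..<N}). cell_weight \<rho> d l)
        = cell_weight \<rho> d None + (\<Sum>l\<in>Some ` {..<N}. cell_weight \<rho> d l)"
      by (subst sum.insert) auto
    also have "(\<Sum>l\<in>Some ` {..<N}. cell_weight \<rho> d l) = (\<Sum>i<N. exp (- d) * (d * \<rho> i))"
      by (subst sum.reindex) (auto simp: cell_weight_def)
    also have "\<dots> = exp (- d) * (d * (\<Sum>i<N. \<rho> i))" by (simp only: sum_distrib_left)
    finally show ?thesis by (simp add: cell_weight_def assms ring_distribs)
  qed
  then show ?thesis
    by (subst prod_sum_PiE[symmetric]) auto
qed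

lemma prod_ge_one_minus_sum:
  fixes a :: "nat \<Rightarrow> real"
  assumes "\<And>c. c < n \<Longrightarrow> 0 \<le> a c \<and> a c \<le> 1"
  shows "1 - (\<Sum>c<n. 1 - a c) \<le> (\<Prod>c<n. a c) \<and> (\<Prod>c<n. a c) \<le> 1 \<and> 0 \<le> (\<Prod>c<n. a c)"
  using assms
proof (induction n)
  case (Suc n)
  then have IH: "1 - (\<Sum>c<n. 1 - a c) \<le> (\<Prod>c<n. a c)" "(\<Prod>c<n. a c) \<le> 1" "0 \<le> (\<Prod>c<n. a c)"
    and a: "0 \<le> a n" "a n \<le> 1"
    by auto
  have "0 \<le> (1 - (\<Prod>c<n. a c)) * (1 - a n)" using IH a by (intro mult_nonneg_nonneg) auto
  then have "(\<Prod>c<n. a c) + a n - 1 \<le> (\<Prod>c<n. a c) * a n" by (simp add: algebra_simps)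
  moreover have "(\<Prod>c<n. a c) * a n \<le> 1" using IH a by (intro mult_le_one) auto
  ultimately show ?case using IH a by (simp add: algebra_simps)
qed simp

text \<open>
  A cell of length \<open>d\<close> has at most one ring with probability
  \<open>exp (- d) * (1 + d) \<ge> (1 - d) * (1 + d) = 1 - d\<^sup>2\<close>.
\<close>

lemma sum_word_weights_ge:
  assumes "(\<Sum>i<N. \<rho> i) = 1" and d: "\<And>c. c < n \<Longrightarrow> 0 \<le> d c"
  shows "1 - (\<Sum>c<n. (d c)\<^sup>2) \<le> (\<Sum>w\<in>words N n. \<Prod>c<n. cell_weight \<rho> (d c) (w c))"
proof -
  let ?a = "\<lambda>c. exp (- d c) * (1 + d c)"
  have a: "0 \<le> ?a c \<and> ?a c \<le> 1" if "c < n" for c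
  proof -
    have "?a c \<le> exp (- d c) * exp (d c)" by (intro mult_left_mono) simp_all
    then show ?thesis using d[OF that] by (simp add: exp_minus)
  qed
  have "1 - ?a c \<le> (d c)\<^sup>2" if "c < n" for c
  proof -
    have "(1 - d c) * (1 + d c) \<le> ?a c"
      using exp_ge_add_one_self[of "- d c"] d[OF that] by (intro mult_right_mono) auto
    then show ?thesis by (simp add: algebra_simps power2_eq_square)
  qed
  then have "(\<Sum>c<n. 1 - ?a c) \<le> (\<Sum>c<n. (d c)\<^sup>2)" by (intro sum_mono) simp
  moreover have "1 - (\<Sum>c<n. 1 - ?a c) \<le> (\<Prod>c<n. ?a c)"
    using prod_ge_one_minus_sum[of n ?a] a by blast
  ultimately show ?thesis unfolding sum_word_weights[OF assms(1)] by linarith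
qed

text \<open>
  Where some \<open>E w\<close> occurs, the word decides the event \<open>Z\<close>; the remaining event has probability
  \<open>1 - (\<Sum>w\<in>W. q w)\<close>. The bounds depend only on the weights \<open>q\<close> and on \<open>good\<close>, so processes on different
  probability spaces can be compared through them.
\<close>

lemma (in prob_space) word_approximation:
  fixes \<kappa> :: "'c \<Rightarrow> 'd"
  assumes W: "finite W" and E: "\<And>w. w \<in> W \<Longrightarrow> E w \<in> events" "\<And>w. w \<in> W \<Longrightarrow> prob (E w) = q w"
    and disj: "disjoint_family_on E W"
    and Z: "AE \<omega> in M. \<forall>w\<in>W. \<omega> \<in> E w \<longrightarrow> (Z \<omega> \<longleftrightarrow> good w)"
    and meas: "{\<omega> \<in> space M. Z \<omega>} \<in> events"
  shows "prob {\<omega> \<in> space M. Z \<omega>} \<in>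
    {(\<Sum>w\<in>{w\<in>W. good w}. q w) .. (\<Sum>w\<in>{w\<in>W. good w}. q w) + (1 - (\<Sum>w\<in>W. q w))}"
proof -
  let ?G = "{w \<in> W. good w}"
  have union: "prob (\<Union>w\<in>V. E w) = (\<Sum>w\<in>V. q w)" "(\<Union>w\<in>V. E w) \<in> events" if "V \<subseteq> W" for V
  proof -
    have "finite V" using that W by (rule finite_subset)
    then have "prob (\<Union>w\<in>V. E w) = (\<Sum>w\<in>V. prob (E w))"
      using that E by (intro finite_measure_finite_Union disjoint_family_on_mono[OF that disj]) auto
    then show "prob (\<Union>w\<in>V. E w) = (\<Sum>w\<in>V. q w)"
      using that E by (simp add: subset_iff)
    show "(\<Union>w\<in>V. E w) \<in> events" using \<open>finite V\<close> that E by (intro sets.finite_UN) auto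
  qed
  have lower: "(\<Sum>w\<in>?G. q w) \<le> prob {\<omega> \<in> space M. Z \<omega>}"
    unfolding union(1)[of ?G, OF Collect_restrict, symmetric]
  proof (rule finite_measure_mono_AE[OF _ meas])
    show "AE \<omega> in M. \<omega> \<in> (\<Union>w\<in>?G. E w) \<longrightarrow> \<omega> \<in> {\<omega> \<in> space M. Z \<omega>}"
      using Z by (rule AE_mp) (rule AE_I2, blast)
  qed
  have none: "space M - (\<Union>w\<in>W. E w) \<in> events" by (rule sets.compl_sets[OF union(2)]) simp
  have "prob {\<omega> \<in> space M. Z \<omega>} \<le> prob ((\<Union>w\<in>?G. E w) \<union> (space M - (\<Union>w\<in>W. E w)))"
  proof (rule finite_measure_mono_AE)
    show "AE \<omega> in M. \<omega> \<in> {\<omega> \<in> space M. Z \<omega>} \<longrightarrow> \<omega> \<in> (\<Union>w\<in>?G. E w) \<union> (space M - (\<Union>w\<in>W. E w))"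
      using Z by (rule AE_mp) (rule AE_I2, blast)
    show "(\<Union>w\<in>?G. E w) \<union> (space M - (\<Union>w\<in>W. E w)) \<in> events"
      using none union(2)[of ?G] by auto
  qed
  also have "\<dots> \<le> prob (\<Union>w\<in>?G. E w) + prob (space M - (\<Union>w\<in>W. E w))"
    by (rule measure_Un_le[OF union(2) none]) simp
  also have "prob (space M - (\<Union>w\<in>W. E w)) = 1 - (\<Sum>w\<in>W. q w)"
    using prob_compl[OF union(2)[of W]] union(1)[of W] by simp
  also have "prob (\<Union>w\<in>?G. E w) = (\<Sum>w\<in>?G. q w)" by (rule union(1)) simp
  finally show ?thesis using lower by simp
qed

section \<open>Fine partitions\<close>

text \<open>
  A new largest point \<open>b\<close> is reached by \<open>m\<close> equal cells appended to the partition; since the last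
  point \<open>s n\<close> belongs to \<open>insert 0 T\<close>, it lies to the left of \<open>b\<close>. These cells contribute
  \<open>L\<^sup>2 / m\<close> to the sum of squares, where \<open>L\<close> is the length of the new interval.
\<close>

lemma ex_fine_partition_pos:
  fixes T :: "real set"
  assumes "finite T" "T \<subseteq> {0<..}" "0 < \<epsilon>"
  shows "\<exists>s n. strict_mono s \<and> s 0 = 0 \<and> s n \<in> insert 0 T \<and> T \<subseteq> s ` {..n} \<and>
    (\<Sum>c<n. (s (Suc c) - s c)\<^sup>2) \<le> \<epsilon>"
  using assms
proof (induction T arbitrary: \<epsilon> rule: finite_linorder_max_induct)
  case empty
  show ?case
    by (rule exI[of _ real], rule exI[of _ 0]) (use empty in \<open>auto simp: strict_mono_def\<close>)
next
  case (insert b T)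
  then obtain s n where s: "strict_mono s" "s 0 = 0" "s n \<in> Set.insert 0 T" "T \<subseteq> s ` {..n}"
    "(\<Sum>c<n. (s (Suc c) - s c)\<^sup>2) \<le> \<epsilon> / 2"
    using insert.IH[of "\<epsilon> / 2"] by auto
  define L where "L = b - s n"
  have L: "0 < L" using s(3) insert by (auto simp: L_def)
  obtain m where m: "L\<^sup>2 / (\<epsilon> / 2) < real m" using reals_Archimedean2 by blast
  have "0 \<le> L\<^sup>2 / (\<epsilon> / 2)" using \<open>0 < \<epsilon>\<close> by simp
  then have "0 < m" using m by (cases m) auto
  define s' where "s' k = (if k \<le> n then s k else s n + real (k - n) * (L / m))" for k
  have s'_Suc: "s' (Suc k) - s' k = (if k < n then s (Suc k) - s k else L / m)" for k
  proof -
    consider "k < n" | "k = n" | "n < k" by linarith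
    then show ?thesis
    proof cases
      case 3
      then obtain j where "k = Suc (n + j)" by (auto dest: less_imp_Suc_add)
      then show ?thesis by (simp add: s'_def ring_distribs add_divide_distrib)
    qed (simp_all add: s'_def)
  qed
  have "s' k < s' (Suc k)" for k
  proof -
    have "0 < s' (Suc k) - s' k"
      unfolding s'_Suc using strict_monoD[OF s(1), of k "Suc k"] L \<open>0 < m\<close> by simp
    then show ?thesis by simp
  qed
  then have "strict_mono s'" by (simp add: strict_mono_Suc_iff)
  moreover have "s' 0 = 0" by (simp add: s'_def s(2))
  moreover have b: "s' (n + m) = b" using \<open>0 < m\<close> by (simp add: s'_def L_def)
  moreover have "insert b T \<subseteq> s' ` {..n + m}"
  proof
    fix \<tau> assume "\<tau> \<in> insert b T"
    then have "\<tau> = b \<or> \<tau> \<in> s ` {..n}" using s(4) by blast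
    then consider "\<tau> = b" | k where "k \<le> n" "\<tau> = s k" by (elim disjE imageE) (simp_all only: atMost_iff)
    then show "\<tau> \<in> s' ` {..n + m}"
    proof cases
      case 1
      then show ?thesis using b by (intro image_eqI[of _ _ "n + m"]) auto
    next
      case (2 k)
      then show ?thesis by (intro image_eqI[of _ _ k]) (auto simp: s'_def)
    qed
  qed
  moreover have "(\<Sum>c<n + m. (s' (Suc c) - s' c)\<^sup>2) \<le> \<epsilon>"
  proof -
    have "(\<Sum>c<n + m. (s' (Suc c) - s' c)\<^sup>2)
        = (\<Sum>c<n. (s' (Suc c) - s' c)\<^sup>2) + (\<Sum>c<m. (s' (Suc (n + c)) - s' (n + c))\<^sup>2)"
      by (induction m) simp_all
    also have "\<dots> = (\<Sum>c<n. (s (Suc c) - s c)\<^sup>2) + real m * (L / m)\<^sup>2"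
      by (simp add: s'_Suc)
    also have "real m * (L / m)\<^sup>2 = L\<^sup>2 / m" using \<open>0 < m\<close> by (simp add: power2_eq_square)
    also have "\<dots> \<le> \<epsilon> / 2" using m \<open>0 < m\<close> \<open>0 < \<epsilon>\<close> by (simp add: field_simps)
    finally show ?thesis using s(5) by simp
  qed
  ultimately show ?case by (intro exI[of _ s'] exI[of _ "n + m"]) simp
qed

lemma ex_fine_partition:
  fixes T :: "real set"
  assumes "finite T" "T \<subseteq> {0..}" "0 < \<epsilon>"
  obtains s n where "strict_mono s" "s 0 = 0" "T \<subseteq> s ` {..n}" "(\<Sum>c<n. (s (Suc c) - s c)\<^sup>2) \<le> \<epsilon>"
proof -
  obtain s n where s: "strict_mono s" "s 0 = 0" "T - {0} \<subseteq> s ` {..n}"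
    "(\<Sum>c<n. (s (Suc c) - s c)\<^sup>2) \<le> \<epsilon>"
    using ex_fine_partition_pos[of "T - {0}" \<epsilon>] assms by force
  have "0 \<in> s ` {..n}" using s(2) by (intro image_eqI[of _ _ 0]) auto
  then show ?thesis using that s by blast
qed

section \<open>The reflected Poisson walk along words\<close>

lemma poisson_process_paths:
  assumes "poisson_process M r P"
  shows "AE \<omega> in M. P 0 \<omega> = 0 \<and> (\<forall>\<sigma> \<tau>. 0 \<le> \<sigma> \<longrightarrow> \<sigma> \<le> \<tau> \<longrightarrow> P \<sigma> \<omega> \<le> P \<tau> \<omega>)"
proof -
  have "AE \<omega> in M. P 0 \<omega> = 0 \<and> mono_on {0..} (\<lambda>\<tau>. P \<tau> \<omega>) \<and>
      (\<forall>\<tau>\<ge>0. continuous (at_right \<tau>) (\<lambda>\<sigma>. P \<sigma> \<omega>))"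
    using assms by (simp add: poisson_process_def)
  then show ?thesis
    by (rule AE_mp) (auto intro!: AE_I2 simp: mono_on_def)
qed

text \<open>
  Superposition of the clocks in a single cell: at most one ring in total has the same probability as
  for one process of rate \<open>R\<close> whose points are distributed among the clocks in proportion to \<open>r i\<close>.
\<close>

lemma prod_single_letter:
  fixes r :: "nat \<Rightarrow> real"
  assumes R: "R = (\<Sum>i<N. r i)" "0 < R" and "0 < d" and r: "\<And>i. i < N \<Longrightarrow> 0 < r i"
    and l: "l \<in> insert None (Some ` {..<N})"
  shows "(\<Prod>i<N. pmf (poisson_pmf (r i * d)) (if l = Some i then 1 else 0))
    = cell_weight (\<lambda>i. r i / R) (R * d) l"
proof -
  have "(\<Prod>i<N. pmf (poisson_pmf (r i * d)) (if l = Some i then 1 else 0))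
      = (\<Prod>i<N. exp (- (r i * d)) * (if l = Some i then r i * d else 1))"
    using r \<open>0 < d\<close> by (intro prod.cong) auto
  also have "\<dots> = (\<Prod>i<N. exp (- (r i * d))) * (\<Prod>i<N. if l = Some i then r i * d else 1)"
    by (rule prod.distrib)
  also have "(\<Prod>i<N. exp (- (r i * d))) = exp (- (R * d))"
    by (simp add: R(1) exp_sum[symmetric] sum_negf sum_distrib_right)
  also have "(\<Prod>i<N. if l = Some i then r i * d else 1) = (case l of None \<Rightarrow> 1 | Some i \<Rightarrow> R * d * (r i / R))"
  proof (cases l)
    case (Some k)
    then have "k < N" using l by auto
    then show ?thesis using Some R(2) by (simp add: prod.delta')
  qed simp
  finally show ?thesis by (simp add: cell_weight_def)
qed

lemma words_distinct:
  assumes "w \<in> words N n" "v \<in> words N n" "w \<noteq> v"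
  obtains c i where "c < n" "i < N" "(w c = Some i) \<noteq> (v c = Some i)"
proof -
  obtain c where c: "c < n" "w c \<noteq> v c"
    using assms by (metis PiE_ext lessThan_iff)
  have "w c \<in> insert None (Some ` {..<N})" "v c \<in> insert None (Some ` {..<N})"
    using PiE_mem[OF assms(1)] PiE_mem[OF assms(2)] c by auto
  then show ?thesis using that[OF c(1)] c(2) by (cases "w c"; cases "v c") auto
qed

text \<open>
  \<open>E w\<close> prescribes the number of rings of every clock in every cell as the word \<open>w\<close> says. On \<open>E w\<close>
  the dynamics applies to each cell, and the states at the points of the partition are those
  computed from \<open>w\<close>. The cell lengths appear multiplied by the total rate \<open>R\<close>.
\<close>

lemma reflected_poisson_walk_words:
  fixes t :: real
  assumes S: "reflected_poisson_walk N t M S" and "0 < N" "0 < t"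
    and s: "strict_mono s" "s 0 = 0"
  defines "R \<equiv> \<Sum>i<N. t ^ (i + 1)"
  obtains E where "\<forall>w\<in>words N n. E w \<in> sets M"
    "\<forall>w\<in>words N n. measure M (E w)
      = (\<Prod>c<n. cell_weight (\<lambda>i. t ^ (i + 1) / R) (R * (s (Suc c) - s c)) (w c))"
    "disjoint_family_on E (words N n)"
    "AE \<omega> in M. \<forall>w\<in>words N n. \<omega> \<in> E w \<longrightarrow> (\<forall>c\<le>n. S (s c) \<omega> = word_state N w c)"
proof -
  from S obtain C where M: "prob_space M"
    and C: "\<And>i. i < N \<Longrightarrow> poisson_process M (t ^ (i + 1)) (C i)"
    and indep: "prob_space.indep_vars M (\<lambda>_. path_space) (\<lambda>i. trajectory (C i)) {..<N}"
    and dynamics: "AE \<omega> in M.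
           S 0 \<omega> = replicate N 0 \<and>
           (\<forall>\<sigma> \<tau>. 0 \<le> \<sigma> \<and> \<sigma> \<le> \<tau> \<longrightarrow>
              ((\<forall>i<N. C i \<tau> \<omega> = C i \<sigma> \<omega>) \<longrightarrow> S \<tau> \<omega> = S \<sigma> \<omega>) \<and>
              (\<forall>i<N. C i \<tau> \<omega> = C i \<sigma> \<omega> + 1 \<and>
                 (\<forall>j<N. j \<noteq> i \<longrightarrow> C j \<tau> \<omega> = C j \<sigma> \<omega>) \<longrightarrow>
                 S \<tau> \<omega> = ring_clock i (S \<sigma> \<omega>)))"
    unfolding reflected_poisson_walk_def by blast
  have s_cell: "0 \<le> s c" "s c < s (Suc c)" for c
    using s strict_mono_less_eq[OF s(1), of 0 c] strict_mono_less[OF s(1), of c "Suc c"] by auto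
  have r_pos: "0 < t ^ (i + 1)" for i using \<open>0 < t\<close> by simp
  have R: "0 < R" unfolding R_def using \<open>0 < N\<close> r_pos by (intro sum_pos) auto
  define x where "x w i c = (if w c = Some i then 1 else 0 :: nat)" for w :: "nat \<Rightarrow> nat option" and i c
  define E where "E w = {\<omega> \<in> space M. \<forall>i<N. \<forall>c<n. C i (s (Suc c)) \<omega> - C i (s c) \<omega> = x w i c}" for w
  have "0 \<le> s 0" using s by simp
  note cells = independent_poisson_cells[OF M \<open>0 < N\<close> C r_pos indep s(1) \<open>0 \<le> s 0\<close>, of n]
  show ?thesis
  proof (rule that[of E]; (intro ballI)?)
    fix w assume w: "w \<in> words N n"
    show "E w \<in> sets M" unfolding E_def by (rule cells(1))
    have "measure M (E w) = (\<Prod>i<N. \<Prod>c<n. pmf (poisson_pmf (t ^ (i + 1) * (s (Suc c) - s c))) (x w i c))"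
      unfolding E_def by (rule cells(2))
    also have "\<dots> = (\<Prod>c<n. \<Prod>i<N. pmf (poisson_pmf (t ^ (i + 1) * (s (Suc c) - s c))) (x w i c))"
      by (rule prod.swap)
    also have "\<dots> = (\<Prod>c<n. cell_weight (\<lambda>i. t ^ (i + 1) / R) (R * (s (Suc c) - s c)) (w c))"
      unfolding x_def using w s_cell r_pos R
      by (intro prod.cong refl prod_single_letter) (auto simp: R_def PiE_iff)
    finally show "measure M (E w) = (\<Prod>c<n. cell_weight (\<lambda>i. t ^ (i + 1) / R) (R * (s (Suc c) - s c)) (w c))" .
  next
    show "disjoint_family_on E (words N n)"
      unfolding disjoint_family_on_def
    proof (intro ballI impI)
      fix w v assume "w \<in> words N n" "v \<in> words N n" "w \<noteq> v"
      then obtain c i where ci: "c < n" "i < N" "(w c = Some i) \<noteq> (v c = Some i)"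
        by (rule words_distinct)
      then have "x w i c \<noteq> x v i c" by (auto simp: x_def)
      then show "E w \<inter> E v = {}" using ci(1,2) unfolding E_def by auto
    qed
  next
    have "AE \<omega> in M. \<forall>i\<in>{..<N}. C i 0 \<omega> = 0 \<and> (\<forall>\<sigma> \<tau>. 0 \<le> \<sigma> \<longrightarrow> \<sigma> \<le> \<tau> \<longrightarrow> C i \<sigma> \<omega> \<le> C i \<tau> \<omega>)"
      by (intro AE_finite_allI poisson_process_paths[OF C]) auto
    with dynamics show "AE \<omega> in M. \<forall>w\<in>words N n. \<omega> \<in> E w \<longrightarrow> (\<forall>c\<le>n. S (s c) \<omega> = word_state N w c)"
    proof eventually_elim
      case (elim \<omega>)
      then have S0: "S 0 \<omega> = replicate N 0"
        and stay: "\<And>\<sigma> \<tau>. 0 \<le> \<sigma> \<Longrightarrow> \<sigma> \<le> \<tau> \<Longrightarrow> \<forall>i<N. C i \<tau> \<omega> = C i \<sigma> \<omega> \<Longrightarrow> S \<tau> \<omega> = S \<sigma> \<omega>"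
        and ring: "\<And>\<sigma> \<tau> i. 0 \<le> \<sigma> \<Longrightarrow> \<sigma> \<le> \<tau> \<Longrightarrow> i < N \<Longrightarrow> C i \<tau> \<omega> = C i \<sigma> \<omega> + 1 \<Longrightarrow>
          \<forall>j<N. j \<noteq> i \<longrightarrow> C j \<tau> \<omega> = C j \<sigma> \<omega> \<Longrightarrow> S \<tau> \<omega> = ring_clock i (S \<sigma> \<omega>)"
        and mono: "\<And>i \<sigma> \<tau>. i < N \<Longrightarrow> 0 \<le> \<sigma> \<Longrightarrow> \<sigma> \<le> \<tau> \<Longrightarrow> C i \<sigma> \<omega> \<le> C i \<tau> \<omega>"
        by blast+
      have "S (s c) \<omega> = word_state N w c" if w: "w \<in> words N n" and E: "\<omega> \<in> E w" and "c \<le> n" for w c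
        using \<open>c \<le> n\<close>
      proof (induction c)
        case 0
        show ?case by (simp add: s(2) S0)
      next
        case (Suc c)
        have inc: "C i (s (Suc c)) \<omega> = C i (s c) \<omega> + x w i c" if "i < N" for i
        proof -
          have "C i (s (Suc c)) \<omega> - C i (s c) \<omega> = x w i c"
            using E that Suc.prems unfolding E_def by auto
          then show ?thesis using mono[OF that s_cell(1)[of c] less_imp_le[OF s_cell(2)[of c]]] by linarith
        qed
        have IH: "S (s c) \<omega> = word_state N w c" using Suc by simp
        show ?case
        proof (cases "w c")
          case None
          then have "S (s (Suc c)) \<omega> = S (s c) \<omega>"
            using inc s_cell[of c] by (intro stay) (auto simp: x_def)
          then show ?thesis using None IH by simp
        next
          case (Some i)
          then have "i < N" using PiE_mem[OF w, of c] Suc.prems by auto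
          then have "S (s (Suc c)) \<omega> = ring_clock i (S (s c) \<omega>)"
            using inc Some s_cell[of c] by (intro ring) (auto simp: x_def)
          then show ?thesis using Some IH by simp
        qed
      qed
      then show ?case by blast
    qed
  qed
qed

section \<open>The matrix product walk along words\<close>

text \<open>
  The number of rings before cell \<open>c\<close>, which is the number of the mark used if cell \<open>c\<close> has a ring.
\<close>

primrec jumps :: "(nat \<Rightarrow> 'a option) \<Rightarrow> nat \<Rightarrow> nat" where
  "jumps w 0 = 0"
| "jumps w (Suc c) = jumps w c + (if w c = None then 0 else 1)"

lemma chain_jumps:
  assumes "\<And>c i. c < n \<Longrightarrow> w c = Some i \<Longrightarrow> m (jumps w c) = i"
  shows "chain N m (jumps w n) = word_state N w n"
  using assms by (induction n) (auto split: option.split)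

text \<open>
  The letters of a word other than \<open>None\<close>, in their order, are the values \<open>f 0, f 1, \<dots>\<close> that the word
  prescribes to an initial segment of the marks.
\<close>

lemma ex_letters:
  fixes g :: "'a \<Rightarrow> real"
  shows "\<exists>f. (\<forall>m. (\<forall>c<n. \<forall>i. w c = Some i \<longrightarrow> m (jumps w c) = i) \<longleftrightarrow> (\<forall>j<jumps w n. m j = f j)) \<and>
    (\<forall>j<jumps w n. \<exists>c<n. w c = Some (f j)) \<and>
    (\<Prod>j<jumps w n. g (f j)) = (\<Prod>c<n. case w c of None \<Rightarrow> 1 | Some i \<Rightarrow> g i)"
proof (induction n)
  case (Suc n)
  then obtain f where f: "\<And>m. (\<forall>c<n. \<forall>i. w c = Some i \<longrightarrow> m (jumps w c) = i) \<longleftrightarrow> (\<forall>j<jumps w n. m j = f j)"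
    "\<forall>j<jumps w n. \<exists>c<n. w c = Some (f j)"
    "(\<Prod>j<jumps w n. g (f j)) = (\<Prod>c<n. case w c of None \<Rightarrow> 1 | Some i \<Rightarrow> g i)"
    by blast
  show ?case
  proof (cases "w n")
    case None
    then show ?thesis using f by (intro exI[of _ f]) (auto simp: less_Suc_eq)
  next
    case (Some i)
    let ?f = "f(jumps w n := i)"
    have "(\<forall>c<Suc n. \<forall>i. w c = Some i \<longrightarrow> m (jumps w c) = i) \<longleftrightarrow> (\<forall>j<jumps w (Suc n). m j = ?f j)" for m
      using f(1)[of m] Some by (auto simp: less_Suc_eq)
    moreover have "\<forall>j<jumps w (Suc n). \<exists>c<Suc n. w c = Some (?f j)"
      using f(2) Some by (auto simp: less_Suc_eq)
    moreover have "(\<Prod>j<jumps w (Suc n). g (?f j)) = (\<Prod>c<Suc n. case w c of None \<Rightarrow> 1 | Some i \<Rightarrow> g i)"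
      using f(3) Some by simp
    ultimately show ?thesis by blast
  qed
qed simp

text \<open>
  With \<open>t = 1 / p\<close>, expand the right-hand side by \<open>p ^ N\<close> and sum the geometric series.
\<close>

lemma lead_weight_eq:
  assumes "i < N" "1 < p"
  shows "lead_weight p N i = (1 / real p) ^ (i + 1) / (\<Sum>j<N. (1 / real p) ^ (j + 1))"
proof -
  let ?p = "real p"
  have p: "1 < ?p" using assms by simp
  have pN: "1 < ?p ^ N" using p assms by (intro one_less_power) auto
  let ?R = "\<Sum>j<N. (1 / ?p) ^ (j + 1)"
  have "?R = (1 / ?p) * (\<Sum>j<N. (1 / ?p) ^ j)"
    unfolding sum_distrib_left by simp
  also have "(\<Sum>j<N. (1 / ?p) ^ j) = (1 - (1 / ?p) ^ N) / (1 - 1 / ?p)"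
    using p unfolding sum_gp_strict by simp
  also have "(1 / ?p) * ((1 - (1 / ?p) ^ N) / (1 - 1 / ?p)) = (1 - (1 / ?p) ^ N) / (?p - 1)"
    using p by (simp add: field_split_simps)
  finally have "?R * (?p - 1) = 1 - (1 / ?p) ^ N" using p by (simp only: nonzero_eq_divide_eq)
  then have "?p ^ N * (?R * (?p - 1)) = ?p ^ N - 1"
    using p by (simp only: right_diff_distrib power_mult_distrib[symmetric]) simp
  moreover have "?p ^ N * (1 / ?p) ^ (i + 1) = ?p ^ (N - 1 - i)"
  proof -
    have "?p ^ N = ?p ^ (N - 1 - i) * ?p ^ (i + 1)"
      unfolding power_add[symmetric] using assms by simp
    then show ?thesis using p by (simp add: power_one_over)
  qed
  ultimately have "lead_weight p N i
      = (?p - 1) * (?p ^ N * (1 / ?p) ^ (i + 1)) / (?p ^ N * (?R * (?p - 1)))"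
    by (simp only: lead_weight_def)
  then show ?thesis using p by simp
qed


text \<open>
  Here \<open>A w\<close> prescribes the jumps of the Poisson process in the cells and \<open>B w\<close> the marks of these
  jumps. The two events are independent, and the probability of \<open>B w\<close> is given by \<open>marks_iid\<close>.
\<close>

lemma product_walk_words:
  fixes x :: "nat + nat \<Rightarrow> 'a \<Rightarrow> 'p::prime_card padic_int mat"
  assumes "0 < N" and P: "poisson_process M 1 P"
    and haar: "\<And>i. i \<ge> 1 \<Longrightarrow> haar_prob_measure N (distr M (GL_Zp_borel N) (x (Inr i)))"
    and indep: "prob_space.indep_vars M (\<lambda>_. GL_Zp_borel N) x matrix_index"
    and indep_P: "prob_space.indep_set M
        (sets (vimage_algebra (space M) (trajectory P) path_space))
        (sets (vimage_algebra (space M) (\<lambda>\<omega>. \<lambda>k\<in>matrix_index. x k \<omega>)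
          (PiM matrix_index (\<lambda>_. GL_Zp_borel N))))"
    and s: "strict_mono s" "s 0 = 0"
  obtains E where "\<forall>w\<in>words N n. E w \<in> sets M"
    "\<forall>w\<in>words N n. measure M (E w)
      = (\<Prod>c<n. cell_weight (lead_weight CARD('p) N) (s (Suc c) - s c) (w c))"
    "disjoint_family_on E (words N n)"
    "AE \<omega> in M. \<forall>w\<in>words N n. \<omega> \<in> E w \<longrightarrow>
      (\<forall>c\<le>n. chain N (mark N (\<lambda>k. x k \<omega>)) (P (s c) \<omega>) = word_state N w c)"
proof -
  interpret prob_space M using P by (simp add: poisson_process_def)
  have s_cell: "0 \<le> s c" "s c < s (Suc c)" for c
    using s strict_mono_less_eq[OF s(1), of 0 c] strict_mono_less[OF s(1), of c "Suc c"] by auto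
  let ?x = "\<lambda>\<omega>. \<lambda>k\<in>matrix_index. x k \<omega>"
  define y where "y w c = (if w c = None then 0 else 1 :: nat)" for w :: "nat \<Rightarrow> nat option" and c
  define A where "A w = {\<omega> \<in> space M. \<forall>c<n. P (s (Suc c)) \<omega> - P (s c) \<omega> = y w c}" for w
  define B where "B w = {\<omega> \<in> space M. \<forall>c<n. \<forall>i. w c = Some i \<longrightarrow> mark N (\<lambda>k. x k \<omega>) (jumps w c) = i}"
    for w
  have rv: "x k \<in> M \<rightarrow>\<^sub>M GL_Zp_borel N" if "k \<in> matrix_index" for k
    using indep that by (auto simp: indep_vars_def2)
  have x_meas: "?x \<in> M \<rightarrow>\<^sub>M matrix_space N matrix_index"
    using rv by (intro measurable_restrict) auto
  have mark_x: "mark N (?x \<omega>) j = mark N (\<lambda>k. x k \<omega>) j" for \<omega> j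
    using index_upto_subset[of "Suc j"] by (intro mark_cong) auto
  have A_sets: "A w \<in> sets (vimage_algebra (space M) (trajectory P) path_space)" for w
    unfolding A_def trajectory_increments[where s = s, OF s_cell(1), symmetric]
    by (intro in_vimage_algebra path_increment_sets s_cell(1))
  have A_events: "A w \<in> events" for w
  proof -
    have "{\<omega> \<in> space M. \<forall>c\<in>{..<n}. P (s (Suc c)) \<omega> - P (s c) \<omega> = y w c} \<in> events"
    proof (rule joint_event_sets)
      have "P (s c) \<in> M \<rightarrow>\<^sub>M count_space UNIV" for c
        using P s_cell(1)[of c] by (simp add: poisson_process_def)
      then show "(\<lambda>\<omega>. P (s (Suc c)) \<omega> - P (s c) \<omega>) \<in> M \<rightarrow>\<^sub>M count_space UNIV" for c
        by (intro nat_diff_measurable)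
    qed simp
    then show ?thesis unfolding A_def Ball_def lessThan_iff .
  qed
  have A_prob: "prob (A w) = (\<Prod>c<n. exp (- (s (Suc c) - s c)) * (if w c = None then 1 else s (Suc c) - s c))" for w
  proof -
    have "prob (A w) = (\<Prod>c<n. pmf (poisson_pmf (1 * (s (Suc c) - s c))) (y w c))"
      unfolding A_def by (rule poisson_cells[OF P _ s(1)]) (simp_all add: s(2))
    also have "\<dots> = (\<Prod>c<n. exp (- (s (Suc c) - s c)) * (if w c = None then 1 else s (Suc c) - s c))"
      using s_cell by (intro prod.cong) (auto simp: y_def)
    finally show ?thesis .
  qed
  have B: "B w \<in> sets (vimage_algebra (space M) ?x (matrix_space N matrix_index))"
    "B w \<in> events"
    "prob (B w) = (\<Prod>c<n. case w c of None \<Rightarrow> 1 | Some i \<Rightarrow> lead_weight CARD('p) N i)"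
    if w: "w \<in> words N n" for w
  proof -
    obtain f where f: "\<And>m. (\<forall>c<n. \<forall>i. w c = Some i \<longrightarrow> m (jumps w c) = i) \<longleftrightarrow> (\<forall>j<jumps w n. m j = f j)"
      "\<And>j. j < jumps w n \<Longrightarrow> \<exists>c<n. w c = Some (f j)"
      "(\<Prod>j<jumps w n. lead_weight CARD('p) N (f j))
        = (\<Prod>c<n. case w c of None \<Rightarrow> 1 | Some i \<Rightarrow> lead_weight CARD('p) N i)"
      using ex_letters[of n w "lead_weight CARD('p) N"] by blast
    have fN: "f j < N" if j: "j < jumps w n" for j
    proof -
      obtain c where "c < n" "w c = Some (f j)" using f(2)[OF j] by blast
      then show ?thesis using PiE_mem[OF w, of c] by auto
    qed
    have B_eq: "B w = {\<omega> \<in> space M. \<forall>j<jumps w n. mark N (\<lambda>k. x k \<omega>) j = f j}"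
      unfolding B_def f(1) ..
    show "prob (B w) = (\<Prod>c<n. case w c of None \<Rightarrow> 1 | Some i \<Rightarrow> lead_weight CARD('p) N i)"
      unfolding B_eq f(3)[symmetric] by (rule marks_iid[OF \<open>0 < N\<close> indep haar fN])
    define B' where "B' = {z \<in> space (matrix_space N matrix_index). \<forall>j<jumps w n.
      mark N (z :: _ \<Rightarrow> 'p padic_int mat) j = f j}"
    have "{z \<in> space (matrix_space N matrix_index). \<forall>j\<in>{..<jumps w n}. mark N z j = f j}
        \<in> sets (matrix_space N matrix_index :: (_ \<Rightarrow> 'p padic_int mat) measure)"
      by (rule joint_event_sets[OF finite_lessThan mark_measurable[OF \<open>0 < N\<close> index_upto_subset]])
    then have B'_sets: "B' \<in> sets (matrix_space N matrix_index)"
      unfolding B'_def Ball_def lessThan_iff .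
    have B_vimage: "B w = ?x -` B' \<inter> space M"
      using measurable_space[OF x_meas] unfolding B_eq B'_def by (auto simp: mark_x simp del: One_nat_def)
    show "B w \<in> sets (vimage_algebra (space M) ?x (matrix_space N matrix_index))"
      unfolding B_vimage by (rule in_vimage_algebra[OF B'_sets])
    show "B w \<in> events"
      unfolding B_vimage by (rule measurable_sets[OF x_meas B'_sets])
  qed
  show ?thesis
  proof (rule that[of "\<lambda>w. A w \<inter> B w"]; (intro ballI)?)
    fix w assume w: "w \<in> words N n"
    show "A w \<inter> B w \<in> events" using A_events B(2)[OF w] by simp
    have "prob (A w \<inter> B w) = prob (A w) * prob (B w)"
      by (rule indep_setD[OF indep_P A_sets B(1)[OF w]])
    also have "\<dots> = (\<Prod>c<n. exp (- (s (Suc c) - s c)) * (if w c = None then 1 else s (Suc c) - s c)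
        * (case w c of None \<Rightarrow> 1 | Some i \<Rightarrow> lead_weight CARD('p) N i))"
      unfolding A_prob B(3)[OF w] by (rule prod.distrib[symmetric])
    also have "\<dots> = (\<Prod>c<n. cell_weight (lead_weight CARD('p) N) (s (Suc c) - s c) (w c))"
      by (intro prod.cong) (auto simp: cell_weight_def split: option.split)
    finally show "prob (A w \<inter> B w) = (\<Prod>c<n. cell_weight (lead_weight CARD('p) N) (s (Suc c) - s c) (w c))" .
  next
    show "disjoint_family_on (\<lambda>w. A w \<inter> B w) (words N n)"
      unfolding disjoint_family_on_def
    proof (intro ballI impI)
      fix w v assume wv: "w \<in> words N n" "v \<in> words N n" "w \<noteq> v"
      show "(A w \<inter> B w) \<inter> (A v \<inter> B v) = {}"
      proof (rule ccontr)
        assume "\<not> ?thesis"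
        then obtain \<omega> where \<omega>: "\<omega> \<in> A w" "\<omega> \<in> B w" "\<omega> \<in> A v" "\<omega> \<in> B v" by blast
        \<comment> \<open>The words have their rings in the same cells because of \<open>A\<close>, hence use the same marks in these
          cells, and these marks determine the letters.\<close>
        have none: "w c = None \<longleftrightarrow> v c = None" if "c < n" for c
        proof -
          have "y w c = y v c" using \<omega>(1,3) that unfolding A_def by auto
          then show ?thesis by (simp add: y_def split: if_splits)
        qed
        have jumps: "c \<le> n \<Longrightarrow> jumps w c = jumps v c" for c
          by (induction c) (simp_all add: none)
        have "w c = v c" if c: "c < n" for c
        proof (cases "w c")
          case None
          then show ?thesis using none[OF c] by simp
        next
          case (Some i)
          then obtain j where j: "v c = Some j" using none[OF c] by auto
          have "i = mark N (\<lambda>k. x k \<omega>) (jumps w c)" using \<omega>(2) c Some unfolding B_def by auto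
          also have "\<dots> = mark N (\<lambda>k. x k \<omega>) (jumps v c)" using jumps[of c] c by simp
          also have "\<dots> = j" using \<omega>(4) c j unfolding B_def by auto
          finally show ?thesis using Some j by simp
        qed
        then have "w = v" by (intro PiE_ext[OF wv(1,2)]) simp
        then show False using wv(3) by simp
      qed
    qed
  next
    show "AE \<omega> in M. \<forall>w\<in>words N n. \<omega> \<in> A w \<inter> B w \<longrightarrow>
      (\<forall>c\<le>n. chain N (mark N (\<lambda>k. x k \<omega>)) (P (s c) \<omega>) = word_state N w c)"
      using poisson_process_paths[OF P]
    proof eventually_elim
      case (elim \<omega>)
      then have P0: "P 0 \<omega> = 0" and mono: "\<And>\<sigma> \<tau>. 0 \<le> \<sigma> \<Longrightarrow> \<sigma> \<le> \<tau> \<Longrightarrow> P \<sigma> \<omega> \<le> P \<tau> \<omega>"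
        by blast+
      have "chain N (mark N (\<lambda>k. x k \<omega>)) (P (s c) \<omega>) = word_state N w c"
        if \<omega>: "\<omega> \<in> A w" "\<omega> \<in> B w" and "c \<le> n" for w c
      proof -
        have "P (s c) \<omega> = jumps w c"
          using \<open>c \<le> n\<close>
        proof (induction c)
          case 0
          show ?case by (simp add: s(2) P0)
        next
          case (Suc c)
          have "P (s (Suc c)) \<omega> - P (s c) \<omega> = y w c"
            using \<omega>(1) Suc.prems unfolding A_def by auto
          then have "P (s (Suc c)) \<omega> = P (s c) \<omega> + y w c"
            using mono[OF s_cell(1)[of c] less_imp_le[OF s_cell(2)[of c]]] by linarith
          then show ?case using Suc by (simp add: y_def)
        qed
        moreover have "mark N (\<lambda>k. x k \<omega>) (jumps w d) = i" if "d < c" "w d = Some i" for d i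
          using \<omega>(2) that \<open>c \<le> n\<close> unfolding B_def by auto
        ultimately show ?thesis by (simp add: chain_jumps)
      qed
      then show ?case by blast
    qed
  qed
qed

section \<open>Comparison of the two walks\<close>

lemma chain_measurable:
  assumes "\<And>j. j < n \<Longrightarrow> (\<lambda>\<omega>. m \<omega> j) \<in> M \<rightarrow>\<^sub>M count_space UNIV"
  shows "(\<lambda>\<omega>. chain N (m \<omega>) n) \<in> M \<rightarrow>\<^sub>M count_space UNIV"
  using assms
proof (induction n)
  case (Suc n)
  have IH: "(\<lambda>\<omega>. chain N (m \<omega>) n) \<in> M \<rightarrow>\<^sub>M count_space UNIV" using Suc by simp
  have m: "(\<lambda>\<omega>. m \<omega> n) \<in> M \<rightarrow>\<^sub>M count_space UNIV" using Suc.prems by simp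
  have "(\<lambda>\<omega>. ring_clock i (chain N (m \<omega>) n)) \<in> M \<rightarrow>\<^sub>M count_space UNIV" for i
    by (rule measurable_compose[OF IH]) simp
  then show ?case
    unfolding chain.simps by (rule measurable_compose_countable[OF _ m])
qed simp

text \<open>
  There are only countably many values, so it suffices to compare the probabilities of points.
\<close>

lemma distr_PiM_eqI:
  fixes X :: "'a \<Rightarrow> 'i \<Rightarrow> 'b::countable" and Y :: "'c \<Rightarrow> 'i \<Rightarrow> 'b"
  assumes "finite_measure M" "finite_measure M'" and "finite T"
    and X: "\<And>\<tau>. \<tau> \<in> T \<Longrightarrow> (\<lambda>\<omega>. X \<omega> \<tau>) \<in> M \<rightarrow>\<^sub>M count_space UNIV"
    and Y: "\<And>\<tau>. \<tau> \<in> T \<Longrightarrow> (\<lambda>\<omega>. Y \<omega> \<tau>) \<in> M' \<rightarrow>\<^sub>M count_space UNIV"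
    and eq: "\<And>\<kappa>. measure M {\<omega> \<in> space M. \<forall>\<tau>\<in>T. X \<omega> \<tau> = \<kappa> \<tau>} = measure M' {\<omega> \<in> space M'. \<forall>\<tau>\<in>T. Y \<omega> \<tau> = \<kappa> \<tau>}"
  shows "distr M (PiM T (\<lambda>_. count_space UNIV)) (\<lambda>\<omega>. \<lambda>\<tau>\<in>T. X \<omega> \<tau>)
    = distr M' (PiM T (\<lambda>_. count_space UNIV)) (\<lambda>\<omega>. \<lambda>\<tau>\<in>T. Y \<omega> \<tau>)"
proof (rule measure_eqI_countable'[where A = "PiE T (\<lambda>_. UNIV)"])
  let ?\<Pi> = "PiM T (\<lambda>_. count_space UNIV) :: ('i \<Rightarrow> 'b) measure"
  have single: "{\<kappa>} \<in> sets ?\<Pi>" if "\<kappa> \<in> PiE T (\<lambda>_. UNIV)" for \<kappa>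
  proof -
    have "{\<kappa>} = PiE T (\<lambda>\<tau>. {\<kappa> \<tau>})"
      using that by (intro PiE_singleton[symmetric]) (simp add: PiE_iff)
    then show ?thesis using sets_PiM_I_finite[OF \<open>finite T\<close>, of "\<lambda>\<tau>. {\<kappa> \<tau>}" "\<lambda>_. count_space UNIV"] by simp
  qed
  show "{\<kappa>} \<in> sets (distr M ?\<Pi> (\<lambda>\<omega>. \<lambda>\<tau>\<in>T. X \<omega> \<tau>))" "{\<kappa>} \<in> sets (distr M' ?\<Pi> (\<lambda>\<omega>. \<lambda>\<tau>\<in>T. Y \<omega> \<tau>))"
    if "\<kappa> \<in> PiE T (\<lambda>_. UNIV)" for \<kappa>
    using single[OF that] by simp_all
  show "countable (PiE T (\<lambda>_. UNIV :: 'b set))"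
    using \<open>finite T\<close> by (rule countable_PiE) simp
  show "emeasure (distr M ?\<Pi> (\<lambda>\<omega>. \<lambda>\<tau>\<in>T. X \<omega> \<tau>)) {\<kappa>} = emeasure (distr M' ?\<Pi> (\<lambda>\<omega>. \<lambda>\<tau>\<in>T. Y \<omega> \<tau>)) {\<kappa>}"
    if \<kappa>: "\<kappa> \<in> PiE T (\<lambda>_. UNIV)" for \<kappa>
  proof -
    have X': "(\<lambda>\<omega>. \<lambda>\<tau>\<in>T. X \<omega> \<tau>) \<in> M \<rightarrow>\<^sub>M ?\<Pi>" and Y': "(\<lambda>\<omega>. \<lambda>\<tau>\<in>T. Y \<omega> \<tau>) \<in> M' \<rightarrow>\<^sub>M ?\<Pi>"
      using X Y by (auto intro!: measurable_restrict)
    have "(\<lambda>\<omega>. \<lambda>\<tau>\<in>T. X \<omega> \<tau>) -` {\<kappa>} \<inter> space M = {\<omega> \<in> space M. \<forall>\<tau>\<in>T. X \<omega> \<tau> = \<kappa> \<tau>}"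
      "(\<lambda>\<omega>. \<lambda>\<tau>\<in>T. Y \<omega> \<tau>) -` {\<kappa>} \<inter> space M' = {\<omega> \<in> space M'. \<forall>\<tau>\<in>T. Y \<omega> \<tau> = \<kappa> \<tau>}"
      using extensional_arb[of \<kappa> T] \<kappa> by (auto simp: fun_eq_iff PiE_iff)
    then show ?thesis
      using eq[of \<kappa>] single[OF \<kappa>] X' Y' assms(1,2)
      by (simp add: emeasure_distr finite_measure.emeasure_eq_measure)
  qed
qed (simp_all add: space_PiM)

lemma approximately_equal:
  fixes a b :: real
  assumes "\<And>\<epsilon>. 0 < \<epsilon> \<Longrightarrow> \<exists>q. a \<in> {q..q + \<epsilon>} \<and> b \<in> {q..q + \<epsilon>}"
  shows "a = b"
proof (rule ccontr)
  assume "a \<noteq> b"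
  then obtain q where "a \<in> {q..q + \<bar>a - b\<bar> / 2}" "b \<in> {q..q + \<bar>a - b\<bar> / 2}"
    using assms[of "\<bar>a - b\<bar> / 2"] by auto
  then have "\<bar>a - b\<bar> \<le> \<bar>a - b\<bar> / 2" unfolding atLeastAtMost_iff by linarith
  then show False using \<open>a \<noteq> b\<close> by simp
qed

theorem theorem1p2:
  fixes N :: nat and t :: real
    and M :: "'a measure" and P :: "real \<Rightarrow> 'a \<Rightarrow> nat"
    and U V :: "nat \<Rightarrow> 'a \<Rightarrow> 'p::prime_card padic_int mat"
    and X :: "real \<Rightarrow> 'a \<Rightarrow> 'p padic mat"
    and M' :: "'b measure" and S :: "real \<Rightarrow> 'b \<Rightarrow> int list"
  assumes N: "N \<ge> 1"
    and t: "t = 1 / real CARD('p)"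
    and M: "prob_space M"
    and P: "poisson_process M 1 P"
    and haar_U: "\<And>i. i \<ge> 1 \<Longrightarrow> haar_prob_measure N (distr M (GL_Zp_borel N) (U i))"
    and haar_V: "\<And>i. i \<ge> 1 \<Longrightarrow> haar_prob_measure N (distr M (GL_Zp_borel N) (V i))"
    and indep_UV: "prob_space.indep_vars M (\<lambda>_. GL_Zp_borel N) (case_sum U V) matrix_index"
    and indep_P: "prob_space.indep_set M
        (sets (vimage_algebra (space M) (trajectory P) path_space))
        (sets (vimage_algebra (space M) (\<lambda>\<omega>. \<lambda>k\<in>matrix_index. case_sum U V k \<omega>)
          (PiM matrix_index (\<lambda>_. GL_Zp_borel N))))"
    and X: "\<And>\<tau> \<omega>. \<tau> \<ge> 0 \<Longrightarrow> \<omega> \<in> space M \<Longrightarrow>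
        X \<tau> \<omega> = matrix_product N (\<lambda>i. U i \<omega>) (\<lambda>i. V i \<omega>) (P \<tau> \<omega>)"
    and S: "reflected_poisson_walk N t M' S"
  shows "(\<forall>\<tau>\<ge>0. (\<lambda>\<omega>. SN N (X \<tau> \<omega>)) \<in> M \<rightarrow>\<^sub>M count_space UNIV) \<and>
    (\<forall>T. finite T \<and> T \<subseteq> {0..} \<longrightarrow>
       distr M (PiM T (\<lambda>_. count_space UNIV)) (\<lambda>\<omega>. \<lambda>\<tau>\<in>T. SN N (X \<tau> \<omega>))
       = distr M' (PiM T (\<lambda>_. count_space UNIV))
           (\<lambda>\<omega>. \<lambda>\<tau>\<in>T. S ((1 / t) * ((1 - t) / (1 - t ^ N)) * \<tau>) \<omega>))"
proof -
  interpret M: prob_space M by fact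
  interpret M': prob_space M' using S by (simp add: reflected_poisson_walk_def)
  define x where "x = case_sum U V"
  define R where "R = (\<Sum>i<N. t ^ (i + 1))"
  have "0 < N" using N by simp
  have "1 < CARD('p)" by (rule nontriv)
  then have t01: "0 < t" "t < 1" unfolding t by simp_all
  have R: "0 < R" unfolding R_def using \<open>0 < N\<close> t01 by (intro sum_pos) auto
  \<comment> \<open>The change of time divides by the total rate \<open>R\<close> of the clocks.\<close>
  have R_eq: "(1 / t) * ((1 - t) / (1 - t ^ N)) = 1 / R"
  proof -
    have "R = t * (\<Sum>i<N. t ^ i)" by (simp add: R_def sum_distrib_left)
    also have "(\<Sum>i<N. t ^ i) = (1 - t ^ N) / (1 - t)" using t01 by (simp add: sum_gp_strict)
    finally have "R = t * ((1 - t ^ N) / (1 - t))" .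
    then show ?thesis
      by (simp only: times_divide_eq_right times_divide_eq_left divide_divide_eq_left
          divide_divide_eq_right mult_1)
  qed
  have weight: "lead_weight CARD('p) N i = t ^ (i + 1) / R" if "i < N" for i
    unfolding R_def t by (rule lead_weight_eq[OF that \<open>1 < CARD('p)\<close>])
  have weight_sum: "(\<Sum>i<N. lead_weight CARD('p) N i) = 1"
  proof -
    have "(\<Sum>i<N. lead_weight CARD('p) N i) = (\<Sum>i<N. t ^ (i + 1) / R)"
      by (rule sum.cong) (simp_all only: weight lessThan_iff)
    also have "\<dots> = (\<Sum>i<N. t ^ (i + 1)) / R" by (simp only: sum_divide_distrib)
    also have "\<dots> = 1" unfolding R_def[symmetric] using R by simp
    finally show ?thesis .
  qed
  have haar: "haar_prob_measure N (distr M (GL_Zp_borel N) (x (Inr i)))" if "1 \<le> i" for i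
    using haar_V[OF that] by (simp add: x_def)
  have indep: "M.indep_vars (\<lambda>_. GL_Zp_borel N) x matrix_index"
    unfolding x_def by (rule indep_UV)
  have indep_x: "M.indep_set
      (sets (vimage_algebra (space M) (trajectory P) path_space))
      (sets (vimage_algebra (space M) (\<lambda>\<omega>. \<lambda>k\<in>matrix_index. x k \<omega>)
        (PiM matrix_index (\<lambda>_. GL_Zp_borel N))))"
    unfolding x_def by (rule indep_P)
  have rv: "x k \<in> M \<rightarrow>\<^sub>M GL_Zp_borel N" if "k \<in> matrix_index" for k
    using indep that by (auto simp: M.indep_vars_def2)
  have SN_X: "SN N (X \<tau> \<omega>) = chain N (mark N (\<lambda>k. x k \<omega>)) (P \<tau> \<omega>)"
    if "0 \<le> \<tau>" "\<omega> \<in> space M" for \<tau> \<omega>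
  proof -
    have "(\<lambda>k. x k \<omega>) \<in> index_upto (P \<tau> \<omega>) \<rightarrow> GL_Zp N"
      using measurable_space[OF rv that(2)] index_upto_subset[of "P \<tau> \<omega>"] by auto
    from SN_matrix_product[OF \<open>0 < N\<close> this] show ?thesis
      by (simp add: X[OF that] x_def)
  qed
  have P_meas: "P \<tau> \<in> M \<rightarrow>\<^sub>M count_space UNIV" if "0 \<le> \<tau>" for \<tau>
    using P that by (simp add: poisson_process_def)
  have SN_meas: "(\<lambda>\<omega>. SN N (X \<tau> \<omega>)) \<in> M \<rightarrow>\<^sub>M count_space UNIV" if "0 \<le> \<tau>" for \<tau>
  proof -
    have mark_meas: "(\<lambda>\<omega>. mark N (\<lambda>k. x k \<omega>) j) \<in> M \<rightarrow>\<^sub>M count_space UNIV" for j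
    proof -
      have "(\<lambda>\<omega>. \<lambda>k\<in>matrix_index. x k \<omega>) \<in> M \<rightarrow>\<^sub>M matrix_space N matrix_index"
        using rv by (intro measurable_restrict) auto
      from measurable_compose[OF this mark_measurable[OF \<open>0 < N\<close> index_upto_subset]]
      have "(\<lambda>\<omega>. mark N (\<lambda>k\<in>matrix_index. x k \<omega>) j) \<in> M \<rightarrow>\<^sub>M count_space UNIV" .
      moreover have "mark N (\<lambda>k\<in>matrix_index. x k \<omega>) j = mark N (\<lambda>k. x k \<omega>) j" for \<omega>
        using index_upto_subset[of "Suc j"] by (intro mark_cong) auto
      ultimately show ?thesis by (simp only:)
    qed
    have "(\<lambda>\<omega>. chain N (mark N (\<lambda>k. x k \<omega>)) (P \<tau> \<omega>)) \<in> M \<rightarrow>\<^sub>M count_space UNIV"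
      by (rule measurable_compose_countable[OF chain_measurable P_meas[OF that]]) (rule mark_meas)
    then show ?thesis
      by (rule measurable_cong[THEN iffD1, rotated]) (simp add: SN_X[OF that])
  qed
  have S_meas: "S \<tau> \<in> M' \<rightarrow>\<^sub>M count_space UNIV" if "0 \<le> \<tau>" for \<tau>
    using S that by (simp add: reflected_poisson_walk_def)
  have same: "M.prob {\<omega> \<in> space M. \<forall>\<tau>\<in>T. SN N (X \<tau> \<omega>) = \<kappa> \<tau>}
      = M'.prob {\<omega> \<in> space M'. \<forall>\<tau>\<in>T. S (\<tau> / R) \<omega> = \<kappa> \<tau>}"
    if T: "finite T" "T \<subseteq> {0..}" for T :: "real set" and \<kappa>
  proof (rule approximately_equal)
    fix \<epsilon> :: real assume "0 < \<epsilon>"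
    \<comment> \<open>The matrix walk is observed along \<open>s\<close> and the reflected walk along \<open>s / R\<close>, so that each word
      has the same weight for both of them.\<close>
    obtain s n where s: "strict_mono s" "s 0 = 0" "T \<subseteq> s ` {..n}" "(\<Sum>c<n. (s (Suc c) - s c)\<^sup>2) \<le> \<epsilon>"
      by (rule ex_fine_partition[OF T \<open>0 < \<epsilon>\<close>])
    have s_cell: "s c < s (Suc c)" for c using s(1) by (simp add: strict_mono_less)
    define good where "good w \<longleftrightarrow> (\<forall>c\<le>n. s c \<in> T \<longrightarrow> word_state N w c = \<kappa> (s c))" for w
    define q where "q w = (\<Prod>c<n. cell_weight (lead_weight CARD('p) N) (s (Suc c) - s c) (w c))" for w
    let ?Q = "\<Sum>w\<in>{w \<in> words N n. good w}. q w"
    have T_iff: "(\<forall>\<tau>\<in>T. F \<tau>) \<longleftrightarrow> (\<forall>c\<le>n. s c \<in> T \<longrightarrow> F (s c))" for F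
      using s(3) by (auto simp: subset_iff image_iff)
    have mass: "1 - (\<Sum>w\<in>words N n. q w) \<le> \<epsilon>"
      using sum_word_weights_ge[OF weight_sum, of n "\<lambda>c. s (Suc c) - s c"] s_cell s(4)
      by (force simp: q_def less_imp_le)
    obtain E where E: "\<forall>w\<in>words N n. E w \<in> sets M"
      "\<forall>w\<in>words N n. M.prob (E w) = q w" "disjoint_family_on E (words N n)"
      "AE \<omega> in M. \<forall>w\<in>words N n. \<omega> \<in> E w \<longrightarrow>
        (\<forall>c\<le>n. chain N (mark N (\<lambda>k. x k \<omega>)) (P (s c) \<omega>) = word_state N w c)"
      unfolding q_def by (rule product_walk_words[where n = n, OF \<open>0 < N\<close> P haar indep indep_x s(1,2)])
    have X_event: "{\<omega> \<in> space M. \<forall>\<tau>\<in>T. SN N (X \<tau> \<omega>) = \<kappa> \<tau>} \<in> sets M"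
      using T SN_meas by (intro joint_event_sets) (auto simp: subset_iff)
    have "M.prob {\<omega> \<in> space M. \<forall>\<tau>\<in>T. SN N (X \<tau> \<omega>) = \<kappa> \<tau>} \<in> {?Q..?Q + (1 - (\<Sum>w\<in>words N n. q w))}"
    proof (rule M.word_approximation[OF finite_words bspec[OF E(1)] bspec[OF E(2)] E(3) _ X_event])
      show "AE \<omega> in M. \<forall>w\<in>words N n. \<omega> \<in> E w \<longrightarrow> ((\<forall>\<tau>\<in>T. SN N (X \<tau> \<omega>) = \<kappa> \<tau>) \<longleftrightarrow> good w)"
        using E(4) AE_space
      proof eventually_elim
        case (elim \<omega>)
        have "SN N (X (s c) \<omega>) = word_state N w c"
          if "w \<in> words N n" "\<omega> \<in> E w" "c \<le> n" "s c \<in> T" for w c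
          using elim that T(2) by (subst SN_X) auto
        then show ?case unfolding T_iff good_def by auto
      qed
    qed
    moreover obtain E' where E': "\<forall>w\<in>words N n. E' w \<in> sets M'"
      "\<forall>w\<in>words N n. M'.prob (E' w)
        = (\<Prod>c<n. cell_weight (\<lambda>i. t ^ (i + 1) / R) (R * (s (Suc c) / R - s c / R)) (w c))"
      "disjoint_family_on E' (words N n)"
      "AE \<omega> in M'. \<forall>w\<in>words N n. \<omega> \<in> E' w \<longrightarrow> (\<forall>c\<le>n. S (s c / R) \<omega> = word_state N w c)"
    proof (rule reflected_poisson_walk_words[OF S \<open>0 < N\<close> t01(1), of "\<lambda>c. s c / R" n, folded R_def])
      show "strict_mono (\<lambda>c. s c / R)"
        using s(1) R by (simp add: strict_mono_def divide_strict_right_mono)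
    qed (simp_all add: s(2))
    have E'_q: "M'.prob (E' w) = q w" if "w \<in> words N n" for w
      unfolding bspec[OF E'(2) that] q_def
    proof (rule prod.cong[OF refl])
      fix c assume "c \<in> {..<n}"
      then have "w c \<in> insert None (Some ` {..<N})" using that by (auto simp: PiE_iff)
      moreover have "R * (s (Suc c) / R - s c / R) = s (Suc c) - s c" using R by (simp add: right_diff_distrib)
      ultimately show "cell_weight (\<lambda>i. t ^ (i + 1) / R) (R * (s (Suc c) / R - s c / R)) (w c)
          = cell_weight (lead_weight CARD('p) N) (s (Suc c) - s c) (w c)"
        by (auto simp: cell_weight_def weight)
    qed
    have S_event: "{\<omega> \<in> space M'. \<forall>\<tau>\<in>T. S (\<tau> / R) \<omega> = \<kappa> \<tau>} \<in> sets M'"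
      using T R S_meas by (intro joint_event_sets) (auto simp: subset_iff)
    have "M'.prob {\<omega> \<in> space M'. \<forall>\<tau>\<in>T. S (\<tau> / R) \<omega> = \<kappa> \<tau>} \<in> {?Q..?Q + (1 - (\<Sum>w\<in>words N n. q w))}"
    proof (rule M'.word_approximation[OF finite_words bspec[OF E'(1)] E'_q E'(3) _ S_event])
      show "AE \<omega> in M'. \<forall>w\<in>words N n. \<omega> \<in> E' w \<longrightarrow> ((\<forall>\<tau>\<in>T. S (\<tau> / R) \<omega> = \<kappa> \<tau>) \<longleftrightarrow> good w)"
        using E'(4) by eventually_elim (simp add: T_iff good_def)
    qed
    ultimately show "\<exists>q. M.prob {\<omega> \<in> space M. \<forall>\<tau>\<in>T. SN N (X \<tau> \<omega>) = \<kappa> \<tau>} \<in> {q..q + \<epsilon>} \<and>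
        M'.prob {\<omega> \<in> space M'. \<forall>\<tau>\<in>T. S (\<tau> / R) \<omega> = \<kappa> \<tau>} \<in> {q..q + \<epsilon>}"
      using mass by (intro exI[of _ ?Q]) auto
  qed
  show ?thesis
  proof (intro conjI allI impI)
    show "(\<lambda>\<omega>. SN N (X \<tau> \<omega>)) \<in> M \<rightarrow>\<^sub>M count_space UNIV" if "0 \<le> \<tau>" for \<tau>
      by (rule SN_meas[OF that])
  next
    fix T :: "real set" assume T: "finite T \<and> T \<subseteq> {0..}"
    show "distr M (PiM T (\<lambda>_. count_space UNIV)) (\<lambda>\<omega>. \<lambda>\<tau>\<in>T. SN N (X \<tau> \<omega>))
       = distr M' (PiM T (\<lambda>_. count_space UNIV))
           (\<lambda>\<omega>. \<lambda>\<tau>\<in>T. S ((1 / t) * ((1 - t) / (1 - t ^ N)) * \<tau>) \<omega>)"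
      unfolding R_eq
    proof (rule distr_PiM_eqI)
      show "finite_measure M" "finite_measure M'" by unfold_locales
    qed (use T R same SN_meas S_meas in \<open>auto simp: subset_iff\<close>)
  qed
qed

end
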